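(* Let $\Omega\subset\mathbb{R}^2\cong\mathbb{C}$, $(\Omega_n)_{n\in\mathbb{N}}$ and $(\nu_n)_{n\in\mathbb{N}}$ satisfy the standing setup, Condition W and Condition D (parts (a), (b), (c)) described in the context, assume $I_{214}(n)\ge I_{14}(n+1)$ and that $-\ln\nu_n$ is subharmonic on $\Omega$ for every $n\in\mathbb{N}$. Then $\bar\partial\colon\mathcal{EV}(\Omega)\to\mathcal{EV}(\Omega)$ is surjective.
   Context: Standing setup: identify $\mathbb{R}^2$ with $\mathbb{C}$; $|\cdot|$ Euclidean norm, $\|\cdot\|_\infty$ max-norm, $\mathbb{B}_r(x)$ open Euclidean ball, $\operatorname{dist}(M_0,M_1):=\inf_{x\in M_0,y\in M_1}|x-y|$ ($\infty$ if a set is empty). $\Omega\subset\mathbb{R}^2$ open, $(\Omega_n)_{n\in\mathbb{N}}$ non-empty open with $\Omega_n\neq\mathbb{R}^2$, $\Omega_n\subset\Omega_{n+1}$, $\Omega=\bigcup_n\Omega_n$, $d_{n,k}:=\operatorname{dist}(\Omega_n,\partial\Omega_k)>0$ for $k>n$; $\nu_n\colon\Omega\to(0,\infty)$ continuous, $\nu_n\le\nu_{n+1}$. $|f|_{n,m}:=\sup_{x\in\Omega_n,\beta\in\mathbb{N}_0^2,|\beta|\le m}|\partial^\beta f(x)|\nu_n(x)$; $\mathcal{E}\nu_n(\Omega_n)$: smooth $\mathbb{C}$-valued $f$ on $\Omega_n$ with all $|f|_{n,m}<\infty$; $\mathcal{E}\nu_{n,\bar\partial}(\Omega_n)$: those with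 $\bar\partial f=0$, $\bar\partial=\frac12(\partial_1+i\partial_2)$. $\mathcal{EV}(\Omega):=\{f\in\mathcal{C}^\infty(\Omega,\mathbb{C})\mid f|_{\Omega_n}\in\mathcal{E}\nu_n(\Omega_n)\ \forall n\}$. Condition W: for every $k\in\mathbb{N}$ there is $\rho_k$ with $0<\rho_k<\inf\{\|x-y\|_\infty\mid y\in\partial\Omega_{k+1}\}$ for all $x\in\Omega_k$, and for every $k,n\in\mathbb{N}$ there are $J_1(n),J_2(n)\ge n$ and $C_1(n),C_2(n)>0$ (possibly depending on $k$) such that for all $x\in\Omega_k$: $\sup_{\|\zeta\|_\infty\le\rho_k}\nu_n(x+\zeta)\le C_1(n)\inf_{\|\zeta\|_\infty\le\rho_k}\nu_{J_1(n)}(x+\zeta)$ and $\nu_n(x)\le C_2(n)(1+|x|^2)^{-2}\nu_{J_2(n)}(x)$. Condition D: (a) for every $n$ there are $g_n\in\mathcal{O}(\mathbb{C})$ with $g_n(0)=1$ and integers $I_1(n),I_2(n)>n$ such that (i) for every $\varepsilon>0$ there is compact $K\subset\overline{\Omega_n}$ with $\nu_n\le\varepsilon\nu_{I_1(n)}$ on $\Omega_n\setminus K$; (ii) there is an open $X_{I_2(n)}\subset\mathbb{R}^2\setminus\overline{\Omega_{I_2(n)}}$, reals $R_n,r_n$ with $0<2R_n<\delta_n:=\operatorname{dist}(X_{I_2(n)},\Omega_{I_2(n)})$, $R_n<r_n<\delta_n-R_n$, and $A_2(\cdot,n)\colon X_{I_2(n)}+\mathbb{B}_{R_n}(0)\to(0,\infty)$,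 locally bounded on $X_{I_2(n)}$, with $\max\{|g_n(\zeta)|\nu_{I_2(n)}(z)\mid|\zeta-(z-x)|=r_n\}\le A_2(x,n)$ for all $z\in\Omega_{I_2(n)}$, $x\in X_{I_2(n)}+\mathbb{B}_{R_n}(0)$; (iii) for every compact $K$ there is $A_3(n,K)>0$ with $\int_K\frac{|g_n(x-y)|\nu_n(x)}{|x-y|}dy\le A_3(n,K)$ for all $x\in\Omega_n$. (b) for every $n$ there are $I_4(n)>n$, $A_4(n)>0$ such that, with $I_{14}(n):=I_1(I_4(n))$, $\int_{\Omega_{I_4(n)}}\frac{|g_{I_{14}(n)}(x-y)|\nu_p(x)}{|x-y|\nu_k(y)}dy\le A_4(n)$ for all $x\in\Omega_p$, for $(k,p)=(I_4(n),n)$ and $(k,p)=(I_{14}(n),I_{14}(n))$. (c) with $I_{214}(n):=I_2(I_{14}(n))$ and $X_{I_{214}(n)}$ the open set of (a)(ii) for the index $I_{14}(n)$: for every $n$, every closed $M\subset\overline{\Omega_n}$ and every connected component $N$ of $\mathbb{R}^2\setminus M$ with $N\cap(\mathbb{R}^2\setminus\overline{\Omega_n})\ne\emptyset$ one has $N\cap X_{I_{214}(n)}\ne\emptyset$. *)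

theory Defs
  imports "HOL-Analysis.Analysis"
begin

definition maxnorm :: "complex \<Rightarrow> real" where
  "maxnorm z = max \<bar>Re z\<bar> \<bar>Im z\<bar>"

definition edist_set :: "complex set \<Rightarrow> complex set \<Rightarrow> ereal" where
  "edist_set A B = (if A = {} \<or> B = {} then \<infinity> else ereal (setdist A B))"

definition partial_dir :: "complex \<Rightarrow> (complex \<Rightarrow> complex) \<Rightarrow> complex \<Rightarrow> complex" where
  "partial_dir e f x = vector_derivative (\<lambda>t::real. f (x + of_real t * e)) (at 0)"

fun iter_partial :: "complex list \<Rightarrow> (complex \<Rightarrow> complex) \<Rightarrow> complex \<Rightarrow> complex" where
  "iter_partial [] f = f"
| "iter_partial (e # es) f = partial_dir e (iter_partial es f)"

definition Cinf_on :: "complex set \<Rightarrow> (complex \<Rightarrow> complex) \<Rightarrow> bool" where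
  "Cinf_on U f \<longleftrightarrow> (\<forall>es. set es \<subseteq> {1, \<i>} \<longrightarrow>
      continuous_on U (iter_partial es f) \<and>
      (\<forall>x\<in>U. \<forall>e\<in>{1, \<i>}. (\<lambda>t::real. iter_partial es f (x + of_real t * e)) differentiable (at 0)))"

definition partial_beta :: "nat \<Rightarrow> nat \<Rightarrow> (complex \<Rightarrow> complex) \<Rightarrow> complex \<Rightarrow> complex" where
  "partial_beta a b f = iter_partial (replicate a 1 @ replicate b \<i>) f"

definition in_Enu :: "(complex \<Rightarrow> real) \<Rightarrow> complex set \<Rightarrow> (complex \<Rightarrow> complex) \<Rightarrow> bool" where
  "in_Enu w U f \<longleftrightarrow> Cinf_on U f \<and>
     (\<forall>m. \<exists>C. \<forall>x\<in>U. \<forall>a b. a + b \<le> m \<longrightarrow> cmod (partial_beta a b f x) * w x \<le> C)"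

definition EV :: "complex set \<Rightarrow> (nat \<Rightarrow> complex set) \<Rightarrow> (nat \<Rightarrow> complex \<Rightarrow> real) \<Rightarrow> (complex \<Rightarrow> complex) set" where
  "EV \<Omega> \<Omega>s \<nu> = {f. Cinf_on \<Omega> f \<and> (\<forall>n. in_Enu (\<nu> n) (\<Omega>s n) f)}"

definition dbar :: "(complex \<Rightarrow> complex) \<Rightarrow> complex \<Rightarrow> complex" where
  "dbar f x = (partial_dir 1 f x + \<i> * partial_dir \<i> f x) / 2"

definition subharmonic_on :: "complex set \<Rightarrow> (complex \<Rightarrow> real) \<Rightarrow> bool" where
  "subharmonic_on U u \<longleftrightarrow>
     (\<forall>x\<in>U. \<forall>a. u x < a \<longrightarrow> eventually (\<lambda>y. u y < a) (at x within U)) \<and>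
     (\<forall>z r. 0 < r \<longrightarrow> cball z r \<subseteq> U \<longrightarrow>
        (\<lambda>t. u (z + of_real r * cis t)) integrable_on {0..2*pi} \<and>
        u z \<le> (1 / (2*pi)) * integral {0..2*pi} (\<lambda>t. u (z + of_real r * cis t)))"

definition standing_setup :: "complex set \<Rightarrow> (nat \<Rightarrow> complex set) \<Rightarrow> (nat \<Rightarrow> complex \<Rightarrow> real) \<Rightarrow> bool" where
  "standing_setup \<Omega> \<Omega>s \<nu> \<longleftrightarrow>
     open \<Omega> \<and>
     (\<forall>n. open (\<Omega>s n) \<and> \<Omega>s n \<noteq> {} \<and> \<Omega>s n \<noteq> UNIV \<and> \<Omega>s n \<subseteq> \<Omega>s (Suc n)) \<and>
     \<Omega> = (\<Union>n. \<Omega>s n) \<and>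
     (\<forall>n k. n < k \<longrightarrow> 0 < edist_set (\<Omega>s n) (frontier (\<Omega>s k))) \<and>
     (\<forall>n. continuous_on \<Omega> (\<nu> n) \<and> (\<forall>x\<in>\<Omega>. 0 < \<nu> n x \<and> \<nu> n x \<le> \<nu> (Suc n) x))"

definition condW :: "(nat \<Rightarrow> complex set) \<Rightarrow> (nat \<Rightarrow> complex \<Rightarrow> real) \<Rightarrow> bool" where
  "condW \<Omega>s \<nu> \<longleftrightarrow> (\<exists>\<rho>::nat \<Rightarrow> real. \<forall>k.
     0 < \<rho> k \<and>
     (\<forall>x\<in>\<Omega>s k. \<exists>\<delta>>\<rho> k. \<forall>y\<in>frontier (\<Omega>s (Suc k)). \<delta> \<le> maxnorm (x - y)) \<and>
     (\<forall>n. \<exists>J1 J2 C1 C2. J1 \<ge> n \<and> J2 \<ge> n \<and> 0 < C1 \<and> 0 < C2 \<and>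
        (\<forall>x\<in>\<Omega>s k.
           (\<forall>\<zeta> \<zeta>'. maxnorm \<zeta> \<le> \<rho> k \<longrightarrow> maxnorm \<zeta>' \<le> \<rho> k \<longrightarrow>
               \<nu> n (x + \<zeta>) \<le> C1 * \<nu> J1 (x + \<zeta>')) \<and>
           \<nu> n x \<le> C2 * (1 + (cmod x)^2) powi (-2) * \<nu> J2 x)))"

definition condD_a :: "(nat \<Rightarrow> complex set) \<Rightarrow> (nat \<Rightarrow> complex \<Rightarrow> real) \<Rightarrow>
    (nat \<Rightarrow> complex \<Rightarrow> complex) \<Rightarrow> (nat \<Rightarrow> nat) \<Rightarrow> (nat \<Rightarrow> nat) \<Rightarrow>
    (nat \<Rightarrow> complex set) \<Rightarrow> (nat \<Rightarrow> real) \<Rightarrow> (nat \<Rightarrow> real) \<Rightarrow> bool" where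
  "condD_a \<Omega>s \<nu> g I1 I2 X R r \<longleftrightarrow> (\<forall>n.
     g n holomorphic_on UNIV \<and> g n 0 = 1 \<and> I1 n > n \<and> I2 n > n \<and>
     \<comment> \<open>(i)\<close>
     (\<forall>\<epsilon>>0. \<exists>K. compact K \<and> K \<subseteq> closure (\<Omega>s n) \<and>
        (\<forall>x\<in>\<Omega>s n - K. \<nu> n x \<le> \<epsilon> * \<nu> (I1 n) x)) \<and>
     \<comment> \<open>(ii): X n is the set called X_{I2(n)} in the paper\<close>
     (open (X n) \<and> X n \<subseteq> - closure (\<Omega>s (I2 n)) \<and>
      0 < 2 * R n \<and> ereal (2 * R n) < edist_set (X n) (\<Omega>s (I2 n)) \<and>
      R n < r n \<and> ereal (r n + R n) < edist_set (X n) (\<Omega>s (I2 n)) \<and>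
      (\<exists>A2 :: complex \<Rightarrow> real.
         (\<forall>x\<in>(\<Union>y\<in>X n. ball y (R n)). 0 < A2 x) \<and>
         (\<forall>x\<in>X n. \<exists>e>0. \<exists>B. \<forall>y\<in>ball x e \<inter> (\<Union>y\<in>X n. ball y (R n)). A2 y \<le> B) \<and>
         (\<forall>z\<in>\<Omega>s (I2 n). \<forall>x\<in>(\<Union>y\<in>X n. ball y (R n)). \<forall>\<zeta>.
             cmod (\<zeta> - (z - x)) = r n \<longrightarrow> cmod (g n \<zeta>) * \<nu> (I2 n) z \<le> A2 x))) \<and>
     \<comment> \<open>(iii)\<close>
     (\<forall>K. compact K \<longrightarrow> (\<exists>A3>0. \<forall>x\<in>\<Omega>s n.
         (\<integral>\<^sup>+ y. ennreal (cmod (g n (x - y)) * \<nu> n x / cmod (x - y)) * indicator K y \<partial>lborel)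
           \<le> ennreal A3)))"

definition condD_b :: "(nat \<Rightarrow> complex set) \<Rightarrow> (nat \<Rightarrow> complex \<Rightarrow> real) \<Rightarrow>
    (nat \<Rightarrow> complex \<Rightarrow> complex) \<Rightarrow> (nat \<Rightarrow> nat) \<Rightarrow> (nat \<Rightarrow> nat) \<Rightarrow> bool" where
  "condD_b \<Omega>s \<nu> g I1 I4 \<longleftrightarrow> (\<forall>n. I4 n > n \<and> (\<exists>A4>0.
     \<forall>(k, p) \<in> {(I4 n, n), (I1 (I4 n), I1 (I4 n))}. \<forall>x\<in>\<Omega>s p.
       (\<integral>\<^sup>+ y. ennreal (cmod (g (I1 (I4 n)) (x - y)) * \<nu> p x / (cmod (x - y) * \<nu> k y))
             * indicator (\<Omega>s (I4 n)) y \<partial>lborel) \<le> ennreal A4))"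

definition condD_c :: "(nat \<Rightarrow> complex set) \<Rightarrow> (nat \<Rightarrow> nat) \<Rightarrow> (nat \<Rightarrow> nat) \<Rightarrow>
    (nat \<Rightarrow> complex set) \<Rightarrow> bool" where
  "condD_c \<Omega>s I1 I4 X \<longleftrightarrow> (\<forall>n M N. closed M \<longrightarrow> M \<subseteq> closure (\<Omega>s n) \<longrightarrow>
     N \<in> components (- M) \<longrightarrow> N \<inter> - closure (\<Omega>s n) \<noteq> {} \<longrightarrow>
     N \<inter> X (I1 (I4 n)) \<noteq> {})"

end

theory Submission
  imports Defs "HOL-Complex_Analysis.Complex_Analysis"
begin

text \<open>
  The kernels \<open>g(x - y)/(x - y)\<close> are fundamental solutions of \<open>dbar\<close> up to a constant, because \<open>g\<close> is
  entire with \<open>g(0) = 1\<close>; no \<open>L\<^sup>2\<close> theory enters. Condition (b)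
  makes the convolution of such a kernel with \<open>f\<close> converge on \<open>\<Omega>s m\<close> with the weighted bound, which
  solves the equation on every \<open>\<Omega>s m\<close>.

  To correct these local solutions, one approximates a weighted holomorphic \<open>F\<close> on a large \<open>\<Omega>s q\<close>, in
  the norm of \<open>\<Omega>s n\<close>, by functions holomorphic on a still larger set. The Pompeiu formula writes \<open>F\<close> on
  \<open>\<Omega>s n\<close> as an integral of the kernel against \<open>dbar \<psi> F\<close> for a cutoff \<open>\<psi>\<close>; (a)(i) cuts the integral down
  to a compact set of poles \<open>y\<close> and Riemann sums reduce the claim to a single kernel with a pole outside
  the closure of \<open>\<Omega>s n\<close>. For \<open>y\<close> in \<open>X\<close> this kernel is admissible by (a)(ii). It depends
  holomorphically on \<open>y\<close> and is locally bounded by (a)(iii), so admissibility spreads over each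
  component of the complement, and every component meets \<open>X\<close> by (c). A Mittag-Leffler argument gives a
  global solution, and condition W turns its weighted sup-bounds into bounds for all derivatives.
\<close>

section \<open>Smooth functions\<close>

text \<open>The choice of indices drives the argument. A holomorphic \<open>F\<close> can be
  approximated on \<open>\<Omega>s n\<close> once it is weight-bounded on
  \<open>\<Omega>s (I1 (I4 n))\<close>, and the approximants then live on
  \<open>\<Omega>s (I2 (I1 (I4 n)))\<close>. The n-th term of the Mittag-Leffler sequence therefore
  solves the equation on \<open>\<Omega>s (I1 (I4 n))\<close>, and
  \<open>I2 (I1 (I4 n)) \<ge> I1 (I4 (Suc n))\<close> says that the correction reaches as far as the
  next term must. The two pairs in (b) have different tasks: \<open>(I4 n, n)\<close> bounds the
  local solutions and the part of the Pompeiu integral outside a compact set, the other pair makes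
  that integral converge.

  The sets may be unbounded, while the convolution calculus covers compactly supported functions.
  Formulas are proved for truncations and passed to the limit by dominated convergence; the limit
  still solves the equation because differences of solutions are holomorphic and locally bounded.

  Admissibility spreads from pole to pole without duality: Taylor coefficients in the pole are
  limits of combinations of kernels already admissible, and Taylor polynomials reach the rest of a
  disc.\<close>

definition has_pd :: "complex \<Rightarrow> (complex \<Rightarrow> complex) \<Rightarrow> complex \<Rightarrow> complex \<Rightarrow> bool" where
  "has_pd e f d x \<longleftrightarrow> ((\<lambda>t::real. f (x + of_real t * e)) has_vector_derivative d) (at 0)"

text \<open>\<open>partial_dir\<close> has an unspecified value where the derivative fails to exist.
  Calculations therefore run with the relation \<open>has_pd\<close>, which carries existence, and
  this rule is the way back.\<close>

lemma has_pd_partial_dir: "has_pd e f d x \<Longrightarrow> partial_dir e f x = d"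
  unfolding has_pd_def partial_dir_def by (rule vector_derivative_at)

lemma has_pd_transform:
  assumes "has_pd e f d x" "open U" "x \<in> U" "\<And>y. y \<in> U \<Longrightarrow> f y = g y"
  shows "has_pd e g d x"
proof -
  have "open ((\<lambda>t::real. x + of_real t * e) -` U)"
    by (rule open_vimage[OF \<open>open U\<close>]) (intro continuous_intros)
  from has_vector_derivative_transform_within_open
    [OF assms(1)[unfolded has_pd_def] this, of "\<lambda>t. g (x + of_real t * e)"]
  show ?thesis unfolding has_pd_def using assms by simp
qed

lemma has_pd_add: "has_pd e f d x \<Longrightarrow> has_pd e g d' x \<Longrightarrow> has_pd e (\<lambda>z. f z + g z) (d + d') x"
  unfolding has_pd_def by (rule has_vector_derivative_add)

lemma has_pd_diff: "has_pd e f d x \<Longrightarrow> has_pd e g d' x \<Longrightarrow> has_pd e (\<lambda>z. f z - g z) (d - d') x"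
  unfolding has_pd_def by (rule has_vector_derivative_diff)

lemma has_pd_mult:
  "has_pd e f d x \<Longrightarrow> has_pd e g d' x \<Longrightarrow> has_pd e (\<lambda>z. f z * g z) (d * g x + f x * d') x"
  unfolding has_pd_def
  by (drule (1) has_vector_derivative_mult) (simp add: add.commute)

lemma has_pd_const: "has_pd e (\<lambda>_. c) 0 x"
  unfolding has_pd_def by simp

lemma has_pd_translate: "has_pd e (\<lambda>z. f (z - a)) d x \<longleftrightarrow> has_pd e f d (x - a)"
  unfolding has_pd_def by (simp add: algebra_simps)

lemma has_pd_reflect:
  assumes "has_pd e f d (a - x)"
  shows "has_pd e (\<lambda>z. f (a - z)) (- d) x"
proof -
  have "((\<lambda>t::real. f (a - x + of_real (- t) * e)) has_vector_derivative (-1) *\<^sub>R d) (at 0)"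
    using assms unfolding has_pd_def
    by (intro vector_diff_chain_at[of uminus "-1" 0
          "\<lambda>t::real. f (a - x + of_real t * e)" d, unfolded comp_def])
      (auto intro!: derivative_eq_intros)
  then show ?thesis unfolding has_pd_def by (simp add: algebra_simps)
qed

lemma has_pd_field_derivative:
  assumes "(f has_field_derivative d) (at x)"
  shows "has_pd e f (e * d) x"
proof -
  have "((\<lambda>t::real. x + of_real t * e) has_vector_derivative e) (at 0)"
    by (auto intro!: derivative_eq_intros simp: has_vector_derivative_def scaleR_conv_of_real)
  from field_vector_diff_chain_at[OF this, of f d] assms show ?thesis
    unfolding has_pd_def by (simp add: comp_def)
qed

lemma has_pd_bounded_linear:
  assumes "bounded_linear f"
  shows "has_pd e f (f e) x"
proof -
  interpret bounded_linear f by fact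
  have *: "f (x + of_real t * e) = f x + t *\<^sub>R f e" for t :: real
    by (simp add: add scaleR_conv_of_real[symmetric] scaleR)
  show ?thesis unfolding has_pd_def *
    by (auto intro!: derivative_eq_intros simp: has_vector_derivative_def)
qed

lemma has_pd_at_shift:
  assumes "has_pd e f d (x + of_real s * e)"
  shows "((\<lambda>t::real. f (x + of_real t * e)) has_vector_derivative d) (at s)"
proof -
  have "((\<lambda>t::real. f (x + of_real s * e + of_real (t - s) * e)) has_vector_derivative 1 *\<^sub>R d) (at s)"
    using assms unfolding has_pd_def
    by (intro vector_diff_chain_at[of "\<lambda>t. t - s" 1 s
          "\<lambda>t::real. f (x + of_real s * e + of_real t * e)" d, unfolded comp_def])
      (auto intro!: derivative_eq_intros)
  then show ?thesis by (simp add: algebra_simps)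
qed

lemma Cinf_on_imp_continuous: "Cinf_on U f \<Longrightarrow> continuous_on U f"
  unfolding Cinf_on_def by (drule spec[of _ "[]"]) simp

lemma Cinf_on_has_pd:
  "Cinf_on U f \<Longrightarrow> e \<in> {1, \<i>} \<Longrightarrow> x \<in> U \<Longrightarrow> has_pd e f (partial_dir e f x) x"
  unfolding Cinf_on_def has_pd_def partial_dir_def
  by (drule spec[of _ "[]"]) (auto simp: vector_derivative_works)

lemma iter_partial_append: "iter_partial (xs @ ys) f = iter_partial xs (iter_partial ys f)"
  by (induction xs) auto

lemma Cinf_on_partial_dir:
  assumes "Cinf_on U f" "e \<in> {1, \<i>}"
  shows "Cinf_on U (partial_dir e f)"
proof -
  have "iter_partial es (partial_dir e f) = iter_partial (es @ [e]) f" for es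
    by (simp add: iter_partial_append)
  then show ?thesis using assms unfolding Cinf_on_def by auto
qed

lemma Cinf_on_iter_partial: "Cinf_on U f \<Longrightarrow> set es \<subseteq> {1, \<i>} \<Longrightarrow> Cinf_on U (iter_partial es f)"
  by (induction es) (auto intro: Cinf_on_partial_dir)

lemma Cinf_on_subset: "Cinf_on U f \<Longrightarrow> V \<subseteq> U \<Longrightarrow> Cinf_on V f"
  unfolding Cinf_on_def by (meson continuous_on_subset subsetD)

lemma Cinf_on_local:
  assumes "\<And>x. x \<in> U \<Longrightarrow> \<exists>V. open V \<and> x \<in> V \<and> Cinf_on V f"
  shows "Cinf_on U f"
proof -
  have "isCont (iter_partial es f) x" if "x \<in> U" "set es \<subseteq> {1, \<i>}" for x es
    using assms[OF that(1)] that(2) unfolding Cinf_on_def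
    by (meson continuous_on_eq_continuous_at)
  then show ?thesis
    using assms unfolding Cinf_on_def by (metis continuous_at_imp_continuous_on)
qed

inductive poly_closure :: "((complex \<Rightarrow> complex) \<Rightarrow> bool) \<Rightarrow> (complex \<Rightarrow> complex) \<Rightarrow> bool"
  for B where
  base: "B f \<Longrightarrow> poly_closure B f"
| add: "poly_closure B f \<Longrightarrow> poly_closure B g \<Longrightarrow> poly_closure B (\<lambda>z. f z + g z)"
| mult: "poly_closure B f \<Longrightarrow> poly_closure B g \<Longrightarrow> poly_closure B (\<lambda>z. f z * g z)"

text \<open>Smoothness is coinductive: a class of continuous functions whose partial derivatives stay in
  the class consists of smooth functions. It suffices that the derivatives of the class are
  polynomials in its members.\<close>

lemma Cinf_on_poly_closure:
  assumes U: "open U"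
    and cont: "\<And>h. B h \<Longrightarrow> continuous_on U h"
    and pd: "\<And>h e. B h \<Longrightarrow> e \<in> {1, \<i>} \<Longrightarrow> \<exists>h'. poly_closure B h' \<and> (\<forall>x\<in>U. has_pd e h (h' x) x)"
    and f: "poly_closure B f"
  shows "Cinf_on U f"
proof -
  \<comment> \<open>By the sum and product rules the generated class is itself closed under both
    partial derivatives, which is the coinduction condition.\<close>
  have A: "continuous_on U h \<and>
      (\<forall>e\<in>{1, \<i>}. \<exists>h'. poly_closure B h' \<and> (\<forall>x\<in>U. has_pd e h (h' x) x))"
    if "poly_closure B h" for h
    using that
  proof (induction rule: poly_closure.induct)
    case (base h)
    then show ?case using cont pd by blast
  next
    case (add h k)
    have "\<exists>h'. poly_closure B h' \<and> (\<forall>x\<in>U. has_pd e (\<lambda>z. h z + k z) (h' x) x)" if "e \<in> {1, \<i>}" for e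
    proof -
      obtain h' k' where "poly_closure B h'" "\<forall>x\<in>U. has_pd e h (h' x) x"
        "poly_closure B k'" "\<forall>x\<in>U. has_pd e k (k' x) x" using add.IH \<open>e \<in> {1, \<i>}\<close> by meson
      then show ?thesis
        by (intro exI[of _ "\<lambda>z. h' z + k' z"]) (auto intro: poly_closure.add has_pd_add)
    qed
    then show ?case using add by (auto intro: continuous_on_add)
  next
    case (mult h k)
    have "\<exists>h'. poly_closure B h' \<and> (\<forall>x\<in>U. has_pd e (\<lambda>z. h z * k z) (h' x) x)" if "e \<in> {1, \<i>}" for e
    proof -
      obtain h' k' where "poly_closure B h'" "\<forall>x\<in>U. has_pd e h (h' x) x"
        "poly_closure B k'" "\<forall>x\<in>U. has_pd e k (k' x) x" using mult.IH \<open>e \<in> {1, \<i>}\<close> by meson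
      then show ?thesis using mult
        by (intro exI[of _ "\<lambda>z. h' z * k z + h z * k' z"])
          (auto intro: poly_closure.add poly_closure.mult has_pd_mult)
    qed
    then show ?case using mult by (auto intro: continuous_on_mult)
  qed
  \<comment> \<open>The iterated derivative is compared with a member of the class on
    \<open>U\<close> only; as \<open>U\<close> is open, derivatives transfer.\<close>
  have It: "\<exists>h. poly_closure B h \<and> (\<forall>x\<in>U. iter_partial es f x = h x)" if "set es \<subseteq> {1, \<i>}" for es
    using that
  proof (induction es)
    case Nil
    then show ?case using f by auto
  next
    case (Cons e es)
    then obtain h where h: "poly_closure B h" "\<forall>x\<in>U. iter_partial es f x = h x" by auto
    obtain h' where h': "poly_closure B h'" "\<forall>x\<in>U. has_pd e h (h' x) x"
      using A[OF h(1)] Cons.prems by (meson list.set_intros(1) subsetD)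
    have "has_pd e (iter_partial es f) (h' x) x" if "x \<in> U" for x
      by (rule has_pd_transform[where f = h and U = U]) (use h h' U that in auto)
    then show ?case using h' by (auto dest: has_pd_partial_dir)
  qed
  show ?thesis
    unfolding Cinf_on_def
  proof (intro allI impI conjI ballI)
    fix es :: "complex list" assume "set es \<subseteq> {1, \<i>}"
    then obtain h where h: "poly_closure B h" "\<forall>x\<in>U. iter_partial es f x = h x" using It by blast
    show "continuous_on U (iter_partial es f)"
      using A[OF h(1)] h(2) by (metis continuous_on_cong)
    fix x e assume x: "x \<in> U" and e: "e \<in> {1, \<i>}"
    obtain h' where h': "\<forall>x\<in>U. has_pd e h (h' x) x"
      using A[OF h(1)] e by meson
    have "has_pd e (iter_partial es f) (h' x) x"
      by (rule has_pd_transform[where f = h and U = U]) (use h h' U x in auto)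
    then show "(\<lambda>t::real. iter_partial es f (x + of_real t * e)) differentiable (at 0)"
      unfolding has_pd_def by (rule differentiableI_vector)
  qed
qed

lemma Cinf_on_coinduct:
  assumes "open U" "B f" "\<And>h. B h \<Longrightarrow> continuous_on U h"
    "\<And>h e. B h \<Longrightarrow> e \<in> {1, \<i>} \<Longrightarrow> \<exists>h'. B h' \<and> (\<forall>x\<in>U. has_pd e h (h' x) x)"
  shows "Cinf_on U f"
proof (rule Cinf_on_poly_closure[of U B])
  fix h e assume "B h" "e \<in> {1, \<i>}"
  then show "\<exists>h'. poly_closure B h' \<and> (\<forall>x\<in>U. has_pd e h (h' x) x)"
    using assms(4) by (meson poly_closure.base)
qed (use assms in \<open>auto intro: poly_closure.base\<close>)

text \<open>The generators are the smooth functions themselves, whose derivatives are again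
  generators. Closure of smoothness under sums and products is thus an instance of the criterion,
  and no Leibniz formula of higher order is written down.\<close>

lemma Cinf_on_poly_closure_Cinf:
  assumes "open U" "poly_closure (Cinf_on U) f"
  shows "Cinf_on U f"
proof (rule Cinf_on_poly_closure[of U "Cinf_on U"])
  fix h e assume "Cinf_on U h" "e \<in> {1, \<i>}"
  then show "\<exists>h'. poly_closure (Cinf_on U) h' \<and> (\<forall>x\<in>U. has_pd e h (h' x) x)"
    by (intro exI[of _ "partial_dir e h"] conjI ballI poly_closure.base Cinf_on_partial_dir)
      (auto intro: Cinf_on_has_pd)
qed (use assms in \<open>auto intro: Cinf_on_imp_continuous\<close>)

lemma Cinf_on_add:
  "open U \<Longrightarrow> Cinf_on U f \<Longrightarrow> Cinf_on U g \<Longrightarrow> Cinf_on U (\<lambda>z. f z + g z)"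
  by (rule Cinf_on_poly_closure_Cinf[OF _ poly_closure.add[OF poly_closure.base poly_closure.base]])

lemma Cinf_on_mult:
  "open U \<Longrightarrow> Cinf_on U f \<Longrightarrow> Cinf_on U g \<Longrightarrow> Cinf_on U (\<lambda>z. f z * g z)"
  by (rule Cinf_on_poly_closure_Cinf[OF _ poly_closure.mult[OF poly_closure.base poly_closure.base]])

text \<open>The coinductive class consists of all functions that agree on \<open>U\<close> with a
  smooth one; openness of \<open>U\<close> makes their derivatives agree there too.\<close>

lemma Cinf_on_cong:
  assumes "open U" "Cinf_on U f" "\<And>x. x \<in> U \<Longrightarrow> f x = g x"
  shows "Cinf_on U g"
proof (rule Cinf_on_coinduct[of U "\<lambda>h. \<exists>k. Cinf_on U k \<and> (\<forall>x\<in>U. k x = h x)"])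
  fix h e assume "\<exists>k. Cinf_on U k \<and> (\<forall>x\<in>U. k x = h x)" and e: "e \<in> {1, \<i>}"
  then obtain k where k: "Cinf_on U k" "\<forall>x\<in>U. k x = h x" by blast
  have "has_pd e h (partial_dir e k x) x" if "x \<in> U" for x
    using has_pd_transform[OF Cinf_on_has_pd[OF k(1) e that] \<open>open U\<close> that] k(2) by blast
  then show "\<exists>h'. (\<exists>k. Cinf_on U k \<and> (\<forall>x\<in>U. k x = h' x)) \<and> (\<forall>x\<in>U. has_pd e h (h' x) x)"
    using Cinf_on_partial_dir[OF k(1) e] by blast
next
  fix h assume "\<exists>k. Cinf_on U k \<and> (\<forall>x\<in>U. k x = h x)"
  then show "continuous_on U h" by (metis Cinf_on_imp_continuous continuous_on_eq)
qed (use assms in auto)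

lemma Cinf_on_holomorphic:
  assumes "open U" "f holomorphic_on U"
  shows "Cinf_on U f"
proof (rule Cinf_on_coinduct[of U "\<lambda>h. h holomorphic_on U"])
  fix h e assume h: "h holomorphic_on U"
  then show "\<exists>h'. h' holomorphic_on U \<and> (\<forall>x\<in>U. has_pd e h (h' x) x)"
    using \<open>open U\<close>
    by (intro exI[of _ "\<lambda>x. e * deriv h x"])
      (auto intro!: holomorphic_intros has_pd_field_derivative holomorphic_derivI)
next
  show "f holomorphic_on U" by fact
qed (use assms(1) holomorphic_on_imp_continuous_on in blast)+

lemma Cinf_on_diff:
  assumes "open U" "Cinf_on U f" "Cinf_on U g"
  shows "Cinf_on U (\<lambda>z. f z - g z)"
proof -
  have "Cinf_on U (\<lambda>_. - 1)" by (rule Cinf_on_holomorphic[OF assms(1) holomorphic_on_const])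
  from Cinf_on_add[OF assms(1,2) Cinf_on_mult[OF assms(1) this assms(3)]]
  have "Cinf_on U (\<lambda>z. f z + (-1) * g z)" .
  then show ?thesis by simp
qed

lemma Cinf_on_translate:
  assumes "Cinf_on UNIV f"
  shows "Cinf_on UNIV (\<lambda>z. f (z - a))"
proof (rule Cinf_on_coinduct[of UNIV "\<lambda>h. \<exists>k. Cinf_on UNIV k \<and> h = (\<lambda>z. k (z - a))"])
  fix h e assume "\<exists>k. Cinf_on UNIV k \<and> h = (\<lambda>z. k (z - a))" and e: "e \<in> {1, \<i>}"
  then obtain k where k: "Cinf_on UNIV k" "h = (\<lambda>z. k (z - a))" by blast
  show "\<exists>h'. (\<exists>k. Cinf_on UNIV k \<and> h' = (\<lambda>z. k (z - a))) \<and> (\<forall>x\<in>UNIV. has_pd e h (h' x) x)"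
    using Cinf_on_partial_dir[OF k(1) e] Cinf_on_has_pd[OF k(1) e] k(2)
    by (intro exI[of _ "\<lambda>z. partial_dir e k (z - a)"]) (auto simp: has_pd_translate)
next
  fix h assume "\<exists>k. Cinf_on UNIV k \<and> h = (\<lambda>z. k (z - a))"
  then obtain k where k: "continuous_on UNIV k" "h = (\<lambda>z. k (z - a))"
    using Cinf_on_imp_continuous by blast
  have "continuous_on UNIV (\<lambda>z::complex. z - a)" by (intro continuous_intros)
  from continuous_on_compose2[OF k(1) this] show "continuous_on UNIV h" by (simp add: k(2))
qed (use assms in auto)

section \<open>Rules for \<open>dbar\<close> and the Cauchy-Riemann equations\<close>

lemma dbar_has_pd:
  "has_pd 1 f d x \<Longrightarrow> has_pd \<i> f d' x \<Longrightarrow> dbar f x = (d + \<i> * d') / 2"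
  unfolding dbar_def by (simp add: has_pd_partial_dir)

lemma dbar_cong:
  assumes "Cinf_on U f" "open U" "x \<in> U" "\<And>y. y \<in> U \<Longrightarrow> f y = g y"
  shows "dbar g x = dbar f x"
proof -
  note g = has_pd_transform[OF Cinf_on_has_pd[OF assms(1) _ assms(3)] assms(2,3,4)]
  show ?thesis using dbar_has_pd[OF g g] by (simp add: dbar_def)
qed

lemma dbar_add:
  assumes "Cinf_on U f" "Cinf_on U g" "x \<in> U"
  shows "dbar (\<lambda>z. f z + g z) x = dbar f x + dbar g x"
proof -
  note f = Cinf_on_has_pd[OF assms(1) _ assms(3)] and g = Cinf_on_has_pd[OF assms(2) _ assms(3)]
  show ?thesis
    unfolding dbar_def[of f] dbar_def[of g]
    using dbar_has_pd[OF has_pd_add[OF f g] has_pd_add[OF f g]]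
    by (simp add: add_divide_distrib diff_divide_distrib algebra_simps)
qed

lemma dbar_diff:
  assumes "Cinf_on U f" "Cinf_on U g" "x \<in> U"
  shows "dbar (\<lambda>z. f z - g z) x = dbar f x - dbar g x"
proof -
  note f = Cinf_on_has_pd[OF assms(1) _ assms(3)] and g = Cinf_on_has_pd[OF assms(2) _ assms(3)]
  show ?thesis
    unfolding dbar_def[of f] dbar_def[of g]
    using dbar_has_pd[OF has_pd_diff[OF f g] has_pd_diff[OF f g]]
    by (simp add: add_divide_distrib diff_divide_distrib algebra_simps)
qed

lemma dbar_mult:
  assumes "Cinf_on U f" "Cinf_on U g" "x \<in> U"
  shows "dbar (\<lambda>z. f z * g z) x = dbar f x * g x + f x * dbar g x"
proof -
  note f = Cinf_on_has_pd[OF assms(1) _ assms(3)] and g = Cinf_on_has_pd[OF assms(2) _ assms(3)]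
  show ?thesis
    unfolding dbar_def[of f] dbar_def[of g]
    using dbar_has_pd[OF has_pd_mult[OF f g] has_pd_mult[OF f g]]
    by (simp add: add_divide_distrib diff_divide_distrib algebra_simps)
qed

lemma dbar_holomorphic:
  assumes "open U" "f holomorphic_on U" "x \<in> U"
  shows "dbar f x = 0"
proof -
  note d = has_pd_field_derivative[OF holomorphic_derivI[OF assms(2,1,3)]]
  show ?thesis using dbar_has_pd[OF d d] by (simp add: algebra_simps)
qed

lemma Cinf_on_dbar:
  assumes "open U" "Cinf_on U f"
  shows "Cinf_on U (dbar f)"
proof -
  have c: "Cinf_on U (\<lambda>_. c)" for c by (rule Cinf_on_holomorphic[OF assms(1) holomorphic_on_const])
  have p: "Cinf_on U (partial_dir e f)" if "e \<in> {1, \<i>}" for e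
    using Cinf_on_partial_dir[OF assms(2) that] .
  have "Cinf_on U (\<lambda>x. 1 / 2 * (partial_dir 1 f x + \<i> * partial_dir \<i> f x))"
    by (rule Cinf_on_mult[OF assms(1) c Cinf_on_add[OF assms(1) p Cinf_on_mult[OF assms(1) c p]]]) auto
  then show ?thesis unfolding dbar_def by (simp add: field_simps)
qed

text \<open>The classical criterion that both partial derivatives, one of them continuous near the
  point, give total differentiability. It is proved in real coordinates on a square and pulled back
  along \<open>z\<close> to \<open>(Re z, Im z)\<close>.\<close>

lemma has_derivative_continuous_pd:
  assumes U: "open U" "x \<in> U"
    and p: "\<And>y. y \<in> U \<Longrightarrow> has_pd 1 f (p y) y" and q: "\<And>y. y \<in> U \<Longrightarrow> has_pd \<i> f (q y) y"
    and cont: "continuous_on U q"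
  shows "(f has_derivative (\<lambda>h. of_real (Re h) * p x + of_real (Im h) * q x)) (at x)"
proof -
  define Q where "Q = (\<lambda>w. blinfun_scaleR_left (q w) :: real \<Rightarrow>\<^sub>L complex)"
  obtain r where r: "r > 0" "ball x r \<subseteq> U" using U openE by blast
  \<comment> \<open>Half-sides \<open>r / 2\<close> put the square inside \<open>ball x r\<close>,
    since the modulus is at most the sum of the absolute values of the coordinates.\<close>
  define s where "s = r / 2"
  define A where "A = ball (Re x) s" define B where "B = ball (Im x) s"
  have AB: "Complex a b \<in> U" if "a \<in> A" "b \<in> B" for a b
  proof -
    have "cmod (Complex a b - x) \<le> \<bar>a - Re x\<bar> + \<bar>b - Im x\<bar>"
      using cmod_le[of "Complex a b - x"] by simp
    then have "Complex a b \<in> ball x r"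
      using that unfolding A_def B_def s_def by (auto simp: dist_norm norm_minus_commute dist_real_def abs_minus_commute)
    then show ?thesis using r by blast
  qed
  have 1: "((\<lambda>a. f (Complex a (Im x))) has_derivative (\<lambda>t. t *\<^sub>R p x)) (at (Re x) within A)"
  proof -
    have e: "x - of_real (Re x) + of_real t = Complex t (Im x)" for t
      by (simp add: complex_eq_iff)
    have "((\<lambda>t::real. f ((x - of_real (Re x)) + of_real t * 1)) has_vector_derivative p x) (at (Re x))"
      by (rule has_pd_at_shift) (use p U in auto)
    then show ?thesis unfolding mult_1_right e has_vector_derivative_def
      by (rule has_derivative_at_withinI)
  qed
  have 2: "((\<lambda>b. f (Complex a b)) has_derivative blinfun_apply (Q (Complex a b))) (at b within B)"
    if "a \<in> A" "b \<in> B" for a b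
  proof -
    have e: "of_real a + of_real t * \<i> = Complex a t" for t
      by (simp add: complex_eq_iff)
    have "((\<lambda>t::real. f (of_real a + of_real t * \<i>)) has_vector_derivative q (Complex a b)) (at b)"
      by (rule has_pd_at_shift) (use q AB that e in auto)
    then show ?thesis unfolding e has_vector_derivative_def Q_def
      by (auto intro: has_derivative_at_withinI)
  qed
  have cC: "continuous_on S (\<lambda>(a, b). Complex a b)" for S
    unfolding Complex_eq by (auto intro!: continuous_intros simp: case_prod_beta)
  have "continuous_on (A \<times> B) (\<lambda>z. q (case z of (a, b) \<Rightarrow> Complex a b))"
    by (rule continuous_on_compose2[OF cont cC]) (use AB in auto)
  then have "continuous_on (A \<times> B) (\<lambda>z. Q (case z of (a, b) \<Rightarrow> Complex a b))"
    unfolding Q_def by (intro bounded_linear.continuous_on[OF bounded_linear_blinfun_scaleR_left])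
  then have 3: "continuous (at (Re x, Im x) within A \<times> B) (\<lambda>(a, b). Q (Complex a b))"
    using r unfolding continuous_on_eq_continuous_within A_def B_def s_def case_prod_beta by auto
  have "((\<lambda>(a, b). f (Complex a b)) has_derivative (\<lambda>(s, t). s *\<^sub>R p x + Q (Complex (Re x) (Im x)) t))
      (at (Re x, Im x) within A \<times> B)"
    by (rule has_derivative_partialsI[OF 1 2 3]) (use r in \<open>auto simp: B_def s_def\<close>)
  then have "((\<lambda>(a, b). f (Complex a b)) has_derivative (\<lambda>(s, t). s *\<^sub>R p x + t *\<^sub>R q x))
      (at (Re x, Im x))"
    using r by (subst (asm) at_within_open) (auto simp: A_def B_def s_def Q_def open_Times)
  moreover have "((\<lambda>z. (Re z, Im z)) has_derivative (\<lambda>z. (Re z, Im z))) (at x)"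
    by (rule bounded_linear_imp_has_derivative) (intro bounded_linear_Pair bounded_linear_Re bounded_linear_Im)
  ultimately have "((\<lambda>(a, b). f (Complex a b)) \<circ> (\<lambda>z. (Re z, Im z)) has_derivative
      (\<lambda>(s, t). s *\<^sub>R p x + t *\<^sub>R q x) \<circ> (\<lambda>z. (Re z, Im z))) (at x)"
    by (rule diff_chain_at[rotated])
  then show ?thesis by (simp add: comp_def scaleR_conv_of_real)
qed

text \<open>If \<open>dbar f\<close> vanishes, the partial derivative along \<open>\<i>\<close> is
  \<open>\<i>\<close> times the one along 1, so the real derivative is multiplication by a complex
  number.\<close>

lemma holomorphic_on_dbar_zero:
  assumes "open U" "Cinf_on U f" "\<And>x. x \<in> U \<Longrightarrow> dbar f x = 0"
  shows "f holomorphic_on U"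
proof (rule holomorphic_onI)
  fix x assume x: "x \<in> U"
  let ?p = "partial_dir 1 f" and ?q = "partial_dir \<i> f"
  have "(f has_derivative (\<lambda>h. of_real (Re h) * ?p x + of_real (Im h) * ?q x)) (at x)"
    by (rule has_derivative_continuous_pd[of U])
      (use assms x in \<open>auto intro: Cinf_on_has_pd Cinf_on_imp_continuous Cinf_on_partial_dir\<close>)
  moreover have q: "?q x = \<i> * ?p x"
  proof -
    have "?p x + \<i> * ?q x = 0" using assms(3)[OF x] unfolding dbar_def by simp
    then have "\<i> * (?p x + \<i> * ?q x) = 0" by simp
    then show ?thesis by (simp add: algebra_simps)
  qed
  have "(\<lambda>h. of_real (Re h) * ?p x + of_real (Im h) * ?q x) = (*) (?p x)"
    unfolding q by (auto simp: complex_eq_iff algebra_simps)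
  ultimately show "f field_differentiable at x within U"
    unfolding field_differentiable_def has_field_derivative_def
    by (metis has_derivative_at_withinI)
qed

section \<open>Convolution with test functions\<close>

definition csupp :: "(complex \<Rightarrow> complex) \<Rightarrow> bool" where
  "csupp f \<longleftrightarrow> (\<exists>R. \<forall>z. R < cmod z \<longrightarrow> f z = 0)"

definition locint :: "(complex \<Rightarrow> complex) \<Rightarrow> bool" where
  "locint h \<longleftrightarrow> h \<in> borel_measurable borel \<and>
     (\<forall>R. integrable lborel (\<lambda>y. indicator (cball 0 R) y *\<^sub>R h y))"

text \<open>The first factor is rough, the second smooth: every derivative of a convolution falls on
  the second one.\<close>

definition conv :: "(complex \<Rightarrow> complex) \<Rightarrow> (complex \<Rightarrow> complex) \<Rightarrow> complex \<Rightarrow> complex" where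
  "conv h f x = (\<integral>y. h y * f (x - y) \<partial>lborel)"

definition test_fun :: "(complex \<Rightarrow> complex) \<Rightarrow> bool" where
  "test_fun f \<longleftrightarrow> Cinf_on UNIV f \<and> csupp f"

lemma csupp_bounded:
  assumes "continuous_on UNIV f" "csupp f"
  obtains B where "0 \<le> B" "\<And>z. cmod (f z) \<le> B"
proof -
  obtain R where R: "\<And>z. R < cmod z \<Longrightarrow> f z = 0" using assms unfolding csupp_def by blast
  have "compact (f ` cball 0 R)"
    by (intro compact_continuous_image continuous_on_subset[OF assms(1)]) auto
  then have "bounded (f ` cball 0 R)" by (rule compact_imp_bounded)
  then obtain B where B: "\<And>z. z \<in> cball 0 R \<Longrightarrow> cmod (f z) \<le> B"
    unfolding bounded_iff by blast
  have "cmod (f z) \<le> max B 0" for z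
    using B[of z] R[of z] by (cases "R < cmod z") auto
  then show ?thesis by (intro that[of "max B 0"]) auto
qed

lemma csupp_has_pd:
  assumes "csupp f" "\<And>z. has_pd e f (f' z) z"
  shows "csupp f'"
proof -
  obtain R where R: "\<And>z. R < cmod z \<Longrightarrow> f z = 0" using assms unfolding csupp_def by blast
  have "open {z::complex. R < cmod z}" by (intro open_Collect_less continuous_intros)
  then have "has_pd e (\<lambda>_. 0) (f' z) z" if "R < cmod z" for z
    using has_pd_transform[OF assms(2), of "{z. R < cmod z}" z "\<lambda>_. 0"] R that by auto
  then have "f' z = 0" if "R < cmod z" for z
    using has_pd_partial_dir[OF has_pd_const, of e 0 z] has_pd_partial_dir that by metis
  then show ?thesis unfolding csupp_def by blast
qed

lemma test_fun_partial_dir: "test_fun f \<Longrightarrow> e \<in> {1, \<i>} \<Longrightarrow> test_fun (partial_dir e f)"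
  unfolding test_fun_def
  by (metis Cinf_on_has_pd Cinf_on_partial_dir UNIV_I csupp_has_pd)

lemma csupp_mult: "csupp f \<Longrightarrow> csupp (\<lambda>z. f z * g z)" "csupp g \<Longrightarrow> csupp (\<lambda>z. f z * g z)"
  unfolding csupp_def by (metis mult_zero_left, metis mult_zero_right)

lemma csupp_add:
  assumes "csupp f" "csupp g"
  shows "csupp (\<lambda>z. f z + g z)"
proof -
  obtain R S where "\<And>z. R < cmod z \<Longrightarrow> f z = 0" "\<And>z. S < cmod z \<Longrightarrow> g z = 0"
    using assms unfolding csupp_def by blast
  then show ?thesis unfolding csupp_def by (intro exI[of _ "max R S"]) auto
qed

lemma test_fun_dbar:
  assumes "test_fun f"
  shows "test_fun (dbar f)"
proof -
  have "csupp (\<lambda>x. 1 / 2 * (partial_dir 1 f x + \<i> * partial_dir \<i> f x))"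
    using test_fun_partial_dir[OF assms, of 1] test_fun_partial_dir[OF assms, of \<i>]
    unfolding test_fun_def
    by (intro csupp_mult(2) csupp_add) auto
  then have "csupp (dbar f)" unfolding dbar_def by (simp add: field_simps)
  then show ?thesis using assms Cinf_on_dbar unfolding test_fun_def by auto
qed

lemma csupp_reflect:
  assumes "csupp f"
  shows "csupp (\<lambda>y. f (x - y))"
proof -
  obtain R where R: "\<And>z. R < cmod z \<Longrightarrow> f z = 0" using assms unfolding csupp_def by blast
  have "f (x - y) = 0" if "R + cmod x < cmod y" for y
    using R[of "x - y"] that norm_triangle_ineq2[of y x] by (simp add: norm_minus_commute)
  then show ?thesis unfolding csupp_def by blast
qed

lemma continuous_reflect:
  assumes "continuous_on UNIV f"
  shows "continuous_on UNIV (\<lambda>y::complex. f (x - y))"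
proof -
  have "continuous_on UNIV (\<lambda>y::complex. x - y)" by (intro continuous_intros)
  from continuous_on_compose2[OF assms this] show ?thesis by simp
qed

text \<open>On the common supporting ball \<open>B * cmod (h y)\<close> dominates. Convergence is
  asked of the products \<open>h y * \<psi> n y\<close> and not of \<open>\<psi> n y\<close>: in the
  Pompeiu formula the approximants tend to the wrong value at the pole, where \<open>h\<close> is 0
  by convention.\<close>

lemma locint_dominated:
  assumes h: "locint h"
    and m: "\<And>n. \<psi> n \<in> borel_measurable borel" "l \<in> borel_measurable borel"
    and bound: "\<And>n y. cmod (\<psi> n y) \<le> B" and supp: "\<And>n y. R < cmod y \<Longrightarrow> \<psi> n y = 0"
    and lim: "\<And>y. (\<lambda>n. h y * \<psi> n y) \<longlonglongrightarrow> h y * l y"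
  shows "(\<lambda>n. \<integral>y. h y * \<psi> n y \<partial>lborel) \<longlonglongrightarrow> (\<integral>y. h y * l y \<partial>lborel)"
proof (rule integral_dominated_convergence[where w = "\<lambda>y. B * cmod (indicator (cball 0 R) y *\<^sub>R h y)"])
  have [measurable]: "h \<in> borel_measurable borel" using h unfolding locint_def by blast
  note m[measurable]
  show "(\<lambda>y. h y * l y) \<in> borel_measurable lborel" by measurable
  show "(\<lambda>y. h y * \<psi> n y) \<in> borel_measurable lborel" for n by measurable
  show "integrable lborel (\<lambda>y. B * cmod (indicator (cball 0 R) y *\<^sub>R h y))"
    using h unfolding locint_def by (intro integrable_mult_right integrable_norm) blast
  show "AE y in lborel. (\<lambda>n. h y * \<psi> n y) \<longlonglongrightarrow> h y * l y" using lim by simp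
  have "cmod (h y * \<psi> n y) \<le> B * cmod (indicator (cball 0 R) y *\<^sub>R h y)" for n y
    using mult_right_mono[OF bound[of n y] norm_ge_zero[of "h y"]] supp[of y n]
    by (cases "R < cmod y") (auto simp: norm_mult mult.commute)
  then show "AE y in lborel. cmod (h y * \<psi> n y) \<le> B * cmod (indicator (cball 0 R) y *\<^sub>R h y)" for n
    by simp
qed

lemma locint_mult_integrable:
  assumes h: "locint h" and f: "continuous_on UNIV f" "csupp f"
  shows "integrable lborel (\<lambda>y. h y * f y)"
proof -
  obtain B where B: "\<And>z. cmod (f z) \<le> B" by (rule csupp_bounded[OF f]) blast
  obtain R where R: "\<And>z. R < cmod z \<Longrightarrow> f z = 0" using f unfolding csupp_def by blast
  have [measurable]: "h \<in> borel_measurable borel" using h unfolding locint_def by blast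
  have [measurable]: "f \<in> borel_measurable borel" using f by (intro borel_measurable_continuous_onI)
  show ?thesis
  proof (rule Bochner_Integration.integrable_bound[where f = "\<lambda>y. B * cmod (indicator (cball 0 R) y *\<^sub>R h y)"])
    show "integrable lborel (\<lambda>y. B * cmod (indicator (cball 0 R) y *\<^sub>R h y))"
      using h unfolding locint_def by (intro integrable_mult_right integrable_norm) blast
    have "0 \<le> B" using B[of 0] norm_ge_zero order_trans by blast
    then have "cmod (h y * f y) \<le> norm (B * cmod (indicator (cball 0 R) y *\<^sub>R h y))" for y
      using mult_right_mono[OF B[of y] norm_ge_zero[of "h y"]] R[of y]
      by (cases "R < cmod y") (auto simp: norm_mult mult.commute)
    then show "AE y in lborel. cmod (h y * f y) \<le> norm (B * cmod (indicator (cball 0 R) y *\<^sub>R h y))"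
      by simp
  qed measurable
qed

lemma conv_integrable:
  assumes "locint h" "continuous_on UNIV f" "csupp f"
  shows "integrable lborel (\<lambda>y. h y * f (x - y))"
  using assms by (intro locint_mult_integrable continuous_reflect csupp_reflect)

lemma conv_continuous:
  assumes h: "locint h" and f: "continuous_on UNIV f" "csupp f"
  shows "continuous_on UNIV (conv h f)"
proof (rule continuous_at_imp_continuous_on, rule ballI)
  fix x
  show "isCont (conv h f) x"
    unfolding continuous_at_sequentially
  proof (intro allI impI)
    fix X :: "nat \<Rightarrow> complex" assume X: "X \<longlonglongrightarrow> x"
    obtain B where B: "\<And>z. cmod (f z) \<le> B" by (rule csupp_bounded[OF f]) blast
    obtain R where R: "\<And>z. R < cmod z \<Longrightarrow> f z = 0" using f unfolding csupp_def by blast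
    obtain T where T: "\<And>n. cmod (X n) \<le> T"
      using X by (meson Bseq_def convergent_imp_Bseq convergentI)
    have "(\<lambda>n. \<integral>y. h y * f (X n - y) \<partial>lborel) \<longlonglongrightarrow> (\<integral>y. h y * f (x - y) \<partial>lborel)"
    proof (rule locint_dominated[OF h _ _ B, where R = "R + T"])
      show "f (X n - y) = 0" if "R + T < cmod y" for n y
        using R[of "X n - y"] T[of n] that norm_triangle_ineq2[of y "X n"]
        by (simp add: norm_minus_commute)
      have "isCont f (x - y)" for y using f by (simp add: continuous_on_eq_continuous_at)
      then have "(\<lambda>n. f (X n - y)) \<longlonglongrightarrow> f (x - y)" for y
        by (rule isCont_tendsto_compose) (intro tendsto_intros X)
      then show "(\<lambda>n. h y * f (X n - y)) \<longlonglongrightarrow> h y * f (x - y)" for y by (intro tendsto_intros)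
    qed (auto intro!: borel_measurable_continuous_onI continuous_reflect f)
    then show "(conv h f \<circ> X) \<longlonglongrightarrow> conv h f x" unfolding conv_def comp_def .
  qed
qed

lemma has_pd_increment_bound:
  assumes "\<And>z. has_pd e f (f' z) z" "\<And>z. cmod (f' z) \<le> B"
  shows "cmod (f (z + of_real t * e) - f z) \<le> B * \<bar>t\<bar>"
proof -
  have "cmod (f (z + of_real t * e) - f (z + of_real 0 * e)) \<le> B * norm (t - 0)"
  proof (rule differentiable_bound[of UNIV _ "\<lambda>s u. u *\<^sub>R f' (z + of_real s * e)"])
    show "((\<lambda>t. f (z + of_real t * e)) has_derivative (\<lambda>u. u *\<^sub>R f' (z + of_real s * e)))
        (at s within UNIV)" for s
      using has_pd_at_shift[OF assms(1)] unfolding has_vector_derivative_def by simp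
    show "onorm (\<lambda>u. u *\<^sub>R f' (z + of_real s * e)) \<le> B" for s
      by (rule onorm_le) (use mult_right_mono[OF assms(2) abs_ge_zero] in \<open>simp add: mult.commute\<close>)
  qed auto
  then show ?thesis by simp
qed

text \<open>Differentiation under the integral sign. The derivative is tested along sequences
  because dominated convergence is sequential.\<close>

lemma conv_has_pd:
  assumes h: "locint h" and f: "continuous_on UNIV f" "csupp f"
    and f': "\<And>z. has_pd e f (f' z) z" "continuous_on UNIV f'"
  shows "has_pd e (conv h f) (conv h f' x) x"
proof -
  have c: "csupp f'" using csupp_has_pd f f' by blast
  obtain B where B: "\<And>z. cmod (f' z) \<le> B" by (rule csupp_bounded[OF f'(2) c]) blast
  obtain R where R: "\<And>z. R < cmod z \<Longrightarrow> f z = 0" using f unfolding csupp_def by blast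
  obtain R' where R': "\<And>z. R' < cmod z \<Longrightarrow> f' z = 0" using c unfolding csupp_def by blast
  define F where "F t = conv h f (x + of_real t * e)" for t :: real
  \<comment> \<open>The remainder of the difference quotient. The mean value inequality bounds it by
    \<open>2 * B\<close>, and for bounded \<open>t\<close> its supports stay in one ball.\<close>
  define q where "q t y = (f (x + of_real t * e - y) - f (x - y) - of_real t * f' (x - y)) / of_real \<bar>t\<bar>"
    for t :: real and y
  have q: "(F t - F 0 - t *\<^sub>R conv h f' x) /\<^sub>R \<bar>t\<bar> = (\<integral>y. h y * q t y \<partial>lborel)" for t
  proof -
    have "(\<integral>y. h y * q t y \<partial>lborel) = (\<integral>y. (h y * f (x + of_real t * e - y) - h y * f (x - y)
        - of_real t * (h y * f' (x - y))) / of_real \<bar>t\<bar> \<partial>lborel)"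
      unfolding q_def by (simp add: algebra_simps)
    also have "\<dots> = (F t - F 0 - of_real t * conv h f' x) / of_real \<bar>t\<bar>"
      unfolding F_def conv_def
      by (simp add: conv_integrable[OF h f] conv_integrable[OF h f'(2) c])
    finally show ?thesis by (simp add: scaleR_conv_of_real divide_inverse mult.commute)
  qed
  have "((\<lambda>t. (F t - F 0 - t *\<^sub>R conv h f' x) /\<^sub>R \<bar>t\<bar>) \<longlongrightarrow> 0) (at 0)"
    unfolding tendsto_at_iff_sequentially
  proof (intro allI impI)
    fix X :: "nat \<Rightarrow> real" assume X0: "\<forall>i. X i \<in> UNIV - {0}" and X: "X \<longlonglongrightarrow> 0"
    obtain T where T: "\<And>n. \<bar>X n\<bar> \<le> T"
      using X by (metis Bseq_def convergent_imp_Bseq convergentI real_norm_def)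
    have "(\<lambda>n. \<integral>y. h y * q (X n) y \<partial>lborel) \<longlonglongrightarrow> (\<integral>y. h y * 0 \<partial>lborel)"
    proof (rule locint_dominated[OF h, where B = "2 * B" and R = "max R R' + cmod x + T * cmod e"])
      show "q (X n) \<in> borel_measurable borel" for n
      proof -
        have "continuous_on UNIV (q (X n))"
          unfolding q_def divide_inverse using f f' by (intro continuous_intros continuous_reflect)
        then show ?thesis by (rule borel_measurable_continuous_onI)
      qed
      show "cmod (q (X n) y) \<le> 2 * B" for n y
      proof -
        have x: "X n \<noteq> 0" using X0 by auto
        have "cmod (f (x - y + of_real (X n) * e) - f (x - y)) \<le> B * \<bar>X n\<bar>"
          using has_pd_increment_bound[OF f'(1) B] .
        moreover have "cmod (of_real (X n) * f' (x - y)) \<le> B * \<bar>X n\<bar>"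
          using mult_right_mono[OF B[of "x - y"] abs_ge_zero[of "X n"]] by (simp add: norm_mult mult.commute)
        ultimately have "cmod (f (x + of_real (X n) * e - y) - f (x - y) - of_real (X n) * f' (x - y))
            \<le> 2 * B * \<bar>X n\<bar>"
          using norm_triangle_ineq4[of "f (x + of_real (X n) * e - y) - f (x - y)" "of_real (X n) * f' (x - y)"]
          by (simp add: algebra_simps)
        then show ?thesis unfolding q_def using x by (simp add: norm_divide field_simps)
      qed
      show "q (X n) y = 0" if "max R R' + cmod x + T * cmod e < cmod y" for n y
      proof -
        have "\<bar>X n\<bar> * cmod e \<le> T * cmod e" using T[of n] by (intro mult_right_mono) auto
        moreover have "cmod y \<le> cmod (x + of_real (X n) * e - y) + cmod (x + of_real (X n) * e)"
          using norm_triangle_ineq4[of "x + of_real (X n) * e" "x + of_real (X n) * e - y"] by simp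
        moreover have "cmod (x + of_real (X n) * e) \<le> cmod x + \<bar>X n\<bar> * cmod e"
          using norm_triangle_ineq[of x "of_real (X n) * e"] by (simp add: norm_mult)
        moreover have "cmod y \<le> cmod (x - y) + cmod x"
          using norm_triangle_ineq4[of x "x - y"] by simp
        moreover have "0 \<le> T * cmod e" using T[of n] by simp
        ultimately have "R < cmod (x + of_real (X n) * e - y)" "R < cmod (x - y)" "R' < cmod (x - y)"
          using that by auto
        then show ?thesis unfolding q_def using R R' by simp
      qed
      show "(\<lambda>n. h y * q (X n) y) \<longlonglongrightarrow> h y * 0" for y
      proof -
        have "((\<lambda>t. (f (x - y + of_real t * e) - f (x - y + of_real 0 * e) - (t - 0) *\<^sub>R f' (x - y)) /\<^sub>R norm (t - 0))
            \<longlongrightarrow> 0) (at 0)"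
          using f'(1)[of "x - y"] unfolding has_pd_def has_vector_derivative_def has_derivative_at_within
          by auto
        then have "((\<lambda>t. q t y) \<longlongrightarrow> 0) (at 0)"
          unfolding q_def by (simp add: scaleR_conv_of_real divide_inverse algebra_simps)
        then have "(\<lambda>n. q (X n) y) \<longlonglongrightarrow> 0"
          unfolding tendsto_at_iff_sequentially comp_def using X0 X by blast
        then show ?thesis by (intro tendsto_intros)
      qed
    qed auto
    then show "((\<lambda>t. (F t - F 0 - t *\<^sub>R conv h f' x) /\<^sub>R \<bar>t\<bar>) \<circ> X) \<longlonglongrightarrow> 0"
      unfolding q comp_def by simp
  qed
  then show ?thesis
    unfolding has_pd_def has_vector_derivative_def has_derivative_at_within F_def
    by (auto intro: bounded_linear_scaleR_left)
qed

lemma test_funD: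
  assumes "test_fun f"
  shows "continuous_on UNIV f" "csupp f" "e \<in> {1, \<i>} \<Longrightarrow> has_pd e f (partial_dir e f z) z"
  using assms Cinf_on_imp_continuous Cinf_on_has_pd unfolding test_fun_def by auto

lemma partial_dir_conv:
  assumes "locint h" "test_fun f" "e \<in> {1, \<i>}"
  shows "has_pd e (conv h f) (conv h (partial_dir e f) x) x"
  by (rule conv_has_pd) (use assms test_funD test_fun_partial_dir in blast)+

lemma Cinf_on_conv:
  assumes h: "locint h" and f: "test_fun f"
  shows "Cinf_on UNIV (conv h f)"
proof (rule Cinf_on_coinduct[of UNIV "\<lambda>k. \<exists>f. test_fun f \<and> k = conv h f"])
  fix k e assume "\<exists>f. test_fun f \<and> k = conv h f" and e: "e \<in> {1, \<i>}"
  then obtain f where "test_fun f" "k = conv h f" by blast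
  then show "\<exists>h'. (\<exists>f. test_fun f \<and> h' = conv h f) \<and> (\<forall>x\<in>UNIV. has_pd e k (h' x) x)"
    using partial_dir_conv[OF h] test_fun_partial_dir e by blast
next
  fix k assume "\<exists>f. test_fun f \<and> k = conv h f"
  then show "continuous_on UNIV k" using conv_continuous[OF h] test_funD by blast
qed (use f in auto)

lemma dbar_conv:
  assumes "locint h" "test_fun f"
  shows "dbar (conv h f) x = conv h (dbar f) x"
proof -
  have i: "integrable lborel (\<lambda>y. h y * partial_dir e f (x - y))" if "e \<in> {1, \<i>}" for e
    using conv_integrable[OF assms(1)] test_funD(1,2)[OF test_fun_partial_dir[OF assms(2) that]] by blast
  have "conv h (dbar f) x =
      (\<integral>y. (h y * partial_dir 1 f (x - y) + \<i> * (h y * partial_dir \<i> f (x - y))) / 2 \<partial>lborel)"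
    unfolding conv_def dbar_def by (simp add: algebra_simps)
  also have "\<dots> = (conv h (partial_dir 1 f) x + \<i> * conv h (partial_dir \<i> f) x) / 2"
    using i by (simp add: conv_def)
  also have "\<dots> = dbar (conv h f) x"
    by (rule dbar_has_pd[symmetric]) (use partial_dir_conv[OF assms] in auto)
  finally show ?thesis by simp
qed

section \<open>Substitutions and integration by parts in the plane\<close>

lemma lborel_integral_affine_complex:
  fixes f :: "complex \<Rightarrow> complex"
  assumes [measurable]: "f \<in> borel_measurable borel" and c: "c \<noteq> 0"
  shows "(\<integral>x. f x \<partial>lborel) = of_real (c\<^sup>2) * (\<integral>x. f (t + of_real c * x) \<partial>lborel)"
proof -
  have "(\<integral>x. f x \<partial>lborel) = (\<integral>x. f x \<partial>density (distr lborel borel (\<lambda>x. t + c *\<^sub>R x)) (\<lambda>_. \<bar>c\<bar>^DIM(complex)))"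
    using lborel_affine[OF c, of t] by simp
  also have "\<dots> = (\<integral>x. c\<^sup>2 *\<^sub>R f x \<partial>distr lborel borel (\<lambda>x. t + c *\<^sub>R x))"
    by (subst integral_density) auto
  also have "\<dots> = (\<integral>x. c\<^sup>2 *\<^sub>R f (t + c *\<^sub>R x) \<partial>lborel)"
    by (subst integral_distr) auto
  finally show ?thesis by (simp add: scaleR_conv_of_real)
qed

lemma integral_reflect_complex:
  fixes f :: "complex \<Rightarrow> complex"
  assumes "f \<in> borel_measurable borel"
  shows "(\<integral>y. f (x - y) \<partial>lborel) = (\<integral>y. f y \<partial>lborel)"
  using lborel_integral_affine_complex[OF assms, of "-1" x] by simp

lemma locint_bounded:
  assumes [measurable]: "h \<in> borel_measurable borel"
    and b: "\<And>R. \<exists>B. \<forall>y\<in>cball 0 R. cmod (h y) \<le> B"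
  shows "locint h"
  unfolding locint_def
proof (intro conjI allI)
  fix R
  obtain B where B: "\<And>y. y \<in> cball 0 R \<Longrightarrow> cmod (h y) \<le> B" using b[of R] by blast
  show "integrable lborel (\<lambda>y. indicator (cball 0 R) y *\<^sub>R h y)"
  proof (rule Bochner_Integration.integrable_bound[where f = "\<lambda>y. B * indicator (cball 0 R) y :: real"])
    have "integrable lborel (indicator (cball (0::complex) R) :: complex \<Rightarrow> real)"
      using emeasure_bounded_finite[OF bounded_cball, of "0::complex" R]
      by (intro integrable_real_indicator) (auto simp: infinity_ennreal_def)
    then show "integrable lborel (\<lambda>y::complex. B * indicator (cball 0 R) y :: real)"
      by (rule integrable_mult_right)
    have "cmod (indicator (cball 0 R) y *\<^sub>R h y) \<le> norm (B * indicator (cball 0 R) y :: real)" for y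
      using B[of y] by (auto simp: indicator_def)
    then show "AE y in lborel. cmod (indicator (cball 0 R) y *\<^sub>R h y) \<le> norm (B * indicator (cball 0 R) y :: real)"
      by simp
    show "(\<lambda>y. indicator (cball 0 R) y *\<^sub>R h y) \<in> borel_measurable lborel"
      by (intro borel_measurable_scaleR borel_measurable_indicator) (use assms(1) in auto)
  qed
qed fact

lemma continuous_bounded_cball:
  fixes h :: "complex \<Rightarrow> complex"
  assumes "continuous_on UNIV h"
  shows "\<exists>B. \<forall>y\<in>cball a R. cmod (h y) \<le> B"
proof -
  have "compact (h ` cball a R)"
    by (rule compact_continuous_image[OF continuous_on_subset[OF assms]]) auto
  then have "bounded (h ` cball a R)" by (rule compact_imp_bounded)
  then show ?thesis unfolding bounded_iff by blast
qed

text \<open>Convolving \<open>f\<close> with the constant 1 gives a constant function, the integral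
  of \<open>f\<close>. Its derivative is 0, and it is also the convolution of 1 with
  \<open>f'\<close>, that is, the integral of \<open>f'\<close>.\<close>

lemma integral_pd_eq_0:
  assumes f: "continuous_on UNIV f" "csupp f" "\<And>z. has_pd e f (f' z) z" "continuous_on UNIV f'"
  shows "(\<integral>y. f' y \<partial>lborel) = 0"
proof -
  have 1: "locint (\<lambda>_. 1)" by (rule locint_bounded) auto
  have *: "conv (\<lambda>_. 1) k x = (\<integral>y. k y \<partial>lborel)" if "continuous_on UNIV k" for k x
    using integral_reflect_complex[OF borel_measurable_continuous_onI[OF that], of x]
    unfolding conv_def by simp
  have "has_pd e (\<lambda>_. \<integral>y. f y \<partial>lborel) (\<integral>y. f' y \<partial>lborel) 0"
    using conv_has_pd[OF 1 f, of 0] *[OF f(1)] *[OF f(4)] unfolding has_pd_def by simp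
  from has_pd_partial_dir[OF this] has_pd_partial_dir[OF has_pd_const] show ?thesis by simp
qed

section \<open>The fundamental solution\<close>

text \<open>Stands in for integration in polar coordinates. Each \<open>z\<close> lies in some ball
  of radius \<open>r k\<close> on which \<open>a k\<close> is an admissible bound, so
  \<open>F\<close> is below the sum of these step functions, and the area of the k-th ball is a
  multiple of \<open>(r k)\<^sup>2\<close>. It serves both the singularity of
  \<open>1 / cmod z\<close> at 0 and decay at infinity.\<close>

lemma nn_integral_dyadic_finite:
  fixes F :: "complex \<Rightarrow> real"
  assumes le: "\<And>z. F z \<noteq> 0 \<Longrightarrow> \<exists>k::nat. F z \<le> a k \<and> cmod z \<le> r k"
    and pos: "\<And>k. 0 \<le> a k" "\<And>k. 0 \<le> r k" and sum: "summable (\<lambda>k. a k * (r k)\<^sup>2)"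
  shows "(\<integral>\<^sup>+z. ennreal (F z) \<partial>lborel) < \<infinity>"
proof -
  let ?V = "unit_ball_vol (real DIM(complex))"
  have V: "0 \<le> ?V" by simp
  have "(\<integral>\<^sup>+z. ennreal (F z) \<partial>lborel)
      \<le> (\<integral>\<^sup>+z. (\<Sum>k. ennreal (a k) * indicator (cball (0::complex) (r k)) z) \<partial>lborel)"
  proof (rule nn_integral_mono)
    fix z
    show "ennreal (F z) \<le> (\<Sum>k. ennreal (a k) * indicator (cball (0::complex) (r k)) z)"
    proof (cases "F z = 0")
      case False
      then obtain k where k: "F z \<le> a k" "cmod z \<le> r k" using le by blast
      then have "ennreal (F z) \<le> ennreal (a k) * indicator (cball (0::complex) (r k)) z"
        by (simp add: ennreal_leI)
      also have "\<dots> \<le> (\<Sum>k. ennreal (a k) * indicator (cball (0::complex) (r k)) z)"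
      proof -
        have "t k \<le> suminf t" for t :: "nat \<Rightarrow> ennreal"
          using sum_le_suminf[OF summableI, of "{k}" t] by simp
        then show ?thesis .
      qed
      finally show ?thesis .
    qed simp
  qed
  also have "\<dots> = (\<Sum>k. \<integral>\<^sup>+z. ennreal (a k) * indicator (cball (0::complex) (r k)) z \<partial>lborel)"
    by (rule nn_integral_suminf) (auto intro!: borel_measurable_times_ennreal borel_measurable_indicator)
  also have "\<dots> = (\<Sum>k. ennreal (?V * (a k * (r k)\<^sup>2)))"
  proof (rule arg_cong[where f = suminf], rule ext)
    fix k
    have "(\<integral>\<^sup>+z. ennreal (a k) * indicator (cball (0::complex) (r k)) z \<partial>lborel)
        = ennreal (a k) * emeasure lborel (cball (0::complex) (r k))"
      by (rule nn_integral_cmult_indicator) simp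
    also have "\<dots> = ennreal (?V * (a k * (r k)\<^sup>2))"
      using pos V by (simp add: emeasure_cball ennreal_mult[symmetric] algebra_simps)
    finally show "(\<integral>\<^sup>+z. ennreal (a k) * indicator (cball (0::complex) (r k)) z \<partial>lborel)
      = ennreal (?V * (a k * (r k)\<^sup>2))" .
  qed
  also have "\<dots> < \<infinity>"
  proof -
    have s: "summable (\<lambda>k. ?V * (a k * (r k)\<^sup>2))" by (rule summable_mult[OF sum])
    have "(\<Sum>k. ennreal (?V * (a k * (r k)\<^sup>2))) = ennreal (\<Sum>k. ?V * (a k * (r k)\<^sup>2))"
      by (rule suminf_ennreal2[OF _ s]) (use pos V in simp)
    then show ?thesis by simp
  qed
  finally show ?thesis .
qed

lemma inverse_norm_integrable: "integrable lborel (\<lambda>z. indicator (cball (0::complex) R) z *\<^sub>R (1 / cmod z))"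
proof (cases "R > 0")
  case True
  have "(\<integral>\<^sup>+z. ennreal (indicator (cball (0::complex) R) z *\<^sub>R (1 / cmod z)) \<partial>lborel) < \<infinity>"
  proof (rule nn_integral_dyadic_finite[where a = "\<lambda>k. 2 ^ Suc k / R" and r = "\<lambda>k. R / 2 ^ k"])
    fix z :: complex assume "indicator (cball 0 R) z *\<^sub>R (1 / cmod z) \<noteq> (0::real)"
    then have z: "z \<noteq> 0" "cmod z \<le> R" by (auto simp: indicator_def split: if_splits)
    \<comment> \<open>With \<open>k = Suc j\<close> minimal,
      \<open>2 ^ j \<le> R / cmod z < 2 ^ Suc j\<close>. That \<open>k\<close> is not 0 follows from
      \<open>cmod z \<le> R\<close>.\<close>
    define k where "k = (LEAST k. R / cmod z < 2 ^ k)"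
    have ex: "\<exists>k. R / cmod z < 2 ^ k" by (rule real_arch_pow) simp
    have k: "R / cmod z < 2 ^ k" unfolding k_def by (rule LeastI_ex[OF ex])
    have "k \<noteq> 0" using k z by (intro notI) (simp add: field_simps)
    then obtain j where j: "k = Suc j" by (cases k) auto
    have "\<not> R / cmod z < 2 ^ j" using not_less_Least[of j "\<lambda>k. R / cmod z < 2 ^ k"] j k_def by auto
    then show "\<exists>k. indicator (cball 0 R) z *\<^sub>R (1 / cmod z) \<le> 2 ^ Suc k / R \<and> cmod z \<le> R / 2 ^ k"
      using k z True unfolding j by (intro exI[of _ j]) (simp add: field_simps)
  next
    have "summable (\<lambda>k. 2 * R * (1 / 2) ^ k :: real)" by (intro summable_mult summable_geometric) simp
    moreover have "2 ^ Suc k / R * (R / 2 ^ k)\<^sup>2 = 2 * R * (1 / 2) ^ k" for k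
      using True by (simp add: field_simps power2_eq_square)
    ultimately show "summable (\<lambda>k. 2 ^ Suc k / R * (R / 2 ^ k)\<^sup>2)" by simp
  qed (use True in auto)
  moreover have "(\<lambda>z. indicator (cball (0::complex) R) z *\<^sub>R (1 / cmod z)) \<in> borel_measurable lborel"
    by (intro borel_measurable_scaleR borel_measurable_indicator) auto
  ultimately show ?thesis by (intro integrableI_nonneg) auto
next
  case False
  have "indicator (cball (0::complex) R) z *\<^sub>R (1 / cmod z) = 0" for z
    using False norm_le_zero_iff[of z] by (cases "z = 0") (auto simp: indicator_def simp del: norm_le_zero_iff)
  then show ?thesis by (simp only: integrable_zero)
qed

lemma locint_kernel:
  assumes "continuous_on UNIV g"
  shows "locint (\<lambda>z. g z / z)"
  unfolding locint_def
proof (intro conjI allI)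
  have [measurable]: "g \<in> borel_measurable borel" using assms by (rule borel_measurable_continuous_onI)
  show [measurable]: "(\<lambda>z. g z / z) \<in> borel_measurable borel" by measurable
  fix R
  obtain B where B: "\<And>y. y \<in> cball 0 R \<Longrightarrow> cmod (g y) \<le> B"
    using continuous_bounded_cball[OF assms] by blast
  show "integrable lborel (\<lambda>y. indicator (cball 0 R) y *\<^sub>R (g y / y))"
  proof (rule Bochner_Integration.integrable_bound[where f = "\<lambda>y. B * (indicator (cball 0 R) y *\<^sub>R (1 / cmod y))"])
    show "integrable lborel (\<lambda>y. B * (indicator (cball 0 R) y *\<^sub>R (1 / cmod y)))"
      by (rule integrable_mult_right[OF inverse_norm_integrable])
    have "cmod (indicator (cball 0 R) y *\<^sub>R (g y / y)) \<le> norm (B * (indicator (cball 0 R) y *\<^sub>R (1 / cmod y)))" for y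
      using B[of y] by (auto simp: indicator_def norm_divide intro!: divide_right_mono)
    then show "AE y in lborel. cmod (indicator (cball 0 R) y *\<^sub>R (g y / y))
        \<le> norm (B * (indicator (cball 0 R) y *\<^sub>R (1 / cmod y)))"
      by simp
    show "(\<lambda>y. indicator (cball 0 R) y *\<^sub>R (g y / y)) \<in> borel_measurable lborel"
      by (intro borel_measurable_scaleR borel_measurable_indicator) auto
  qed
qed

text \<open>This number is \<pi>, so that \<open>1 / (pompeiu_const * z)\<close> is the classical
  fundamental solution of \<open>dbar\<close>. It is kept in the form in which it arises, as the
  total mass of the approximate identity below; what enters later is its positivity.\<close>

definition pompeiu_const :: real where
  "pompeiu_const = integral\<^sup>L lborel (\<lambda>w::complex. 1 / (1 + (cmod w)\<^sup>2)\<^sup>2)"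

lemma pompeiu_integrable: "integrable lborel (\<lambda>w::complex. 1 / (1 + (cmod w)\<^sup>2)\<^sup>2)"
proof (rule integrableI_nonneg)
  show "(\<integral>\<^sup>+w. ennreal (1 / (1 + (cmod w)\<^sup>2)\<^sup>2) \<partial>lborel) < \<infinity>"
  \<comment> \<open>For \<open>2 ^ (k - 1) \<le> cmod w\<close> the denominator is at least
    \<open>16 ^ (k - 1)\<close>, while the area of the k-th ball grows like \<open>4 ^ k\<close>: a
    geometric series of ratio 1/4.\<close>
  proof (rule nn_integral_dyadic_finite[where a = "\<lambda>k. 16 / 16 ^ k" and r = "\<lambda>k. 2 ^ k"])
    fix w :: complex
    define k where "k = (LEAST k. cmod w < 2 ^ k)"
    have ex: "\<exists>k. cmod w < 2 ^ k" by (rule real_arch_pow) simp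
    have k: "cmod w < 2 ^ k" unfolding k_def by (rule LeastI_ex[OF ex])
    have "1 / (1 + (cmod w)\<^sup>2)\<^sup>2 \<le> 16 / 16 ^ k"
    proof (cases k)
      case 0
      have "1 \<le> (1 + (cmod w)\<^sup>2)\<^sup>2" by (intro one_le_power) simp
      then have "1 / (1 + (cmod w)\<^sup>2)\<^sup>2 \<le> 1" by (simp add: divide_le_eq_1)
      then show ?thesis using 0 by simp
    next
      case (Suc j)
      have "\<not> cmod w < 2 ^ j" using not_less_Least[of j "\<lambda>k. cmod w < 2 ^ k"] Suc k_def by auto
      then have "(2 ^ j)\<^sup>2 \<le> (cmod w)\<^sup>2" by (intro power_mono) auto
      then have "(2 ^ j)\<^sup>2 \<le> 1 + (cmod w)\<^sup>2" by linarith
      then have "((2 ^ j)\<^sup>2)\<^sup>2 \<le> (1 + (cmod w)\<^sup>2)\<^sup>2" by (intro power_mono) auto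
      moreover have "((2 ^ j)\<^sup>2)\<^sup>2 = (16 ^ j :: real)"
        by (induction j) (auto simp: power_mult_distrib)
      moreover have "0 < 1 + (cmod w)\<^sup>2" by (intro add_pos_nonneg) auto
      ultimately have "1 / (1 + (cmod w)\<^sup>2)\<^sup>2 \<le> 1 / 16 ^ j"
        by (intro divide_left_mono mult_pos_pos) (auto simp: zero_less_power)
      then show ?thesis using Suc by simp
    qed
    then show "\<exists>k. 1 / (1 + (cmod w)\<^sup>2)\<^sup>2 \<le> 16 / 16 ^ k \<and> cmod w \<le> 2 ^ k" using k by force
  next
    have "summable (\<lambda>k. 16 * (1 / 4) ^ k :: real)" by (intro summable_mult summable_geometric) simp
    moreover have "16 / 16 ^ k * (2 ^ k)\<^sup>2 = 16 * (1 / 4 :: real) ^ k" for k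
    proof -
      have "(2 ^ k)\<^sup>2 = (4 ^ k :: real)" "(16 ^ k :: real) = 4 ^ k * 4 ^ k"
        by (induction k) (auto simp: power_mult_distrib)
      then show ?thesis by (simp add: field_simps power_one_over)
    qed
    ultimately show "summable (\<lambda>k. 16 / 16 ^ k * (2 ^ k)\<^sup>2 :: real)" by simp
  qed auto
qed auto

lemma pompeiu_const_pos: "pompeiu_const > 0"
proof -
  have f: "emeasure lborel (cball (0::complex) 1) < \<infinity>" by (rule emeasure_bounded_finite) simp
  have "0 < measure lborel (cball (0::complex) 1) * (1 / 4)"
    using content_cball_pos[of 1 "0::complex"] by simp
  also have "\<dots> = (\<integral>w. indicator (cball (0::complex) 1) w * (1 / 4) \<partial>lborel)"
    by simp
  also have "\<dots> \<le> pompeiu_const" unfolding pompeiu_const_def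
  proof (rule integral_mono[OF _ pompeiu_integrable])
    show "integrable lborel (\<lambda>w. indicator (cball (0::complex) 1) w * (1 / 4) :: real)"
      using f by (intro integrable_mult_left integrable_real_indicator) (auto simp: infinity_ennreal_def)
    fix w :: complex
    show "indicator (cball 0 1) w * (1 / 4) \<le> 1 / (1 + (cmod w)\<^sup>2)\<^sup>2"
    proof (cases "cmod w \<le> 1")
      case True
      then have "(cmod w)\<^sup>2 \<le> 1" by (simp add: power_le_one)
      then have "(1 + (cmod w)\<^sup>2)\<^sup>2 \<le> 2\<^sup>2" by (intro power_mono) auto
      then show ?thesis using True
        by (simp add: divide_simps) (metis add_pos_nonneg less_numeral_extra(1) zero_le_power2 less_irrefl power_eq_0_iff)
    qed simp
  qed
  finally show ?thesis .
qed

text \<open>The kernel \<open>g(z)/z\<close> is approximated by \<open>g(z) cnj z / (|z|\<^sup>2 + s\<^sup>2)\<close>, whose \<open>dbar\<close> is the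
  approximate identity \<open>g(z) s\<^sup>2 / (|z|\<^sup>2 + s\<^sup>2)\<^sup>2\<close> of total mass \<open>pompeiu_const\<close>.\<close>

lemma pompeiu_regularised:
  assumes g: "g holomorphic_on UNIV" and s: "s > 0" and f: "test_fun f"
  shows "(\<integral>y. g y * cnj y / of_real ((cmod y)\<^sup>2 + s\<^sup>2) * dbar f (x - y) \<partial>lborel) =
         (\<integral>y. g y * of_real (s\<^sup>2 / ((cmod y)\<^sup>2 + s\<^sup>2)\<^sup>2) * f (x - y) \<partial>lborel)"
proof -
  define D where "D y = complex_of_real ((cmod y)\<^sup>2 + s\<^sup>2)" for y
  have D0: "D y \<noteq> 0" for y
    using s unfolding D_def of_real_eq_0_iff by (metis add_nonneg_pos less_irrefl zero_le_power2 zero_less_power)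
  \<comment> \<open>As a polynomial in \<open>y\<close> and \<open>cnj y\<close>, \<open>D\<close>
    is accessible to the product rule.\<close>
  have Deq: "D = (\<lambda>y. y * cnj y + of_real (s\<^sup>2))" unfolding D_def
    by (simp add: complex_norm_square[symmetric] fun_eq_iff)
  have id: "has_pd e (\<lambda>z. z) e y" for e y by (rule has_pd_bounded_linear) simp
  have cnj: "has_pd e cnj (cnj e) y" for e y by (rule has_pd_bounded_linear) (rule bounded_linear_cnj)
  have D: "has_pd e D (e * cnj y + y * cnj e) y" for e y
    using has_pd_add[OF has_pd_mult[OF id cnj] has_pd_const] unfolding Deq by simp
  have iD: "has_pd e (\<lambda>y. inverse (D y)) (- (e * cnj y + y * cnj e) / (D y)\<^sup>2) y" for e y
  proof -
    have "((\<lambda>t::real. inverse (D (y + of_real t * e))) has_vector_derivative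
        (e * cnj y + y * cnj e) * (- inverse (D y) * inverse (D y))) (at 0)"
      using field_vector_diff_chain_at[of "\<lambda>t::real. D (y + of_real t * e)" "e * cnj y + y * cnj e" 0
          inverse "- inverse (D y) * inverse (D y)"] D[of e y] D0
      unfolding has_pd_def comp_def
      by (simp add: DERIV_inverse[unfolded power2_eq_square power_Suc] numeral_2_eq_2 DERIV_inverse')
        (metis (no_types, lifting) DERIV_inverse mult_minus_left numeral_2_eq_2 power_Suc0_right power_Suc)
    moreover have "(e * cnj y + y * cnj e) * (- inverse (D y) * inverse (D y)) =
        - (e * cnj y + y * cnj e) / (D y)\<^sup>2"
      by (simp add: divide_inverse power2_eq_square algebra_simps)
    ultimately show ?thesis unfolding has_pd_def by simp
  qed
  have cD: "continuous_on UNIV D" unfolding Deq by (intro continuous_intros)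
  have cg: "continuous_on UNIV g" by (rule holomorphic_on_imp_continuous_on[OF g])
  have cg': "continuous_on UNIV (deriv g)"
    by (rule holomorphic_on_imp_continuous_on) (rule holomorphic_deriv[OF g], simp)
  have gd: "has_pd e g (e * deriv g y) y" for e y
    by (rule has_pd_field_derivative[OF holomorphic_derivI[OF g]]) auto
  define K where "K y = g y * cnj y * inverse (D y)" for y
  define K' where "K' e y = (e * deriv g y * cnj y + g y * cnj e) * inverse (D y)
      + g y * cnj y * (- (e * cnj y + y * cnj e) / (D y)\<^sup>2)" for e y
  have K: "has_pd e K (K' e y) y" for e y
    unfolding K_def K'_def by (rule has_pd_mult[OF has_pd_mult[OF gd cnj] iD])
  have cK: "continuous_on UNIV K" unfolding K_def using D0
    by (intro continuous_intros cg cD) auto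
  have cK': "continuous_on UNIV (K' e)" for e unfolding K'_def using D0
    by (intro continuous_intros cg cg' cD) auto
  have ef: "has_pd e (\<lambda>y. f (x - y)) (- partial_dir e f (x - y)) y" if "e \<in> {1, \<i>}" for e y
    by (rule has_pd_reflect[OF test_funD(3)[OF f that]])
  have cf: "continuous_on UNIV (\<lambda>y. f (x - y))" "csupp (\<lambda>y. f (x - y))"
    using continuous_reflect csupp_reflect test_funD[OF f] by auto
  have cf': "continuous_on UNIV (\<lambda>y. partial_dir e f (x - y))" "csupp (\<lambda>y. partial_dir e f (x - y))"
    if "e \<in> {1, \<i>}" for e
    using continuous_reflect csupp_reflect test_funD[OF test_fun_partial_dir[OF f that]] by auto
  have int: "integrable lborel (\<lambda>y. k y * l y)" if "continuous_on UNIV k" "continuous_on UNIV l" "csupp l" for k l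
    by (rule locint_mult_integrable[OF locint_bounded that(2,3)])
      (use that(1) continuous_bounded_cball in \<open>auto intro: borel_measurable_continuous_onI\<close>)
  have I: "(\<integral>y. K' e y * f (x - y) \<partial>lborel) = (\<integral>y. K y * partial_dir e f (x - y) \<partial>lborel)"
    if e: "e \<in> {1, \<i>}" for e
  proof -
    \<comment> \<open>Integration by parts: the integrand is the derivative of the compactly
      supported product \<open>K y * f (x - y)\<close>; the minus sign comes from the
      reflection.\<close>
    have "(\<integral>y. K' e y * f (x - y) + K y * (- partial_dir e f (x - y)) \<partial>lborel) = 0"
    proof (rule integral_pd_eq_0[where f = "\<lambda>y. K y * f (x - y)" and e = e])
      show "has_pd e (\<lambda>y. K y * f (x - y)) (K' e z * f (x - z) + K z * (- partial_dir e f (x - z))) z" for z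
        by (rule has_pd_mult[OF K ef[OF e]])
      show "csupp (\<lambda>y. K y * f (x - y))" by (rule csupp_mult(2)[OF cf(2)])
    qed (intro continuous_intros cK cK' cf(1) cf'(1) e)+
    then show ?thesis
      using int[OF cK' cf] int[OF cK cf'[OF e]] by simp
  qed
  have "(\<integral>y. K y * dbar f (x - y) \<partial>lborel) =
      (\<integral>y. (K y * partial_dir 1 f (x - y) + \<i> * (K y * partial_dir \<i> f (x - y))) / 2 \<partial>lborel)"
    unfolding dbar_def by (simp add: algebra_simps)
  also have "\<dots> = ((\<integral>y. K y * partial_dir 1 f (x - y) \<partial>lborel) + \<i> * (\<integral>y. K y * partial_dir \<i> f (x - y) \<partial>lborel)) / 2"
    using int[OF cK cf'[of 1]] int[OF cK cf'[of \<i>]] by simp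
  also have "\<dots> = ((\<integral>y. K' 1 y * f (x - y) \<partial>lborel) + \<i> * (\<integral>y. K' \<i> y * f (x - y) \<partial>lborel)) / 2"
    by (simp add: I)
  also have "\<dots> = (\<integral>y. (K' 1 y * f (x - y) + \<i> * (K' \<i> y * f (x - y))) / 2 \<partial>lborel)"
    using int[OF cK' cf] by simp
  also have "\<dots> = (\<integral>y. g y * (of_real (s\<^sup>2) / (D y)\<^sup>2) * f (x - y) \<partial>lborel)"
  proof -
    \<comment> \<open>The terms with \<open>deriv g\<close> cancel because
      \<open>1 + \<i> * \<i> = 0\<close>: \<open>dbar\<close> does not see the holomorphic factor
      \<open>g\<close>.\<close>
    have "(K' 1 y + \<i> * K' \<i> y) / 2 = g y * (of_real (s\<^sup>2) / (D y)\<^sup>2)" for y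
    proof -
      have "(K' 1 y + \<i> * K' \<i> y) / 2 = g y * inverse (D y) - g y * y * cnj y / (D y)\<^sup>2"
        unfolding K'_def by (simp add: algebra_simps add_divide_distrib diff_divide_distrib)
      also have "\<dots> = g y * ((D y - y * cnj y) / (D y)\<^sup>2)"
        using D0[of y] by (simp add: field_simps power2_eq_square)
      also have "D y - y * cnj y = of_real (s\<^sup>2)" unfolding Deq by simp
      finally show ?thesis .
    qed
    then have "(K' 1 y * f (x - y) + \<i> * (K' \<i> y * f (x - y))) / 2 = g y * (of_real (s\<^sup>2) / (D y)\<^sup>2) * f (x - y)" for y
      by (metis (no_types, lifting) distrib_right mult.assoc times_divide_eq_left)
    then show ?thesis by simp
  qed
  finally show ?thesis unfolding K_def D_def by (simp add: divide_inverse)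
qed

text \<open>The left side is the limit of the regularised formula as \<open>s\<close> tends to 0. On
  its right side the substitution \<open>y = s * w\<close> turns the approximate identity into the
  fixed density \<open>1 / (1 + |w|^2)^2\<close>, multiplied by
  \<open>g (s * w) * f (x - s * w)\<close>, which tends to \<open>g 0 * f x = f x\<close>.\<close>

theorem pompeiu:
  assumes g: "g holomorphic_on UNIV" "g 0 = 1" and f: "test_fun f"
  shows "conv (\<lambda>z. g z / z) (dbar f) x = of_real pompeiu_const * f x"
proof -
  define s where "s n = inverse (real (Suc n))" for n
  have s: "s n > 0" for n unfolding s_def by simp
  have s0: "s \<longlonglongrightarrow> 0" unfolding s_def by (rule LIMSEQ_inverse_real_of_nat)
  have cg: "continuous_on UNIV g" by (rule holomorphic_on_imp_continuous_on[OF g(1)])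
  define r where "r n y = (cmod y)\<^sup>2 / ((cmod y)\<^sup>2 + (s n)\<^sup>2)" for n y
  have pos: "(cmod y)\<^sup>2 + (s n)\<^sup>2 > 0" for n y
    using s[of n] by (intro add_nonneg_pos) auto
  note fd = test_funD[OF test_fun_dbar[OF f]]
  have fd': "continuous_on UNIV (\<lambda>y. dbar f (x - y))" "csupp (\<lambda>y. dbar f (x - y))"
    using continuous_reflect csupp_reflect fd by auto
  obtain B where B: "\<And>z. cmod (dbar f (x - z)) \<le> B" by (rule csupp_bounded[OF fd']) blast
  obtain R where R: "\<And>z. R < cmod z \<Longrightarrow> dbar f (x - z) = 0" using fd'(2) unfolding csupp_def by blast
  have "(\<lambda>n. \<integral>y. g y / y * (of_real (r n y) * dbar f (x - y)) \<partial>lborel) \<longlonglongrightarrow>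
      (\<integral>y. g y / y * dbar f (x - y) \<partial>lborel)"
  proof (rule locint_dominated[OF locint_kernel[OF cg], where B = B and R = R])
    show "(\<lambda>y. of_real (r n y) * dbar f (x - y)) \<in> borel_measurable borel" for n
      unfolding r_def using pos[of _ n]
      by (intro borel_measurable_continuous_onI continuous_intros fd'(1)) (auto simp: less_le)
    show "(\<lambda>y. dbar f (x - y)) \<in> borel_measurable borel"
      by (intro borel_measurable_continuous_onI fd'(1))
    show "cmod (of_real (r n y) * dbar f (x - y)) \<le> B" for n y
    proof -
      have "0 \<le> r n y" "r n y \<le> 1" unfolding r_def using pos[of y n] by (auto simp: divide_le_eq_1)
      then show ?thesis
        using mult_mono[OF _ B[of y], of "r n y" 1] by (simp add: norm_mult)
    qed
    show "of_real (r n y) * dbar f (x - y) = 0" if "R < cmod y" for n y using R that by simp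
    show "(\<lambda>n. g y / y * (of_real (r n y) * dbar f (x - y))) \<longlonglongrightarrow> g y / y * dbar f (x - y)" for y
    \<comment> \<open>At \<open>y = 0\<close> the factor \<open>r n 0\<close> is 0 and does not tend
      to 1, but the quotient \<open>g 0 / 0\<close> is 0, so both sides vanish.\<close>
    proof (cases "y = 0")
      case False
      have "(\<lambda>n. r n y) \<longlonglongrightarrow> (cmod y)\<^sup>2 / ((cmod y)\<^sup>2 + 0\<^sup>2)"
        unfolding r_def using False by (intro tendsto_intros s0) auto
      then have "(\<lambda>n. r n y) \<longlonglongrightarrow> 1" using False by simp
      then have "(\<lambda>n. g y / y * (of_real (r n y) * dbar f (x - y))) \<longlonglongrightarrow> g y / y * (of_real 1 * dbar f (x - y))"
        by (intro tendsto_intros)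
      then show ?thesis by simp
    qed simp
  qed
  moreover have "(\<integral>y. g y / y * (of_real (r n y) * dbar f (x - y)) \<partial>lborel) =
      (\<integral>w. of_real (1 / (1 + (cmod w)\<^sup>2)\<^sup>2) * (g (of_real (s n) * w) * f (x - of_real (s n) * w)) \<partial>lborel)" for n
  proof -
    have e: "g y / y * (of_real (r n y) * dbar f (x - y))
        = g y * cnj y / of_real ((cmod y)\<^sup>2 + (s n)\<^sup>2) * dbar f (x - y)" for y
    proof (cases "y = 0")
      case False
      have "of_real (r n y) = y * cnj y / of_real ((cmod y)\<^sup>2 + (s n)\<^sup>2)"
        unfolding r_def by (simp add: complex_norm_square[symmetric])
      then show ?thesis using False by simp
    qed simp
    define k where "k y = g y * of_real ((s n)\<^sup>2 / ((cmod y)\<^sup>2 + (s n)\<^sup>2)\<^sup>2) * f (x - y)" for y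
    have "continuous_on UNIV k" unfolding k_def using pos[of _ n]
      by (intro continuous_intros cg continuous_reflect test_funD(1)[OF f]) (auto simp: less_le)
    then have m: "k \<in> borel_measurable borel" by (rule borel_measurable_continuous_onI)
    have "(\<integral>y. g y / y * (of_real (r n y) * dbar f (x - y)) \<partial>lborel) = (\<integral>y. k y \<partial>lborel)"
      unfolding e k_def by (rule pompeiu_regularised[OF g(1) s f])
    also have "\<dots> = of_real ((s n)\<^sup>2) * (\<integral>w. k (0 + of_real (s n) * w) \<partial>lborel)"
      by (rule lborel_integral_affine_complex[OF m]) (use s[of n] in simp)
    also have "\<dots> = (\<integral>w. of_real ((s n)\<^sup>2) * k (of_real (s n) * w) \<partial>lborel)" by simp
    also have "\<dots> = (\<integral>w. of_real (1 / (1 + (cmod w)\<^sup>2)\<^sup>2) * (g (of_real (s n) * w) * f (x - of_real (s n) * w)) \<partial>lborel)"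
    proof (rule Bochner_Integration.integral_cong[OF refl])
      fix w :: complex
      have "(s n)\<^sup>2 * ((s n)\<^sup>2 / ((cmod (of_real (s n) * w))\<^sup>2 + (s n)\<^sup>2)\<^sup>2) = 1 / (1 + (cmod w)\<^sup>2)\<^sup>2"
      proof -
        have "(cmod (of_real (s n) * w))\<^sup>2 + (s n)\<^sup>2 = (s n)\<^sup>2 * (1 + (cmod w)\<^sup>2)"
          using s[of n] by (simp add: norm_mult power_mult_distrib algebra_simps)
        then show ?thesis using s[of n] by (simp add: power_mult_distrib power2_eq_square[of "(s n)\<^sup>2"])
      qed
      then have "complex_of_real ((s n)\<^sup>2) * of_real ((s n)\<^sup>2 / ((cmod (of_real (s n) * w))\<^sup>2 + (s n)\<^sup>2)\<^sup>2)
          = of_real (1 / (1 + (cmod w)\<^sup>2)\<^sup>2)"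
        by (simp only: of_real_mult[symmetric])
      from this[symmetric] show "of_real ((s n)\<^sup>2) * k (of_real (s n) * w) =
          of_real (1 / (1 + (cmod w)\<^sup>2)\<^sup>2) * (g (of_real (s n) * w) * f (x - of_real (s n) * w))"
        unfolding k_def by (simp only: mult_ac)
    qed
    finally show ?thesis .
  qed
  moreover have "(\<lambda>n. \<integral>w. of_real (1 / (1 + (cmod w)\<^sup>2)\<^sup>2) * (g (of_real (s n) * w) * f (x - of_real (s n) * w)) \<partial>lborel)
      \<longlonglongrightarrow> (\<integral>w. of_real (1 / (1 + (cmod w)\<^sup>2)\<^sup>2) * f x \<partial>lborel)"
  proof -
    \<comment> \<open>\<open>g\<close> may be unbounded; its product with the compactly supported
      factor is bounded by some \<open>M\<close>, and the density times \<open>M\<close>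
      dominates.\<close>
    define k where "k z = g z * f (x - z)" for z
    have ck: "continuous_on UNIV k" unfolding k_def
      by (intro continuous_intros cg continuous_reflect test_funD(1)[OF f])
    have "csupp k" unfolding k_def by (rule csupp_mult(2)[OF csupp_reflect[OF test_funD(2)[OF f]]])
    then obtain M where M: "\<And>z. cmod (k z) \<le> M" by (rule csupp_bounded[OF ck]) blast
    have [measurable]: "k \<in> borel_measurable borel" by (rule borel_measurable_continuous_onI[OF ck])
    have "(\<lambda>n. \<integral>w. of_real (1 / (1 + (cmod w)\<^sup>2)\<^sup>2) * k (of_real (s n) * w) \<partial>lborel)
      \<longlonglongrightarrow> (\<integral>w. of_real (1 / (1 + (cmod w)\<^sup>2)\<^sup>2) * f x \<partial>lborel)"
    proof (rule integral_dominated_convergence[where w = "\<lambda>w. 1 / (1 + (cmod w)\<^sup>2)\<^sup>2 * M"])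
      show "integrable lborel (\<lambda>w. 1 / (1 + (cmod w)\<^sup>2)\<^sup>2 * M)"
        by (rule integrable_mult_left[OF pompeiu_integrable])
      have "cmod (of_real (1 / (1 + (cmod w)\<^sup>2)\<^sup>2) * k (of_real (s n) * w)) \<le> 1 / (1 + (cmod w)\<^sup>2)\<^sup>2 * M" for w n
        using mult_left_mono[OF M[of "of_real (s n) * w"], of "1 / (1 + (cmod w)\<^sup>2)\<^sup>2"]
        by (simp add: norm_mult norm_divide norm_power del: of_real_add)
      then show "AE w in lborel. cmod (of_real (1 / (1 + (cmod w)\<^sup>2)\<^sup>2) * k (of_real (s n) * w))
          \<le> 1 / (1 + (cmod w)\<^sup>2)\<^sup>2 * M" for n
        by simp
      have "(\<lambda>n. k (of_real (s n) * w)) \<longlonglongrightarrow> k (of_real 0 * w)" for w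
      proof -
        have c: "isCont k (of_real 0 * w)" using ck by (simp add: continuous_on_eq_continuous_at)
        show ?thesis by (rule isCont_tendsto_compose[OF c]) (intro tendsto_intros s0)
      qed
      then have "(\<lambda>n. k (of_real (s n) * w)) \<longlonglongrightarrow> f x" for w unfolding k_def using g(2) by simp
      then show "AE w in lborel. (\<lambda>n. of_real (1 / (1 + (cmod w)\<^sup>2)\<^sup>2) * k (of_real (s n) * w))
          \<longlonglongrightarrow> of_real (1 / (1 + (cmod w)\<^sup>2)\<^sup>2) * f x"
        by (intro AE_I2 tendsto_intros)
    qed measurable
    then show ?thesis unfolding k_def .
  qed
  moreover have "(\<integral>w. of_real (1 / (1 + (cmod w)\<^sup>2)\<^sup>2) * f x \<partial>lborel) = of_real pompeiu_const * f x"
    unfolding pompeiu_const_def by (subst integral_mult_left_zero) (simp only: integral_complex_of_real)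
  ultimately show ?thesis unfolding conv_def using LIMSEQ_unique by simp
qed

section \<open>Cutoff functions\<close>

text \<open>The polynomial parameter closes the family under differentiation, as the coinductive
  criterion for smoothness requires; \<open>p = 1\<close> is the usual flat function.\<close>

definition flat_fun :: "real poly \<Rightarrow> real \<Rightarrow> real" where
  "flat_fun p t = (if t > 0 then poly p (1 / t) * exp (- (1 / t)) else 0)"

lemma flat_fun_tendsto_0: "(flat_fun p \<longlongrightarrow> 0) (at 0)"
proof -
  have e: "((\<lambda>u. poly p u * exp (- u)) \<longlongrightarrow> 0) at_top"
  proof -
    have "((\<lambda>u. \<Sum>i\<le>degree p. coeff p i * (u ^ i / exp u)) \<longlongrightarrow> (\<Sum>i\<le>degree p. coeff p i * 0)) at_top"
      by (intro tendsto_sum tendsto_mult tendsto_const tendsto_power_div_exp_0)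
    then show ?thesis
      by (simp add: poly_altdef sum_distrib_right exp_minus divide_inverse mult.assoc)
  qed
  have "((\<lambda>t. poly p (inverse t) * exp (- inverse t)) \<longlongrightarrow> 0) (at_right 0)"
    by (rule filterlim_compose[OF e filterlim_inverse_at_top_right])
  then have "(flat_fun p \<longlongrightarrow> 0) (at_right 0)"
    by (rule Lim_transform_eventually) (auto simp: eventually_at_filter flat_fun_def divide_inverse)
  moreover have "(flat_fun p \<longlongrightarrow> 0) (at_left 0)"
    by (rule Lim_transform_eventually[OF tendsto_const]) (auto simp: eventually_at_filter flat_fun_def)
  ultimately show ?thesis by (simp add: filterlim_split_at)
qed

text \<open>With \<open>u = 1 / t\<close> one has \<open>d/dt = - u^2 d/du\<close>, which sends
  \<open>p(u) exp(-u)\<close> to \<open>u^2 (p(u) - p'(u)) exp(-u)\<close>;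
  \<open>[:0, 0, 1:]\<close> is the polynomial \<open>u^2\<close>.\<close>

lemma flat_fun_derivative:
  "(flat_fun p has_real_derivative flat_fun ([:0, 0, 1:] * (p - pderiv p)) t) (at t)"
proof (cases t "0::real" rule: linorder_cases)
  case less
  have "((\<lambda>_. 0) has_real_derivative 0) (at t)" by simp
  then have "(flat_fun p has_real_derivative 0) (at t)"
    by (rule has_field_derivative_transform_within_open[where S = "{..<0}"])
      (use less in \<open>auto simp: flat_fun_def\<close>)
  then show ?thesis using less by (simp add: flat_fun_def)
next
  case equal
  \<comment> \<open>The difference quotient at 0 belongs to the family again: dividing by
    \<open>h\<close> multiplies the polynomial by its variable.\<close>
  have "((\<lambda>h. flat_fun (pCons 0 p) h) \<longlongrightarrow> 0) (at 0)" by (rule flat_fun_tendsto_0)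
  moreover have "(flat_fun p h - flat_fun p 0) / (h - 0) = flat_fun (pCons 0 p) h" for h
    by (simp add: flat_fun_def)
  ultimately have "((\<lambda>h. (flat_fun p h - flat_fun p 0) / (h - 0)) \<longlongrightarrow> 0) (at 0)" by simp
  then show ?thesis unfolding equal has_field_derivative_iff by (simp add: flat_fun_def)
next
  case greater
  have "((\<lambda>t. poly p (1 / t) * exp (- (1 / t))) has_real_derivative
      flat_fun ([:0, 0, 1:] * (p - pderiv p)) t) (at t)"
    using greater unfolding flat_fun_def
    by (auto intro!: derivative_eq_intros poly_DERIV[THEN DERIV_chain2] simp: field_simps power2_eq_square)
  then show ?thesis
    by (rule has_field_derivative_transform_within_open[where S = "{0<..}"])
      (use greater in \<open>auto simp: flat_fun_def\<close>)
qed

text \<open>The generators are the flat profiles of \<open>r - |z|^2\<close>, the real-linear maps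
  and the constants. A derivative of a profile is a profile times a real-linear map, and the
  derivative of a linear map is constant.\<close>

lemma Cinf_on_bump: "Cinf_on UNIV (\<lambda>z. of_real (flat_fun p (r - (cmod z)\<^sup>2)))"
proof -
  define B :: "(complex \<Rightarrow> complex) \<Rightarrow> bool" where
    "B h \<longleftrightarrow> (\<exists>p. h = (\<lambda>z. of_real (flat_fun p (r - (cmod z)\<^sup>2)))) \<or> bounded_linear h \<or> (\<exists>c. h = (\<lambda>_. c))" for h
  have flat: "has_pd e (\<lambda>z. of_real (flat_fun p (r - (cmod z)\<^sup>2)))
      (of_real (flat_fun ([:0, 0, 1:] * (p - pderiv p)) (r - (cmod z)\<^sup>2)) * of_real (- 2 * (z \<bullet> e))) z"
    for e p z
  proof -
    have "(cmod (z + of_real t * e))\<^sup>2 = (cmod z)\<^sup>2 + 2 * t * (z \<bullet> e) + t\<^sup>2 * (cmod e)\<^sup>2" for t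
      unfolding scaleR_conv_of_real[symmetric] power2_norm_eq_inner
      by (simp add: inner_add_left inner_add_right inner_commute power2_eq_square)
    then have "((\<lambda>t. r - (cmod (z + of_real t * e))\<^sup>2) has_real_derivative - 2 * (z \<bullet> e)) (at 0)"
      by (auto intro!: derivative_eq_intros)
    from DERIV_chain2[OF flat_fun_derivative this]
    have "((\<lambda>t. flat_fun p (r - (cmod (z + of_real t * e))\<^sup>2)) has_real_derivative
        flat_fun ([:0, 0, 1:] * (p - pderiv p)) (r - (cmod (z + of_real 0 * e))\<^sup>2) * (- 2 * (z \<bullet> e))) (at 0)" .
    from has_vector_derivative_of_real[OF this] show ?thesis
      unfolding has_pd_def by simp
  qed
  have "poly_closure B (\<lambda>z. of_real (flat_fun p (r - (cmod z)\<^sup>2)))"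
    by (rule poly_closure.base) (auto simp: B_def)
  then show ?thesis
  proof (rule Cinf_on_poly_closure[of UNIV B, rotated 3])
    fix h e assume "B h"
    then consider p where "h = (\<lambda>z. of_real (flat_fun p (r - (cmod z)\<^sup>2)))"
      | "bounded_linear h" | c where "h = (\<lambda>_. c)" unfolding B_def by blast
    then show "\<exists>h'. poly_closure B h' \<and> (\<forall>x\<in>UNIV. has_pd e h (h' x) x)"
    proof cases
      case (1 p)
      have "bounded_linear (\<lambda>z. complex_of_real (- 2 * (z \<bullet> e)))"
        by (intro bounded_linear_compose[OF bounded_linear_of_real] bounded_linear_const_mult bounded_linear_inner_left)
      then have "poly_closure B (\<lambda>z. of_real (flat_fun ([:0, 0, 1:] * (p - pderiv p)) (r - (cmod z)\<^sup>2)) * of_real (- 2 * (z \<bullet> e)))"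
        by (intro poly_closure.mult poly_closure.base) (auto simp: B_def simp del: of_real_mult)
      then show ?thesis using flat unfolding 1 by blast
    next
      case 2
      have "poly_closure B (\<lambda>_. h e)" by (rule poly_closure.base) (auto simp: B_def)
      then show ?thesis using has_pd_bounded_linear[OF 2] by blast
    next
      case (3 c)
      have "poly_closure B (\<lambda>_. 0)" by (rule poly_closure.base) (auto simp: B_def)
      then show ?thesis using has_pd_const unfolding 3 by blast
    qed
  next
    fix h assume "B h"
    then consider p where "h = (\<lambda>z. of_real (flat_fun p (r - (cmod z)\<^sup>2)))"
      | "bounded_linear h" | c where "h = (\<lambda>_. c)" unfolding B_def by blast
    then show "continuous_on UNIV h"
    proof cases
      case (1 p)
      have "continuous_on UNIV (flat_fun p)"
        using DERIV_isCont[OF flat_fun_derivative] by (simp add: continuous_on_eq_continuous_at)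
      then have "continuous_on UNIV (\<lambda>z::complex. flat_fun p (r - (cmod z)\<^sup>2))"
        by (rule continuous_on_compose2) (auto intro!: continuous_intros)
      then show ?thesis unfolding 1 by (rule continuous_on_of_real)
    next
      case 2
      then show ?thesis by (rule linear_continuous_on)
    qed simp
  qed auto
qed

lemma norm_conv_le:
  assumes h: "locint h" "\<And>y. cmod (h y) \<le> 1" and f: "continuous_on UNIV f" "csupp f"
  shows "cmod (conv h f x) \<le> (\<integral>y. cmod (f y) \<partial>lborel)"
proof -
  have one: "locint (\<lambda>_. 1)" by (rule locint_bounded) auto
  have "cmod (conv h f x) \<le> (\<integral>y. cmod (h y * f (x - y)) \<partial>lborel)"
    unfolding conv_def by (rule integral_norm_bound)
  also have "\<dots> \<le> (\<integral>y. cmod (f (x - y)) \<partial>lborel)"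
  proof (rule integral_mono)
    show "integrable lborel (\<lambda>y. cmod (h y * f (x - y)))"
      by (intro integrable_norm conv_integrable h f)
    show "integrable lborel (\<lambda>y. cmod (f (x - y)))"
      using conv_integrable[OF one f, of x] by (intro integrable_norm) simp
    show "cmod (h y * f (x - y)) \<le> cmod (f (x - y))" for y
      using mult_right_mono[OF h(2)[of y] norm_ge_zero[of "f (x - y)"]] by (simp add: norm_mult)
  qed
  also have "\<dots> = (\<integral>y. cmod (f y) \<partial>lborel)"
  proof -
    have "(\<lambda>y. complex_of_real (cmod (f y))) \<in> borel_measurable borel"
      by (intro borel_measurable_continuous_onI continuous_intros f)
    from integral_reflect_complex[OF this, of x] show ?thesis by simp
  qed
  finally show ?thesis .
qed

lemma mollifier_kernel_exists:
  assumes "\<eta> > 0"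
  obtains k where "test_fun k" "\<And>z. \<eta> \<le> cmod z \<Longrightarrow> k z = 0" "(\<integral>y. k y \<partial>lborel) = 1"
    "(\<integral>y. cmod (k y) \<partial>lborel) = 1"
proof -
  define b where "b z = flat_fun 1 (\<eta>\<^sup>2 - (cmod z)\<^sup>2)" for z
  have b0: "b z \<ge> 0" for z unfolding b_def flat_fun_def by simp
  have bs: "b z = 0" if "\<eta> \<le> cmod z" for z
  proof -
    have "\<eta>\<^sup>2 \<le> (cmod z)\<^sup>2" using that assms by (intro power_mono) auto
    then show ?thesis unfolding b_def flat_fun_def by simp
  qed
  have Cb: "Cinf_on UNIV (\<lambda>z. of_real (b z))" unfolding b_def by (rule Cinf_on_bump)
  have tb: "test_fun (\<lambda>z. of_real (b z))" unfolding test_fun_def csupp_def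
    using Cb bs by (auto intro!: exI[of _ \<eta>])
  have "locint (\<lambda>_. 1)" by (rule locint_bounded) auto
  from locint_mult_integrable[OF this test_funD(1,2)[OF tb]]
  have ib: "integrable lborel b" by (simp add: complex_of_real_integrable_eq)
  define J where "J = (\<integral>y. b y \<partial>lborel)"
  have "J > 0"
  proof -
    define m where "m = exp (- (1 / (\<eta>\<^sup>2 - (\<eta> / 2)\<^sup>2)))"
    have f: "emeasure lborel (cball (0::complex) (\<eta> / 2)) < \<infinity>" by (rule emeasure_bounded_finite) simp
    have "0 < measure lborel (cball (0::complex) (\<eta> / 2)) * m"
      using content_cball_pos[of "\<eta> / 2" "0::complex"] assms by (simp add: m_def)
    also have "\<dots> = (\<integral>w. indicator (cball (0::complex) (\<eta> / 2)) w * m \<partial>lborel)" by simp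
    also have "\<dots> \<le> J" unfolding J_def
    proof (rule integral_mono[OF _ ib])
      show "integrable lborel (\<lambda>w. indicator (cball (0::complex) (\<eta> / 2)) w * m)"
        using f by (intro integrable_mult_left integrable_real_indicator) (auto simp: infinity_ennreal_def)
      fix w :: complex
      show "indicator (cball 0 (\<eta> / 2)) w * m \<le> b w"
      proof (cases "cmod w \<le> \<eta> / 2")
        case True
        have "(cmod w)\<^sup>2 \<le> (\<eta> / 2)\<^sup>2" using True by (intro power_mono) auto
        moreover have "(\<eta> / 2)\<^sup>2 < \<eta>\<^sup>2" using assms by (simp add: power_divide)
        ultimately have "1 / (\<eta>\<^sup>2 - (cmod w)\<^sup>2) \<le> 1 / (\<eta>\<^sup>2 - (\<eta> / 2)\<^sup>2)" "0 < \<eta>\<^sup>2 - (cmod w)\<^sup>2"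
          by (auto intro!: divide_left_mono mult_pos_pos)
        then show ?thesis using True unfolding b_def flat_fun_def m_def by simp
      qed (use b0 in simp)
    qed
    finally show ?thesis .
  qed
  define k where "k z = complex_of_real (1 / J) * of_real (b z)" for z
  show ?thesis
  proof
    show "test_fun k"
    proof -
      have "Cinf_on UNIV (\<lambda>_. complex_of_real (1 / J))"
        by (rule Cinf_on_holomorphic) (auto intro: holomorphic_on_const)
      from Cinf_on_mult[OF open_UNIV this Cb] csupp_mult(2)[OF test_funD(2)[OF tb], of "\<lambda>_. complex_of_real (1 / J)"]
      show ?thesis unfolding test_fun_def k_def by blast
    qed
    show "k z = 0" if "\<eta> \<le> cmod z" for z unfolding k_def using bs[OF that] by simp
    show "(\<integral>y. k y \<partial>lborel) = 1" unfolding k_def using \<open>J > 0\<close> by (simp add: J_def)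
    have "cmod (k y) = 1 / J * b y" for y
      unfolding k_def using b0[of y] \<open>J > 0\<close> by (simp add: norm_mult norm_divide)
    then show "(\<integral>y. cmod (k y) \<partial>lborel) = 1" using \<open>J > 0\<close> by (simp add: J_def)
  qed
qed

definition is_cutoff :: "real \<Rightarrow> real \<Rightarrow> complex set \<Rightarrow> (complex \<Rightarrow> complex) \<Rightarrow> bool" where
  "is_cutoff \<eta> C S \<psi> \<longleftrightarrow> Cinf_on UNIV \<psi> \<and> (\<forall>x. cmod (\<psi> x) \<le> 1) \<and>
      (\<forall>x. ball x \<eta> \<subseteq> S \<longrightarrow> \<psi> x = 1) \<and> (\<forall>x. ball x \<eta> \<inter> S = {} \<longrightarrow> \<psi> x = 0) \<and>
      (\<forall>x. cmod (dbar \<psi> x) \<le> C)"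

lemma is_cutoffD:
  assumes "is_cutoff \<eta> C S \<psi>"
  shows "Cinf_on UNIV \<psi>" "cmod (\<psi> x) \<le> 1" "ball x \<eta> \<subseteq> S \<Longrightarrow> \<psi> x = 1"
    "ball x \<eta> \<inter> S = {} \<Longrightarrow> \<psi> x = 0" "cmod (dbar \<psi> x) \<le> C"
  using assms unfolding is_cutoff_def by blast+

text \<open>The cutoff is the indicator of \<open>S\<close> smoothed at scale \<eta>. Since
  \<open>dbar\<close> falls on the mollifier, \<open>C\<close> can be its \<open>L\<^sup>1\<close>
  norm after \<open>dbar\<close>, which depends on \<eta> but not on \<open>S\<close>. This
  uniformity provides dominating functions when \<open>S\<close> varies.\<close>

lemma cutoff_exists:
  assumes "\<eta> > 0"
  obtains C where "0 \<le> C" "\<And>S. open S \<Longrightarrow> \<exists>\<psi>. is_cutoff \<eta> C S \<psi>"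
proof -
  obtain k where k: "test_fun k" "\<And>z. \<eta> \<le> cmod z \<Longrightarrow> k z = 0" "(\<integral>y. k y \<partial>lborel) = 1"
    "(\<integral>y. cmod (k y) \<partial>lborel) = 1" using mollifier_kernel_exists[OF assms] by blast
  note kd = test_funD(1,2)[OF k(1)] and dk = test_funD(1,2)[OF test_fun_dbar[OF k(1)]]
  show ?thesis
  proof (rule that[of "\<integral>y. cmod (dbar k y) \<partial>lborel"])
    show "0 \<le> (\<integral>y. cmod (dbar k y) \<partial>lborel)" by (rule integral_nonneg_AE) simp
    fix S :: "complex set" assume S: "open S"
    define h where "h y = (indicator S y :: complex)" for y
    have h1: "cmod (h y) \<le> 1" for y unfolding h_def by (simp add: indicator_def)
    have "h \<in> borel_measurable borel"
      unfolding h_def using S by (intro borel_measurable_indicator) auto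
    then have h: "locint h" using h1 by (intro locint_bounded) auto
    have "conv h k x = 1" if "ball x \<eta> \<subseteq> S" for x
    proof -
      have "h y * k (x - y) = k (x - y)" for y
        using that k(2)[of "x - y"] by (cases "y \<in> S") (auto simp: h_def dist_norm subset_eq not_less)
      then show ?thesis
        using integral_reflect_complex[OF borel_measurable_continuous_onI[OF kd(1)], of x] k(3)
        unfolding conv_def by (simp only:)
    qed
    moreover have "conv h k x = 0" if "ball x \<eta> \<inter> S = {}" for x
    proof -
      have "h y * k (x - y) = 0" for y
      proof (cases "y \<in> S")
        case True
        then have "y \<notin> ball x \<eta>" using that by blast
        then show ?thesis using k(2)[of "x - y"] by (auto simp: dist_norm)
      qed (simp add: h_def)
      then show ?thesis unfolding conv_def by (simp only: Bochner_Integration.integral_zero)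
    qed
    ultimately show "\<exists>\<psi>. is_cutoff \<eta> (\<integral>y. cmod (dbar k y) \<partial>lborel) S \<psi>"
      unfolding is_cutoff_def
      using Cinf_on_conv[OF h k(1)] norm_conv_le[OF h h1 kd] norm_conv_le[OF h h1 dk] k(4)
        dbar_conv[OF h k(1)]
      by (intro exI[of _ "conv h k"]) auto
  qed
qed

section \<open>Solutions of the Cauchy-Riemann equation\<close>

text \<open>The constant is attached to \<open>g\<close>, so that the kernel still has the form of a
  continuous function divided by \<open>z\<close> and \<open>locint_kernel\<close> applies.\<close>

definition cauchy_op :: "(complex \<Rightarrow> complex) \<Rightarrow> (complex \<Rightarrow> complex) \<Rightarrow> complex \<Rightarrow> complex" where
  "cauchy_op g f = conv (\<lambda>z. g z / of_real pompeiu_const / z) f"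

lemma locint_cauchy_kernel:
  assumes "g holomorphic_on UNIV"
  shows "locint (\<lambda>z. g z / of_real pompeiu_const / z)"
  using pompeiu_const_pos
  by (intro locint_kernel continuous_intros holomorphic_on_imp_continuous_on[OF assms]) auto

lemma cauchy_op_dbar:
  assumes "g holomorphic_on UNIV" "g 0 = 1" "test_fun f"
  shows "cauchy_op g (dbar f) x = f x"
proof -
  have e: "g y / of_real pompeiu_const / y * d = (g y / y * d) / of_real pompeiu_const" for y d
    by (simp add: divide_inverse mult_ac)
  have "cauchy_op g (dbar f) x = (\<integral>y. (g y / y * dbar f (x - y)) / of_real pompeiu_const \<partial>lborel)"
    unfolding cauchy_op_def conv_def e ..
  also have "\<dots> = conv (\<lambda>z. g z / z) (dbar f) x / of_real pompeiu_const"
    unfolding conv_def by (rule integral_divide_zero)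
  also have "\<dots> = f x"
    unfolding pompeiu[OF assms] using pompeiu_const_pos by simp
  finally show ?thesis .
qed

lemma Cinf_on_cauchy_op: "g holomorphic_on UNIV \<Longrightarrow> test_fun f \<Longrightarrow> Cinf_on UNIV (cauchy_op g f)"
  unfolding cauchy_op_def by (intro Cinf_on_conv locint_cauchy_kernel)

text \<open>\<open>dbar\<close> commutes with the convolution because it acts on the second factor,
  so the right inverse is the Pompeiu formula once more.\<close>

lemma dbar_cauchy_op:
  assumes "g holomorphic_on UNIV" "g 0 = 1" "test_fun f"
  shows "dbar (cauchy_op g f) x = f x"
  using dbar_conv[OF locint_cauchy_kernel[OF assms(1)] assms(3)] cauchy_op_dbar[OF assms]
  unfolding cauchy_op_def by simp

lemma cauchy_op_eq_integral:
  assumes "g holomorphic_on UNIV" "test_fun f"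
  shows "cauchy_op g f x = (\<integral>y. g (x - y) / of_real pompeiu_const / (x - y) * f y \<partial>lborel)"
proof -
  have [measurable]: "g \<in> borel_measurable borel" "f \<in> borel_measurable borel"
    using holomorphic_on_imp_continuous_on[OF assms(1)] test_funD(1)[OF assms(2)]
    by (auto intro: borel_measurable_continuous_onI)
  have "(\<lambda>y. g (x - y) / of_real pompeiu_const / (x - y) * f y) \<in> borel_measurable borel"
    by measurable
  from integral_reflect_complex[OF this, of x] show ?thesis
    unfolding cauchy_op_def conv_def by simp
qed

text \<open>\<open>f\<close> may be arbitrary off \<open>U\<close>. The cutoff vanishes in a whole
  neighbourhood of each point there, so the product is locally either a product of smooth functions
  or 0.\<close>

lemma Cinf_on_cutoff:
  assumes "Cinf_on UNIV \<theta>" "open U" "Cinf_on U f"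
    and "\<And>x. x \<notin> U \<Longrightarrow> \<exists>V. open V \<and> x \<in> V \<and> (\<forall>y\<in>V. \<theta> y = 0)"
  shows "Cinf_on UNIV (\<lambda>z. \<theta> z * f z)"
proof -
  have "\<exists>V. open V \<and> x \<in> V \<and> Cinf_on V (\<lambda>z. \<theta> z * f z)" for x
  proof (cases "x \<in> U")
    case True
    then show ?thesis
      using assms Cinf_on_mult[OF assms(2) Cinf_on_subset[OF assms(1)] assms(3)] by blast
  next
    case False
    then obtain V where V: "open V" "x \<in> V" "\<forall>y\<in>V. \<theta> y = 0" using assms(4) by blast
    have "Cinf_on V (\<lambda>z. \<theta> z * f z)"
      by (rule Cinf_on_cong[OF V(1) Cinf_on_holomorphic[OF V(1) holomorphic_on_const[of 0]]])
        (use V in auto)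
    then show ?thesis using V by blast
  qed
  then show ?thesis by (intro Cinf_on_local) auto
qed

lemma test_fun_cutoff:
  assumes "Cinf_on UNIV \<theta>" "csupp \<theta>" "open U" "Cinf_on U f"
    and "\<And>x. x \<notin> U \<Longrightarrow> \<exists>V. open V \<and> x \<in> V \<and> (\<forall>y\<in>V. \<theta> y = 0)"
  shows "test_fun (\<lambda>z. \<theta> z * f z)"
  unfolding test_fun_def using Cinf_on_cutoff[OF assms(1,3,4,5)] csupp_mult(1)[OF assms(2)] by blast

text \<open>The ball of radius \<open>\<rho> / 2\<close> is smoothed at scale
  \<open>\<rho> / 4\<close>, which yields the radii \<open>\<rho> / 4\<close> and
  \<open>3 * \<rho> / 4\<close>.\<close>

lemma bump_exists:
  assumes "\<rho> > 0"
  obtains \<theta> where "test_fun \<theta>" "\<And>x. cmod (\<theta> x) \<le> 1" "\<And>x. cmod x < \<rho> / 4 \<Longrightarrow> \<theta> x = 1"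
    "\<And>x. 3 * \<rho> / 4 < cmod x \<Longrightarrow> \<theta> x = 0"
proof -
  have r: "0 < \<rho> / 4" using assms by simp
  obtain C where "\<And>S. open S \<Longrightarrow> \<exists>\<psi>. is_cutoff (\<rho> / 4) C S \<psi>"
    by (rule cutoff_exists[OF r]) blast
  from this[OF open_ball[of 0 "\<rho> / 2"]] obtain \<theta> where "is_cutoff (\<rho> / 4) C (ball 0 (\<rho> / 2)) \<theta>" by blast
  note t = is_cutoffD[OF this]
  have z: "\<theta> x = 0" if "3 * \<rho> / 4 < cmod x" for x
  proof (rule t(4))
    show "ball x (\<rho> / 4) \<inter> ball 0 (\<rho> / 2) = {}"
    proof (rule equals0I)
      fix y assume "y \<in> ball x (\<rho> / 4) \<inter> ball 0 (\<rho> / 2)"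
      then show False using that norm_triangle_ineq2[of x y] by (auto simp: dist_norm)
    qed
  qed
  have "\<theta> x = 1" if "cmod x < \<rho> / 4" for x
  proof (rule t(3), rule subsetI)
    fix y assume "y \<in> ball x (\<rho> / 4)"
    then show "y \<in> ball 0 (\<rho> / 2)"
      using that norm_triangle_ineq2[of y x] by (auto simp: dist_norm norm_minus_commute)
  qed
  moreover have "test_fun \<theta>" unfolding test_fun_def csupp_def using t(1) z by blast
  ultimately show ?thesis using that t z by blast
qed

lemma csupp_translate:
  assumes "csupp f"
  shows "csupp (\<lambda>y. f (y - x))"
proof -
  obtain R where R: "\<And>z. R < cmod z \<Longrightarrow> f z = 0" using assms unfolding csupp_def by blast
  have "f (y - x) = 0" if "R + cmod x < cmod y" for y
    using R[of "y - x"] that norm_triangle_ineq2[of y x] by simp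
  then show ?thesis unfolding csupp_def by blast
qed

lemma partial_dir_translate: "partial_dir e (\<lambda>z. f (z - a)) x = partial_dir e f (x - a)"
  unfolding partial_dir_def by (simp add: algebra_simps)

lemma dbar_translate: "dbar (\<lambda>z. f (z - a)) x = dbar f (x - a)"
  unfolding dbar_def by (simp add: partial_dir_translate)

lemma test_fun_bump_mult:
  assumes t: "test_fun \<theta>" "\<And>x. 3 * \<rho> / 4 < cmod x \<Longrightarrow> \<theta> x = 0" and r: "\<rho> > 0"
    and U: "open U" "cball a \<rho> \<subseteq> U" and f: "Cinf_on U f"
  shows "test_fun (\<lambda>z. \<theta> (z - a) * f z)"
proof (rule test_fun_cutoff[OF _ _ U(1) f])
  show "Cinf_on UNIV (\<lambda>z. \<theta> (z - a))" "csupp (\<lambda>z. \<theta> (z - a))"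
    using t Cinf_on_translate csupp_translate unfolding test_fun_def by auto
  fix x assume "x \<notin> U"
  then have "x \<notin> cball a \<rho>" using U by blast
  then have "x \<in> - cball a (3 * \<rho> / 4)" using r by auto
  moreover have "\<theta> (y - a) = 0" if "y \<in> - cball a (3 * \<rho> / 4)" for y
    by (rule t(2)) (use that in \<open>auto simp: dist_norm norm_minus_commute\<close>)
  moreover have "open (- cball a (3 * \<rho> / 4))" by auto
  ultimately show "\<exists>V. open V \<and> x \<in> V \<and> (\<forall>y\<in>V. \<theta> (y - a) = 0)" by blast
qed

section \<open>Interior estimates and limits of solutions\<close>

text \<open>In the Pompeiu formula for a cut-off \<open>h\<close> only \<open>dbar \<theta>\<close>
  times \<open>h\<close> survives. It is supported where
  \<open>\<rho> / 4 \<le> cmod (y - a)\<close>, hence the kernel is at most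
  \<open>4 / \<rho>\<close> up to the constant. This is what later turns the integral bound (a)(iii)
  into a pointwise bound.\<close>

lemma holomorphic_area_bound:
  assumes r: "\<rho> > 0"
  obtains M where "0 \<le> M" "\<And>h a U. open U \<Longrightarrow> cball a \<rho> \<subseteq> U \<Longrightarrow> h holomorphic_on U \<Longrightarrow>
    ennreal (cmod (h a)) \<le> ennreal M * (\<integral>\<^sup>+ y. ennreal (cmod (h y)) * indicator (cball a \<rho>) y \<partial>lborel)"
proof -
  from bump_exists[OF r] obtain \<theta> where t: "test_fun \<theta>" "\<And>x. cmod (\<theta> x) \<le> 1"
    "\<And>x. cmod x < \<rho> / 4 \<Longrightarrow> \<theta> x = 1" "\<And>x. 3 * \<rho> / 4 < cmod x \<Longrightarrow> \<theta> x = 0" by metis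
  obtain C where C: "0 \<le> C" "\<And>x. cmod (dbar \<theta> x) \<le> C"
    using csupp_bounded[OF test_funD(1,2)[OF test_fun_dbar[OF t(1)]]] by metis
  have CT: "Cinf_on UNIV \<theta>" using t(1) test_fun_def by auto
  have d0: "dbar \<theta> x = 0" if "cmod x < \<rho> / 4 \<or> 3 * \<rho> / 4 < cmod x" for x
    using that
  proof
    assume "cmod x < \<rho> / 4"
    then have "dbar \<theta> x = dbar (\<lambda>_. 1) x"
      using t(3) by (intro dbar_cong[of "ball 0 (\<rho> / 4)"]) (auto intro!: Cinf_on_holomorphic)
    then show ?thesis using dbar_holomorphic[of UNIV "\<lambda>_. 1" x] by simp
  next
    assume "3 * \<rho> / 4 < cmod x"
    then have "dbar \<theta> x = dbar (\<lambda>_. 0) x"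
      using t(4) by (intro dbar_cong[of "- cball 0 (3 * \<rho> / 4)"]) (auto intro!: Cinf_on_holomorphic)
    then show ?thesis using dbar_holomorphic[of UNIV "\<lambda>_. 0" x] by simp
  qed
  define M where "M = C * (4 / \<rho>) / pompeiu_const"
  have M: "0 \<le> M" unfolding M_def using C r pompeiu_const_pos by simp
  show ?thesis
  proof (rule that[OF M])
    fix h a U assume U: "open U" "cball a \<rho> \<subseteq> U" and h: "h holomorphic_on U"
    define f where "f z = \<theta> (z - a) * h z" for z
    have f: "test_fun f" unfolding f_def
      by (rule test_fun_bump_mult[OF t(1,4) r U Cinf_on_holomorphic[OF U(1) h]])
    have df: "dbar f y = dbar \<theta> (y - a) * h y" if "y \<in> U" for y
      using dbar_mult[OF Cinf_on_subset[OF Cinf_on_translate[OF CT, of a]] Cinf_on_holomorphic[OF U(1) h] that]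
        dbar_holomorphic[OF U(1) h that] unfolding f_def dbar_translate by simp
    have df0: "dbar f y = 0" if "3 * \<rho> / 4 < cmod (y - a)" for y
    proof -
      have "dbar f y = dbar (\<lambda>_. 0) y"
        using that t(4) unfolding f_def
        by (intro dbar_cong[of "- cball a (3 * \<rho> / 4)"])
          (auto intro!: Cinf_on_holomorphic simp: dist_norm norm_minus_commute)
      then show ?thesis using dbar_holomorphic[of UNIV "\<lambda>_. 0" y] by simp
    qed
    have one: "(\<lambda>_. 1) holomorphic_on UNIV" by simp
    have le: "cmod (1 / of_real pompeiu_const / (a - y) * dbar f y) \<le> M * (cmod (h y) * indicator (cball a \<rho>) y)" for y
    proof (cases "y \<in> cball a \<rho> \<and> \<rho> / 4 \<le> cmod (y - a)")
      case True
      then have "0 < cmod (a - y)" using r by (auto simp: norm_minus_commute)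
      have "cmod (1 / of_real pompeiu_const / (a - y)) \<le> 4 / \<rho> / pompeiu_const"
      proof -
        have "1 / cmod (a - y) \<le> 4 / \<rho>"
          using True r \<open>0 < cmod (a - y)\<close> by (simp add: norm_minus_commute field_simps)
        moreover have "cmod (1 / of_real pompeiu_const / (a - y)) = 1 / cmod (a - y) / pompeiu_const"
          using pompeiu_const_pos by (simp add: norm_divide norm_mult)
        ultimately show ?thesis using divide_right_mono[of "1 / cmod (a - y)" "4 / \<rho>" pompeiu_const]
          pompeiu_const_pos by simp
      qed
      moreover have "cmod (dbar f y) \<le> C * cmod (h y)"
        using True U df[of y] mult_right_mono[OF C(2)[of "y - a"] norm_ge_zero[of "h y"]]
        by (auto simp: norm_mult)
      ultimately have "cmod (1 / of_real pompeiu_const / (a - y) * dbar f y) \<le> 4 / \<rho> / pompeiu_const * (C * cmod (h y))"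
        unfolding norm_mult using r pompeiu_const_pos by (intro mult_mono) auto
      then show ?thesis using True unfolding M_def by (simp add: field_simps)
    next
      case False
      have "dbar f y = 0"
      proof (cases "y \<in> cball a \<rho>")
        case True
        then show ?thesis using False df[of y] d0[of "y - a"] U by auto
      next
        case False
        then show ?thesis using r by (intro df0) (auto simp: dist_norm norm_minus_commute)
      qed
      then show ?thesis using M by simp
    qed
    have "h a = f a" unfolding f_def using t(3)[of 0] r by simp
    also have "\<dots> = (\<integral>y. 1 / of_real pompeiu_const / (a - y) * dbar f y \<partial>lborel)"
      using cauchy_op_dbar[OF one _ f, of a] cauchy_op_eq_integral[OF one test_fun_dbar[OF f], of a] by simp
    finally have "ennreal (cmod (h a)) \<le> (\<integral>\<^sup>+ y. ennreal (cmod (1 / of_real pompeiu_const / (a - y) * dbar f y)) \<partial>lborel)"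
    proof -
      assume e: "h a = (\<integral>y. 1 / of_real pompeiu_const / (a - y) * dbar f y \<partial>lborel)"
      show ?thesis
      proof (cases "integrable lborel (\<lambda>y. 1 / of_real pompeiu_const / (a - y) * dbar f y)")
        case True
        then show ?thesis unfolding e by (rule integral_norm_bound_ennreal)
      next
        case False
        then show ?thesis unfolding e by (simp add: not_integrable_integral_eq)
      qed
    qed
    also have "\<dots> \<le> (\<integral>\<^sup>+ y. ennreal M * (ennreal (cmod (h y)) * indicator (cball a \<rho>) y) \<partial>lborel)"
    proof (rule nn_integral_mono)
      fix y
      have "ennreal (cmod (1 / of_real pompeiu_const / (a - y) * dbar f y)) \<le> ennreal (M * (cmod (h y) * indicator (cball a \<rho>) y))"
        using le by (rule ennreal_leI)
      also have "\<dots> = ennreal M * (ennreal (cmod (h y)) * indicator (cball a \<rho>) y)"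
        using M by (auto simp: ennreal_mult indicator_def)
      finally show "ennreal (cmod (1 / of_real pompeiu_const / (a - y) * dbar f y)) \<le> ennreal M * (ennreal (cmod (h y)) * indicator (cball a \<rho>) y)" .
    qed
    also have "\<dots> = ennreal M * (\<integral>\<^sup>+ y. ennreal (cmod (h y)) * indicator (cball a \<rho>) y \<partial>lborel)"
    proof (rule nn_integral_cmult)
      have "continuous_on (cball a \<rho>) h"
        using U holomorphic_on_imp_continuous_on[OF h] continuous_on_subset by blast
      then have "(\<lambda>y. indicator (cball a \<rho>) y *\<^sub>R h y) \<in> borel_measurable borel"
        by (intro borel_measurable_continuous_on_indicator) auto
      then have "(\<lambda>y. ennreal (cmod (indicator (cball a \<rho>) y *\<^sub>R h y))) \<in> borel_measurable lborel" by measurable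
      moreover have "ennreal (cmod (indicator (cball a \<rho>) y *\<^sub>R h y)) = ennreal (cmod (h y)) * indicator (cball a \<rho>) y" for y
        by (auto simp: indicator_def)
      ultimately show "(\<lambda>y. ennreal (cmod (h y)) * indicator (cball a \<rho>) y) \<in> borel_measurable lborel" by (simp only:)
    qed
    finally show "ennreal (cmod (h a)) \<le> ennreal M * (\<integral>\<^sup>+ y. ennreal (cmod (h y)) * indicator (cball a \<rho>) y \<partial>lborel)" .
  qed
qed

text \<open>By Montel's theorem a subsequence converges to a holomorphic function, and pointwise
  convergence identifies it with \<open>l\<close>.\<close>

lemma holomorphic_pointwise_limit:
  assumes U: "open U" and f: "\<And>n. f n holomorphic_on U" and B: "\<And>n y. y \<in> U \<Longrightarrow> cmod (f n y) \<le> B"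
    and lim: "\<And>y. y \<in> U \<Longrightarrow> (\<lambda>n. f n y) \<longlonglongrightarrow> l y"
  shows "l holomorphic_on U"
proof -
  obtain g r where g: "g holomorphic_on U" "strict_mono (r :: nat \<Rightarrow> nat)"
    "\<And>x. x \<in> U \<Longrightarrow> ((\<lambda>n. f (r n) x) \<longlongrightarrow> g x) sequentially"
  proof (rule Montel[OF U, of "range f" f])
    show "\<exists>B. \<forall>h\<in>range f. \<forall>z\<in>K. cmod (h z) \<le> B" if "K \<subseteq> U" for K
      using B that by (intro exI[of _ B]) auto
  qed (use f in auto)
  have "g y = l y" if "y \<in> U" for y
    using LIMSEQ_subseq_LIMSEQ[OF lim[OF that] g(2)] g(3)[OF that] LIMSEQ_unique
    unfolding comp_def by blast
  then show ?thesis using g(1) holomorphic_transform by blast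
qed

text \<open>Near a point the differences \<open>u j - u N\<close> are holomorphic and bounded by
  \<open>2 * B\<close>, so their pointwise limit \<open>v - u N\<close> is holomorphic. Thus
  \<open>v\<close> inherits smoothness and the equation from the single function \<open>u N\<close>,
  and no convergence of derivatives has to be shown.\<close>

lemma solution_limit:
  assumes U: "open U" and u: "\<And>j. Cinf_on U (u j)"
    and loc: "\<And>x. x \<in> U \<Longrightarrow> \<exists>r>0. \<exists>N B. ball x r \<subseteq> U \<and>
        (\<forall>j\<ge>N. \<forall>y\<in>ball x r. dbar (u j) y = f y \<and> cmod (u j y) \<le> B)"
    and lim: "\<And>y. y \<in> U \<Longrightarrow> (\<lambda>j. u j y) \<longlonglongrightarrow> v y"
  shows "Cinf_on U v \<and> (\<forall>y\<in>U. dbar v y = f y)"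
proof -
  have *: "\<exists>V. open V \<and> x \<in> V \<and> Cinf_on V v \<and> dbar v x = f x" if x: "x \<in> U" for x
  proof -
    obtain r N B where r: "r > 0" "ball x r \<subseteq> U"
      "\<And>j y. j \<ge> N \<Longrightarrow> y \<in> ball x r \<Longrightarrow> dbar (u j) y = f y"
      "\<And>j y. j \<ge> N \<Longrightarrow> y \<in> ball x r \<Longrightarrow> cmod (u j y) \<le> B"
      using loc[OF x] by meson
    have uC: "Cinf_on (ball x r) (u j)" for j using Cinf_on_subset[OF u r(2)] .
    have "(\<lambda>z. v z - u N z) holomorphic_on ball x r"
    proof (rule holomorphic_pointwise_limit[where f = "\<lambda>n z. u (n + N) z - u N z" and B = "2 * B"])
      show "(\<lambda>z. u (n + N) z - u N z) holomorphic_on ball x r" for n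
      proof (rule holomorphic_on_dbar_zero[OF open_ball Cinf_on_diff[OF open_ball uC uC]])
        fix y assume "y \<in> ball x r"
        then show "dbar (\<lambda>z. u (n + N) z - u N z) y = 0"
          using dbar_diff[OF uC uC, of y "n + N" N] r(3)[of "n + N" y] r(3)[of N y] by simp
      qed
      show "cmod (u (n + N) y - u N y) \<le> 2 * B" if "y \<in> ball x r" for n y
        using norm_triangle_ineq4[of "u (n + N) y" "u N y"] r(4)[of "n + N" y] r(4)[of N y] that by simp
      show "(\<lambda>n. u (n + N) y - u N y) \<longlonglongrightarrow> v y - u N y" if "y \<in> ball x r" for y
        by (rule tendsto_diff[OF LIMSEQ_ignore_initial_segment[OF lim] tendsto_const]) (use r(2) that in blast)
    qed auto
    note h = Cinf_on_holomorphic[OF open_ball this] dbar_holomorphic[OF open_ball this]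
    have c: "Cinf_on (ball x r) (\<lambda>z. u N z + (v z - u N z))" by (rule Cinf_on_add[OF open_ball uC h(1)])
    then have "Cinf_on (ball x r) v" by simp
    moreover have "dbar v x = f x"
      using dbar_add[OF uC h(1), of x N] h(2)[of x] r(1) r(3)[of N x] by simp
    ultimately show ?thesis using r(1) by (intro exI[of _ "ball x r"]) auto
  qed
  then show ?thesis using Cinf_on_local[of U v] by blast
qed

lemma partial_dir_cauchy_op:
  assumes "g holomorphic_on UNIV" "test_fun f" "e \<in> {1, \<i>}"
  shows "has_pd e (cauchy_op g f) (cauchy_op g (partial_dir e f) x) x"
  unfolding cauchy_op_def by (rule partial_dir_conv[OF locint_cauchy_kernel[OF assms(1)] assms(2,3)])

text \<open>If \<open>x\<close> and the support of \<open>f\<close> lie within \<rho> of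
  \<open>a\<close>, the kernel is evaluated at arguments of modulus at most
  \<open>2 * \<rho>\<close>. \<open>L\<close> is its integral over that disc and hence does not
  depend on \<open>a\<close>.\<close>

lemma cauchy_op_one_bound:
  obtains L where "0 \<le> L" "\<And>f a B x. continuous_on UNIV f \<Longrightarrow> csupp f \<Longrightarrow> (\<And>y. cmod (f y) \<le> B) \<Longrightarrow>
    (\<And>y. \<rho> < cmod (y - a) \<Longrightarrow> f y = 0) \<Longrightarrow> cmod (x - a) \<le> \<rho> \<Longrightarrow> cmod (cauchy_op (\<lambda>_. 1) f x) \<le> L * B"
proof -
  define k where "k y = indicator (cball (0::complex) (2 * \<rho>)) y *\<^sub>R (1 / cmod y) / pompeiu_const" for y
  have ki: "integrable lborel k" unfolding k_def
    by (rule integrable_divide[OF inverse_norm_integrable])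
  have k0: "0 \<le> k y" for y unfolding k_def using pompeiu_const_pos by simp
  show ?thesis
  proof (rule that[of "\<integral>y. k y \<partial>lborel"])
    show "0 \<le> (\<integral>y. k y \<partial>lborel)" using k0 by (intro integral_nonneg_AE) simp
    fix f a B x assume f: "continuous_on UNIV f" "csupp f" "\<And>y. cmod (f y) \<le> B"
      "\<And>y. \<rho> < cmod (y - a) \<Longrightarrow> f y = 0" and x: "cmod (x - a) \<le> \<rho>"
    have l: "locint (\<lambda>z. 1 / of_real pompeiu_const / z)" by (rule locint_cauchy_kernel) simp
    have "cmod (cauchy_op (\<lambda>_. 1) f x) \<le> (\<integral>y. cmod (1 / of_real pompeiu_const / y * f (x - y)) \<partial>lborel)"
      unfolding cauchy_op_def conv_def by (rule integral_norm_bound)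
    also have "\<dots> \<le> (\<integral>y. k y * B \<partial>lborel)"
    proof (rule integral_mono)
      show "integrable lborel (\<lambda>y. cmod (1 / of_real pompeiu_const / y * f (x - y)))"
        by (rule integrable_norm[OF conv_integrable[OF l f(1,2)]])
      show "integrable lborel (\<lambda>y. k y * B)" by (rule integrable_mult_left[OF ki])
      fix y
      show "cmod (1 / of_real pompeiu_const / y * f (x - y)) \<le> k y * B"
      proof (cases "cmod y \<le> 2 * \<rho>")
        case True
        then have "cmod (1 / of_real pompeiu_const / y) = k y"
          unfolding k_def using pompeiu_const_pos by (simp add: norm_divide norm_mult)
        then show ?thesis unfolding norm_mult using f(3)[of "x - y"] k0[of y] by (simp add: mult_left_mono)
      next
        case False
        then have "\<rho> < cmod (x - y - a)" using x norm_triangle_ineq4[of "x - a" "x - y - a"] by simp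
        then have "f (x - y) = 0" by (rule f(4))
        moreover have "0 \<le> B" using f(3)[of 0] norm_ge_zero order_trans by blast
        ultimately show ?thesis using k0[of y] by simp
      qed
    qed
    finally show "cmod (cauchy_op (\<lambda>_. 1) f x) \<le> (\<integral>y. k y \<partial>lborel) * B" by simp
  qed
qed

text \<open>Near \<open>a\<close> a solution differs from the Cauchy transform of \<open>f\<close>, cut off around \<open>a\<close>, by a
  holomorphic function. The formula for \<open>dbar\<close> of a partial derivative also comes out of this
  decomposition, so symmetry of second derivatives is never needed.\<close>

lemma derivative_estimate:
  assumes r: "\<rho> > 0"
  obtains A where "0 \<le> A" "\<And>U u f a e B. open U \<Longrightarrow> cball a \<rho> \<subseteq> U \<Longrightarrow> Cinf_on U u \<Longrightarrow> Cinf_on U f \<Longrightarrow>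
     (\<And>x. x \<in> U \<Longrightarrow> dbar u x = f x) \<Longrightarrow> e \<in> {1, \<i>} \<Longrightarrow>
     (\<And>y. y \<in> cball a \<rho> \<Longrightarrow> cmod (u y) \<le> B) \<Longrightarrow> (\<And>y. y \<in> cball a \<rho> \<Longrightarrow> cmod (f y) \<le> B) \<Longrightarrow>
     (\<And>y. y \<in> cball a \<rho> \<Longrightarrow> cmod (partial_dir e f y) \<le> B) \<Longrightarrow>
     cmod (partial_dir e u a) \<le> A * B \<and> dbar (partial_dir e u) a = partial_dir e f a"
proof -
  from bump_exists[OF r] obtain \<theta> where t: "test_fun \<theta>" "\<And>x. cmod (\<theta> x) \<le> 1"
    "\<And>x. cmod x < \<rho> / 4 \<Longrightarrow> \<theta> x = 1" "\<And>x. 3 * \<rho> / 4 < cmod x \<Longrightarrow> \<theta> x = 0" by metis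
  have CT: "Cinf_on UNIV \<theta>" using t(1) test_fun_def by auto
  obtain D1 where D1: "0 \<le> D1" "\<And>x. cmod (partial_dir 1 \<theta> x) \<le> D1"
    using csupp_bounded[OF test_funD(1,2)[OF test_fun_partial_dir[OF t(1)]], of 1] by auto
  obtain D2 where D2: "0 \<le> D2" "\<And>x. cmod (partial_dir \<i> \<theta> x) \<le> D2"
    using csupp_bounded[OF test_funD(1,2)[OF test_fun_partial_dir[OF t(1)]], of \<i>] by auto
  define D where "D = D1 + D2"
  have D: "0 \<le> D" "\<And>x e. e \<in> {1, \<i>} \<Longrightarrow> cmod (partial_dir e \<theta> x) \<le> D"
    unfolding D_def using D1 D2 by (auto simp: add_increasing add_increasing2)
  obtain L where L: "0 \<le> L" "\<And>f a B x. continuous_on UNIV f \<Longrightarrow> csupp f \<Longrightarrow> (\<And>y. cmod (f y) \<le> B) \<Longrightarrow>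
    (\<And>y. \<rho> < cmod (y - a) \<Longrightarrow> f y = 0) \<Longrightarrow> cmod (x - a) \<le> \<rho> \<Longrightarrow> cmod (cauchy_op (\<lambda>_. 1) f x) \<le> L * B"
    using cauchy_op_one_bound[of \<rho>] by metis
  \<comment> \<open>\<open>L * (D + 1)\<close> bounds the Cauchy transform \<open>w'\<close> of the
    derivative of the cut-off \<open>f\<close>; \<open>(1 + L) / (\<rho> / 8)\<close> is Cauchy's
    inequality for \<open>h = u - w\<close> on a circle of radius \<open>\<rho> / 8\<close>.\<close>
  define A where "A = L * (D + 1) + (1 + L) / (\<rho> / 8)"
  have A: "0 \<le> A" unfolding A_def using L D r by simp
  show ?thesis
  proof (rule that[OF A])
    fix U u f a e B
    assume U: "open U" "cball a \<rho> \<subseteq> U" and u: "Cinf_on U u" and f: "Cinf_on U f"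
      and du: "\<And>x. x \<in> U \<Longrightarrow> dbar u x = f x" and e: "e \<in> {1, \<i>}"
      and bu: "\<And>y. y \<in> cball a \<rho> \<Longrightarrow> cmod (u y) \<le> B" and bf: "\<And>y. y \<in> cball a \<rho> \<Longrightarrow> cmod (f y) \<le> B"
      and bp: "\<And>y. y \<in> cball a \<rho> \<Longrightarrow> cmod (partial_dir e f y) \<le> B"
    have one: "(\<lambda>_. 1) holomorphic_on UNIV" by simp
    have B0: "0 \<le> B" using order_trans[OF norm_ge_zero bu[of a]] r by simp
    define \<phi> where "\<phi> z = \<theta> (z - a) * f z" for z
    have ph: "test_fun \<phi>" unfolding \<phi>_def by (rule test_fun_bump_mult[OF t(1,4) r U f])
    have php: "test_fun (partial_dir e \<phi>)" by (rule test_fun_partial_dir[OF ph e])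
    have ph0: "\<phi> y = 0" if "3 * \<rho> / 4 < cmod (y - a)" for y using t(4)[OF that] unfolding \<phi>_def by simp
    have phb: "cmod (\<phi> y) \<le> B" for y
    proof (cases "y \<in> cball a \<rho>")
      case True
      then show ?thesis
        using mult_mono[OF t(2)[of "y - a"] bf[OF True]] unfolding \<phi>_def by (simp add: norm_mult)
    next
      case False
      then show ?thesis using ph0[of y] r B0 by (auto simp: dist_norm norm_minus_commute)
    qed
    have pp: "partial_dir e \<phi> y = partial_dir e \<theta> (y - a) * f y + \<theta> (y - a) * partial_dir e f y"
      if "y \<in> U" for y
    proof -
      have "has_pd e (\<lambda>z. \<theta> (z - a)) (partial_dir e \<theta> (y - a)) y"
        using Cinf_on_has_pd[OF CT e] by (simp add: has_pd_translate)
      from has_pd_partial_dir[OF has_pd_mult[OF this Cinf_on_has_pd[OF f e that]]] show ?thesis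
        unfolding \<phi>_def .
    qed
    have pp0: "partial_dir e \<phi> y = 0" if "\<rho> < cmod (y - a)" for y
    proof -
      have "has_pd e \<phi> 0 y"
        by (rule has_pd_transform[OF has_pd_const[of _ 0], of "- cball a (3 * \<rho> / 4)"])
          (use that r ph0 in \<open>auto simp: dist_norm norm_minus_commute\<close>)
      then show ?thesis by (rule has_pd_partial_dir)
    qed
    have ppb: "cmod (partial_dir e \<phi> y) \<le> (D + 1) * B" for y
    proof (cases "y \<in> cball a \<rho>")
      case True
      have "cmod (partial_dir e \<theta> (y - a) * f y) \<le> D * B"
        unfolding norm_mult by (rule mult_mono[OF D(2)[OF e] bf[OF True] D(1)]) simp
      moreover have "cmod (\<theta> (y - a) * partial_dir e f y) \<le> 1 * B"
        unfolding norm_mult by (rule mult_mono[OF t(2) bp[OF True]]) auto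
      ultimately show ?thesis
        using norm_triangle_ineq[of "partial_dir e \<theta> (y - a) * f y" "\<theta> (y - a) * partial_dir e f y"]
          pp[of y] True U by (auto simp: algebra_simps)
    next
      case False
      then have "partial_dir e \<phi> y = 0" by (intro pp0) (auto simp: dist_norm norm_minus_commute)
      then show ?thesis using B0 D(1) by simp
    qed
    define w where "w = cauchy_op (\<lambda>_. 1) \<phi>"
    define w' where "w' = cauchy_op (\<lambda>_. 1) (partial_dir e \<phi>)"
    have wC: "Cinf_on V w" for V unfolding w_def
      using Cinf_on_subset[OF Cinf_on_cauchy_op[OF one ph]] by blast
    have wC': "Cinf_on V w'" for V unfolding w'_def
      using Cinf_on_subset[OF Cinf_on_cauchy_op[OF one php]] by blast
    have ww: "has_pd e w (w' x) x" for x
      unfolding w_def w'_def by (rule partial_dir_cauchy_op[OF one ph e])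
    have wb: "cmod (w x) \<le> L * B" if "cmod (x - a) \<le> \<rho>" for x
      unfolding w_def by (rule L(2)[OF test_funD(1,2)[OF ph] phb _ that]) (use ph0 r in auto)
    have wb': "cmod (w' a) \<le> L * ((D + 1) * B)"
      unfolding w'_def by (rule L(2)[OF test_funD(1,2)[OF php] ppb pp0]) (use r in auto)
    \<comment> \<open>On this ball the cutoff is 1, so \<open>w\<close> solves the same equation as
      \<open>u\<close>.\<close>
    let ?V = "ball a (\<rho> / 4)"
    have V: "?V \<subseteq> U" using U(2) r by (auto simp: subset_eq)
    have aV: "a \<in> ?V" using r by simp
    have uV: "Cinf_on ?V u" by (rule Cinf_on_subset[OF u V])
    define h where "h z = u z - w z" for z
    have hh: "h holomorphic_on ?V"
      unfolding h_def
    proof (rule holomorphic_on_dbar_zero[OF open_ball Cinf_on_diff[OF open_ball uV wC]])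
      fix y assume y: "y \<in> ?V"
      have "dbar w y = f y" unfolding w_def dbar_cauchy_op[OF one _ ph, simplified] \<phi>_def
        using t(3)[of "y - a"] y by (simp add: dist_norm norm_minus_commute)
      then show "dbar (\<lambda>z. u z - w z) y = 0"
        using dbar_diff[OF uV wC y] du[of y] y V by auto
    qed
    have up: "has_pd e u (w' y + e * deriv h y) y" if "y \<in> ?V" for y
      using has_pd_add[OF ww has_pd_field_derivative[OF holomorphic_derivI[OF hh open_ball that]]]
      unfolding h_def by simp
    have "cmod ((deriv ^^ 1) h a) \<le> fact 1 * ((1 + L) * B) / (\<rho> / 8) ^ 1"
    proof (rule Cauchy_inequality)
      show "h holomorphic_on ball a (\<rho> / 8)" by (rule holomorphic_on_subset[OF hh]) (use r in auto)
      show "continuous_on (cball a (\<rho> / 8)) h"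
        by (rule continuous_on_subset[OF holomorphic_on_imp_continuous_on[OF hh]]) (use r in auto)
      fix x assume "norm (a - x) = \<rho> / 8"
      then have x: "cmod (x - a) \<le> \<rho>" "x \<in> cball a \<rho>" using r by (auto simp: norm_minus_commute dist_norm)
      show "norm (h x) \<le> (1 + L) * B"
        using norm_triangle_ineq4[of "u x" "w x"] bu[OF x(2)] wb[OF x(1)] unfolding h_def
        by (simp add: algebra_simps)
    qed (use r in auto)
    then have hb: "cmod (deriv h a) \<le> (1 + L) / (\<rho> / 8) * B" by (simp add: algebra_simps)
    have "cmod (partial_dir e u a) \<le> cmod (w' a) + cmod (deriv h a)"
      using norm_triangle_ineq[of "w' a" "e * deriv h a"] e has_pd_partial_dir[OF up[OF aV]]
      by (auto simp: norm_mult)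
    also have "\<dots> \<le> A * B" using wb' hb unfolding A_def distrib_right[of _ _ B] mult.assoc[of L] by linarith
    finally have 1: "cmod (partial_dir e u a) \<le> A * B" .
    have hd: "(\<lambda>y. e * deriv h y) holomorphic_on ?V"
      by (rule holomorphic_on_mult[OF holomorphic_on_const holomorphic_deriv[OF hh open_ball]])
    note hdC = Cinf_on_holomorphic[OF open_ball hd]
    have "dbar (partial_dir e u) a = dbar (\<lambda>y. w' y + e * deriv h y) a"
      using has_pd_partial_dir[OF up]
      by (intro dbar_cong[OF Cinf_on_add[OF open_ball wC' hdC] open_ball aV]) simp
    also have "\<dots> = dbar w' a + 0"
      using dbar_add[OF wC' hdC aV] dbar_holomorphic[OF open_ball hd aV] by simp
    also have "dbar w' a = partial_dir e \<phi> a"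
      unfolding w'_def by (rule dbar_cauchy_op[OF one _ php]) simp
    also have "partial_dir e \<phi> a = partial_dir e f a"
    proof (rule has_pd_partial_dir[OF has_pd_transform[OF Cinf_on_has_pd[OF f e] open_ball aV]])
      show "a \<in> U" using aV V by blast
      show "f y = \<phi> y" if "y \<in> ?V" for y
        unfolding \<phi>_def using t(3)[of "y - a"] that by (simp add: dist_norm norm_minus_commute)
    qed
    finally have "dbar (partial_dir e u) a = partial_dir e f a" by simp
    with 1 show "cmod (partial_dir e u a) \<le> A * B \<and> dbar (partial_dir e u) a = partial_dir e f a" by blast
  qed
qed

section \<open>Holomorphic families in a closed subspace\<close>

text \<open>A closed linear subspace for the weighted sup norm over \<open>A\<close>. Expressing
  closedness through approximation admits arbitrary functions, including those of infinite norm, and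
  lets only values on \<open>A\<close> matter.\<close>

locale closed_subspace =
  fixes A :: "complex set" and w :: "complex \<Rightarrow> real" and P :: "(complex \<Rightarrow> complex) \<Rightarrow> bool"
  assumes w_nonneg: "x \<in> A \<Longrightarrow> 0 \<le> w x"
    and P_zero: "P (\<lambda>_. 0)"
    and P_add: "P F \<Longrightarrow> P G \<Longrightarrow> P (\<lambda>x. F x + G x)"
    and P_scale: "P F \<Longrightarrow> P (\<lambda>x. c * F x)"
    and P_lim: "(\<And>\<epsilon>. \<epsilon> > 0 \<Longrightarrow> \<exists>G. P G \<and> (\<forall>x\<in>A. cmod (F x - G x) * w x \<le> \<epsilon>)) \<Longrightarrow> P F"
begin

lemma P_sum: "finite I \<Longrightarrow> (\<And>i. i \<in> I \<Longrightarrow> P (F i)) \<Longrightarrow> P (\<lambda>x. \<Sum>i\<in>I. c i * F i x)"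
proof (induction I rule: finite_induct)
  case empty
  then show ?case using P_zero by simp
next
  case (insert i I)
  then show ?case using P_add[OF P_scale[of "F i" "c i"]] by simp
qed

lemma P_diff: "P F \<Longrightarrow> P G \<Longrightarrow> P (\<lambda>x. F x - G x)"
  using P_add[OF _ P_scale[of G "-1"], of F] by simp

definition taylor_coeff :: "(complex \<Rightarrow> complex \<Rightarrow> complex) \<Rightarrow> complex \<Rightarrow> nat \<Rightarrow> complex \<Rightarrow> complex" where
  "taylor_coeff \<Phi> a k x = (deriv ^^ k) (\<lambda>y. \<Phi> y x) a / fact k"

text \<open>Cauchy's estimate on the circle of radius \<open>s\<close> bounds the k-th coefficient
  in the weighted norm by \<open>B / s ^ k\<close>, uniformly in \<open>x\<close>. The remainder is
  then dominated by a geometric tail of ratio \<open>cmod (y - a) / s\<close>.\<close>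

lemma taylor_remainder:
  assumes s: "0 < s" "s < \<rho>" and hol: "(\<lambda>y. \<Phi> y x) holomorphic_on ball a \<rho>"
    and x: "x \<in> A" and B: "\<And>y. y \<in> ball a \<rho> \<Longrightarrow> cmod (\<Phi> y x) * w x \<le> B"
    and y: "cmod (y - a) < s"
  shows "cmod (\<Phi> y x - (\<Sum>k<N. taylor_coeff \<Phi> a k x * (y - a) ^ k)) * w x
         \<le> B * (cmod (y - a) / s) ^ N / (1 - cmod (y - a) / s)"
proof -
  define q where "q = cmod (y - a) / s"
  have q: "0 \<le> q" "q < 1" unfolding q_def using y s by auto
  have B0: "0 \<le> B" using B[of a] s w_nonneg[OF x] by (auto intro: order_trans[OF _ B[of a]])
  let ?c = "\<lambda>k. taylor_coeff \<Phi> a k x * (y - a) ^ k"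
  have coeff: "cmod (taylor_coeff \<Phi> a k x) * w x \<le> B / s ^ k" for k
  proof (cases "w x = 0")
    case True
    then show ?thesis using B0 s by simp
  next
    case False
    then have w: "w x > 0" using w_nonneg[OF x] by simp
    have "cmod ((deriv ^^ k) (\<lambda>y. \<Phi> y x) a) \<le> fact k * (B / w x) / s ^ k"
    proof (rule Cauchy_inequality)
      show "(\<lambda>y. \<Phi> y x) holomorphic_on ball a s" by (rule holomorphic_on_subset[OF hol]) (use s in auto)
      show "continuous_on (cball a s) (\<lambda>y. \<Phi> y x)"
        by (rule continuous_on_subset[OF holomorphic_on_imp_continuous_on[OF hol]]) (use s in auto)
      show "cmod (\<Phi> y x) \<le> B / w x" if "cmod (a - y) = s" for y
        using B[of y] that s w by (auto simp: dist_norm field_simps)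
    qed (use s in auto)
    from mult_right_mono[OF this, of "w x / fact k"]
    show ?thesis unfolding taylor_coeff_def using w by (simp add: norm_divide)
  qed
  have trm: "cmod (?c k * of_real (w x)) \<le> B * q ^ k" for k
  proof -
    have "cmod (?c k * of_real (w x)) = (cmod (taylor_coeff \<Phi> a k x) * w x) * cmod (y - a) ^ k"
      using w_nonneg[OF x] by (simp add: norm_mult norm_power)
    also have "\<dots> \<le> B / s ^ k * cmod (y - a) ^ k" by (rule mult_right_mono[OF coeff]) simp
    also have "\<dots> = B * q ^ k" unfolding q_def by (simp add: power_divide)
    finally show ?thesis .
  qed
  have "?c sums \<Phi> y x"
    using holomorphic_power_series[OF hol, of y] y s unfolding taylor_coeff_def
    by (simp add: dist_norm norm_minus_commute)
  then have "(\<lambda>k. ?c k * of_real (w x)) sums (\<Phi> y x * of_real (w x))" by (rule sums_mult2)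
  from sums_split_initial_segment[OF this, of N]
  have S: "(\<lambda>k. ?c (k + N) * of_real (w x)) sums ((\<Phi> y x - (\<Sum>k<N. ?c k)) * of_real (w x))"
    by (simp add: left_diff_distrib sum_distrib_right)
  have G: "(\<lambda>k. B * q ^ N * q ^ k) sums (B * q ^ N * (1 / (1 - q)))"
    using q by (intro sums_mult geometric_sums) auto
  have "cmod ((\<Phi> y x - (\<Sum>k<N. ?c k)) * of_real (w x)) \<le> B * q ^ N * (1 / (1 - q))"
    unfolding sums_unique[OF S] sums_unique[OF G]
    by (rule norm_suminf_le[OF _ sums_summable[OF G]])
      (use trm[of "_ + N"] in \<open>simp add: power_add mult_ac\<close>)
  then show ?thesis using w_nonneg[OF x] unfolding q_def by (simp add: norm_mult)
qed

text \<open>Induction on \<open>k\<close>: subtract from \<open>\<Phi> (a + t)\<close> the part of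
  its expansion below order \<open>k\<close>, divide by \<open>t ^ k\<close> and let
  \<open>t\<close> tend to 0. These quotients belong to the subspace and converge to the k-th
  coefficient in the weighted norm.\<close>

lemma taylor_coeff_mem:
  assumes r: "0 < \<rho>" and hol: "\<And>x. x \<in> A \<Longrightarrow> (\<lambda>y. \<Phi> y x) holomorphic_on ball a \<rho>"
    and B: "\<And>x y. x \<in> A \<Longrightarrow> y \<in> ball a \<rho> \<Longrightarrow> cmod (\<Phi> y x) * w x \<le> B"
    and s: "0 < s" and P: "\<And>y. y \<in> ball a s \<Longrightarrow> P (\<Phi> y)"
  shows "P (taylor_coeff \<Phi> a k)"
proof (induction k rule: less_induct)
  case (less k)
  define \<sigma> where "\<sigma> = \<rho> / 2"
  have \<sigma>: "0 < \<sigma>" "\<sigma> < \<rho>" unfolding \<sigma>_def using r by auto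
  define B' where "B' = max B 0"
  have B': "cmod (\<Phi> y x) * w x \<le> B'" if "x \<in> A" "y \<in> ball a \<rho>" for x y
    using B[OF that] unfolding B'_def by simp
  show ?case
  proof (rule P_lim)
    fix \<epsilon> :: real assume e: "\<epsilon> > 0"
    \<comment> \<open>The first two bounds put \<open>a + t\<close> where membership is known and
      make \<open>1 / (1 - t / \<sigma>)\<close> at most 2; the third makes the error
      \<open>2 * B' * t / \<sigma> ^ Suc k\<close> at most \<epsilon>. The added 1 avoids division
      by zero.\<close>
    define t where "t = min (min (s / 2) (\<sigma> / 2)) (\<epsilon> * \<sigma> ^ Suc k / (2 * B' + 1))"
    have B0: "0 \<le> B'" unfolding B'_def by simp
    have t1: "t \<le> s / 2" "t \<le> \<sigma> / 2" "t \<le> \<epsilon> * \<sigma> ^ Suc k / (2 * B' + 1)"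
      unfolding t_def by (meson min.cobounded1 min.cobounded2 order_trans)+
    have "0 < \<epsilon> * \<sigma> ^ Suc k / (2 * B' + 1)"
      using e \<sigma> B0 by (intro divide_pos_pos mult_pos_pos zero_less_power) auto
    then have "0 < t" unfolding t_def using s \<sigma> by simp
    then have t: "0 < t" "t < s" "t \<le> \<sigma> / 2" "t < \<sigma>" "t \<le> \<epsilon> * \<sigma> ^ Suc k / (2 * B' + 1)"
      using t1 s \<sigma> by auto
    define y where "y = a + of_real t"
    have ya: "y - a = of_real t" "cmod (y - a) = t" unfolding y_def using t by auto
    define G where "G x = (1 / of_real t ^ k) * (\<Phi> y x - (\<Sum>j<k. of_real t ^ j * taylor_coeff \<Phi> a j x))" for x
    have "P G" unfolding G_def
      by (intro P_scale P_diff P_sum P less) (use t in \<open>auto simp: y_def dist_norm\<close>)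
    moreover have "cmod (taylor_coeff \<Phi> a k x - G x) * w x \<le> \<epsilon>" if x: "x \<in> A" for x
    proof -
      let ?R = "\<Phi> y x - (\<Sum>j<Suc k. taylor_coeff \<Phi> a j x * (y - a) ^ j)"
      have R: "cmod ?R * w x \<le> B' * (t / \<sigma>) ^ Suc k / (1 - t / \<sigma>)"
        using taylor_remainder[where \<Phi> = \<Phi> and a = a and y = y, OF \<sigma> hol[OF x] x B'[OF x], of "Suc k"] ya t by simp
      have "1 / (1 - t / \<sigma>) \<le> 2" using t \<sigma> by (simp add: field_simps)
      then have "B' * (t / \<sigma>) ^ Suc k * (1 / (1 - t / \<sigma>)) \<le> B' * (t / \<sigma>) ^ Suc k * 2"
        using B0 t \<sigma> by (intro mult_left_mono) auto
      then have "B' * (t / \<sigma>) ^ Suc k / (1 - t / \<sigma>) \<le> 2 * B' * (t / \<sigma>) ^ Suc k"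
        by (simp only: mult_ac times_divide_eq_right mult_1_right mult_1_left)
      from order_trans[OF R this] have R2: "cmod ?R * w x \<le> 2 * B' * (t / \<sigma>) ^ Suc k" .
      have "taylor_coeff \<Phi> a k x - G x = - (?R / of_real t ^ k)"
        unfolding G_def using t ya by (simp add: field_simps)
      then have "cmod (taylor_coeff \<Phi> a k x - G x) * w x = cmod ?R * w x / t ^ k"
        using t by (simp only: norm_minus_cancel norm_divide norm_power norm_of_real) simp
      also have "\<dots> \<le> 2 * B' * (t / \<sigma>) ^ Suc k / t ^ k" using R2 t by (intro divide_right_mono) auto
      also have "\<dots> = 2 * B' * t / \<sigma> ^ Suc k" using t by (simp add: power_divide field_simps)
      also have "\<dots> \<le> (2 * B' + 1) * t / \<sigma> ^ Suc k"
        using t \<sigma> by (intro divide_right_mono mult_right_mono) auto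
      also have "\<dots> \<le> \<epsilon>"
        using t(5) B0 \<sigma> by (simp add: field_simps)
      finally show ?thesis .
    qed
    ultimately show "\<exists>G. P G \<and> (\<forall>x\<in>A. cmod (taylor_coeff \<Phi> a k x - G x) * w x \<le> \<epsilon>)" by blast
  qed
qed

text \<open>The coefficients at \<open>a\<close> see only the small ball of radius \<open>s\<close>,
  but the Taylor polynomials converge in the weighted norm on all of \<open>ball a \<rho>\<close>.
  This is the unit step of the continuation in the pole.\<close>

lemma family_mem_ball:
  assumes r: "0 < \<rho>" and hol: "\<And>x. x \<in> A \<Longrightarrow> (\<lambda>y. \<Phi> y x) holomorphic_on ball a \<rho>"
    and B: "\<And>x y. x \<in> A \<Longrightarrow> y \<in> ball a \<rho> \<Longrightarrow> cmod (\<Phi> y x) * w x \<le> B"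
    and s: "0 < s" and P: "\<And>y. y \<in> ball a s \<Longrightarrow> P (\<Phi> y)"
    and y: "y \<in> ball a \<rho>"
  shows "P (\<Phi> y)"
proof (rule P_lim)
  fix \<epsilon> :: real assume e: "\<epsilon> > 0"
  have ya: "cmod (y - a) < \<rho>" using y by (simp add: dist_norm norm_minus_commute)
  define \<sigma> where "\<sigma> = (cmod (y - a) + \<rho>) / 2"
  have \<sigma>: "0 < \<sigma>" "\<sigma> < \<rho>" "cmod (y - a) < \<sigma>"
    unfolding \<sigma>_def using r ya norm_ge_zero[of "y - a"] by (simp_all add: add_nonneg_pos del: norm_ge_zero)
  define q where "q = cmod (y - a) / \<sigma>"
  have q: "0 \<le> q" "q < 1" unfolding q_def using \<sigma> by auto
  have "(\<lambda>N. B * q ^ N / (1 - q)) \<longlonglongrightarrow> B * 0 / (1 - q)"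
    using q by (intro tendsto_intros LIMSEQ_power_zero) auto
  then have "\<forall>\<^sub>F N in sequentially. B * q ^ N / (1 - q) < \<epsilon>"
    using e by (intro order_tendstoD(2)) auto
  then obtain N where N: "B * q ^ N / (1 - q) < \<epsilon>" by (auto simp: eventually_sequentially)
  define G where "G x = (\<Sum>k<N. (y - a) ^ k * taylor_coeff \<Phi> a k x)" for x
  have "P G" unfolding G_def by (intro P_sum taylor_coeff_mem[OF r hol B s P]) auto
  moreover have "cmod (\<Phi> y x - G x) * w x \<le> \<epsilon>" if x: "x \<in> A" for x
    using taylor_remainder[where \<Phi> = \<Phi> and a = a and y = y, OF \<sigma>(1,2) hol[OF x] x B[OF x] \<sigma>(3), of N] N
    unfolding G_def q_def by (simp add: mult.commute)
  ultimately show "\<exists>G. P G \<and> (\<forall>x\<in>A. cmod (\<Phi> y x - G x) * w x \<le> \<epsilon>)" by blast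
qed

lemma family_mem_connected:
  assumes U: "open U" "connected U" and hol: "\<And>x. x \<in> A \<Longrightarrow> (\<lambda>y. \<Phi> y x) holomorphic_on U"
    and loc: "\<And>a. a \<in> U \<Longrightarrow> \<exists>\<rho>>0. \<exists>B. ball a \<rho> \<subseteq> U \<and> (\<forall>x\<in>A. \<forall>y\<in>ball a \<rho>. cmod (\<Phi> y x) * w x \<le> B)"
    and W: "open W" "W \<inter> U \<noteq> {}" "\<And>y. y \<in> W \<inter> U \<Longrightarrow> P (\<Phi> y)"
    and y: "y \<in> U"
  shows "P (\<Phi> y)"
proof -
  define T where "T = interior {y \<in> U. P (\<Phi> y)}"
  \<comment> \<open>A centre \<open>b\<close> of \<open>T\<close> within \<open>\<rho> / 2\<close>
    of \<open>a\<close> has \<open>ball b (\<rho> / 2)\<close> inside the ball where the bound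
    \<open>B\<close> holds, and \<open>a\<close> lies in that smaller ball.\<close>
  have near: "a \<in> T" if a: "a \<in> U" and "\<rho> > 0" and "ball a \<rho> \<subseteq> U"
    and bd: "\<forall>x\<in>A. \<forall>y\<in>ball a \<rho>. cmod (\<Phi> y x) * w x \<le> B" and ne: "ball a (\<rho> / 2) \<inter> T \<noteq> {}" for a \<rho> B
  proof -
    obtain b where b: "b \<in> ball a (\<rho> / 2)" "b \<in> T" using ne by blast
    obtain s where s: "s > 0" "ball b s \<subseteq> {y \<in> U. P (\<Phi> y)}"
      using b(2) unfolding T_def mem_interior by blast
    have sub: "ball b (\<rho> / 2) \<subseteq> ball a \<rho>"
    proof
      fix z assume "z \<in> ball b (\<rho> / 2)"
      then show "z \<in> ball a \<rho>" using b(1) dist_triangle[of a z b] by auto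
    qed
    have "P (\<Phi> z)" if "z \<in> ball b (\<rho> / 2)" for z
    proof (rule family_mem_ball[OF _ _ _ s(1) _ that])
      show "(\<lambda>y. \<Phi> y x) holomorphic_on ball b (\<rho> / 2)" if "x \<in> A" for x
        by (rule holomorphic_on_subset[OF hol[OF that]]) (use sub \<open>ball a \<rho> \<subseteq> U\<close> in blast)
      show "cmod (\<Phi> y x) * w x \<le> B" if "x \<in> A" "y \<in> ball b (\<rho> / 2)" for x y
        using bd that sub by blast
      show "P (\<Phi> y)" if "y \<in> ball b s" for y using s(2) that by blast
    qed (use \<open>\<rho> > 0\<close> in simp)
    then have "ball b (\<rho> / 2) \<subseteq> {y \<in> U. P (\<Phi> y)}" using sub \<open>ball a \<rho> \<subseteq> U\<close> by blast
    then have "ball b (\<rho> / 2) \<subseteq> T" unfolding T_def by (intro interior_maximal) auto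
    then show ?thesis using b(1) by (auto simp: dist_commute)
  qed
  \<comment> \<open>The exterior of \<open>T\<close> relative to \<open>U\<close>. By
    \<open>near\<close> no point of \<open>U\<close> is left over, so connectedness decides between
    the two open sets.\<close>
  define T' where "T' = {a \<in> U. \<exists>r>0. ball a r \<inter> T = {}}"
  have "open T'"
    unfolding open_contains_ball
  proof
    fix a assume "a \<in> T'"
    then obtain r where a: "a \<in> U" "r > 0" "ball a r \<inter> T = {}" unfolding T'_def by blast
    obtain e where e: "e > 0" "ball a e \<subseteq> U" using U(1) a(1) openE by blast
    have "ball a (min e (r / 2)) \<subseteq> T'"
    proof
      fix z assume z: "z \<in> ball a (min e (r / 2))"
      have "ball z (r / 2) \<subseteq> ball a r"
      proof
        fix v assume "v \<in> ball z (r / 2)"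
        then show "v \<in> ball a r" using z dist_triangle[of a v z] by auto
      qed
      then show "z \<in> T'" unfolding T'_def using z e a by (auto intro!: exI[of _ "r / 2"])
    qed
    then show "\<exists>e>0. ball a e \<subseteq> T'" using e a by (intro exI[of _ "min e (r / 2)"]) auto
  qed
  moreover have "open T" unfolding T_def by simp
  moreover have "T \<inter> T' \<inter> U = {}"
  proof (rule equals0I)
    fix a assume "a \<in> T \<inter> T' \<inter> U"
    then obtain r where "r > 0" "ball a r \<inter> T = {}" "a \<in> T" unfolding T'_def by blast
    then show False using centre_in_ball by blast
  qed
  moreover have "U \<subseteq> T \<union> T'"
  proof
    fix a assume a: "a \<in> U"
    then obtain \<rho> B where r: "\<rho> > 0" "ball a \<rho> \<subseteq> U" "\<forall>x\<in>A. \<forall>y\<in>ball a \<rho>. cmod (\<Phi> y x) * w x \<le> B"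
      using loc by meson
    show "a \<in> T \<union> T'"
    proof (cases "ball a (\<rho> / 2) \<inter> T = {}")
      case True
      then show ?thesis using a r(1) unfolding T'_def by (auto intro!: exI[of _ "\<rho> / 2"])
    next
      case False
      then show ?thesis using near[OF a r] by blast
    qed
  qed
  moreover have "T \<inter> U \<noteq> {}"
  proof -
    have "W \<inter> U \<subseteq> T" unfolding T_def using W U by (intro interior_maximal) auto
    then show ?thesis using W(2) by blast
  qed
  ultimately have "T' \<inter> U = {}" using connectedD[OF U(2), of T T'] by blast
  then have "y \<in> T" using y \<open>U \<subseteq> T \<union> T'\<close> by blast
  then show ?thesis unfolding T_def using interior_subset by blast
qed

text \<open>The remainder estimate of order 1; it supplies the uniformity in \<open>x\<close> that
  the Riemann sums need.\<close>

lemma family_continuous: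
  assumes r: "0 < \<rho>" and hol: "\<And>x. x \<in> A \<Longrightarrow> (\<lambda>y. \<Phi> y x) holomorphic_on ball a \<rho>"
    and B: "\<And>x y. x \<in> A \<Longrightarrow> y \<in> ball a \<rho> \<Longrightarrow> cmod (\<Phi> y x) * w x \<le> B" and e: "\<epsilon> > 0"
  obtains \<delta> where "\<delta> > 0" "\<And>x y. x \<in> A \<Longrightarrow> y \<in> ball a \<delta> \<Longrightarrow> cmod (\<Phi> y x - \<Phi> a x) * w x \<le> \<epsilon>"
proof -
  define \<sigma> where "\<sigma> = \<rho> / 2"
  have \<sigma>: "0 < \<sigma>" "\<sigma> < \<rho>" unfolding \<sigma>_def using r by auto
  have "((\<lambda>y. B * (cmod (y - a) / \<sigma>) ^ 1 / (1 - cmod (y - a) / \<sigma>)) \<longlongrightarrow> B * (cmod (a - a) / \<sigma>) ^ 1 / (1 - cmod (a - a) / \<sigma>)) (nhds a)"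
    using \<sigma> by (intro tendsto_intros filterlim_ident) auto
  then have "\<forall>\<^sub>F y in nhds a. B * (cmod (y - a) / \<sigma>) ^ 1 / (1 - cmod (y - a) / \<sigma>) < \<epsilon>"
    using e by (intro order_tendstoD(2)) auto
  then obtain d where d: "d > 0" "\<And>y. dist y a < d \<Longrightarrow> B * (cmod (y - a) / \<sigma>) ^ 1 / (1 - cmod (y - a) / \<sigma>) < \<epsilon>"
    unfolding eventually_nhds_metric by blast
  show ?thesis
  proof (rule that[of "min d \<sigma>"])
    show "min d \<sigma> > 0" using d \<sigma> by simp
    fix x y assume x: "x \<in> A" and y: "y \<in> ball a (min d \<sigma>)"
    then have ya: "cmod (y - a) < \<sigma>" "dist y a < d" by (auto simp: dist_norm norm_minus_commute)
    show "cmod (\<Phi> y x - \<Phi> a x) * w x \<le> \<epsilon>"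
      using taylor_remainder[where \<Phi> = \<Phi> and a = a and y = y, OF \<sigma> hol[OF x] x B[OF x] ya(1), of 1] d(2)[OF ya(2)]
      by (simp add: taylor_coeff_def)
  qed
qed

text \<open>Riemann sums approximate the integral of the family in the weighted norm.\<close>

lemma family_integral_mem:
  fixes a :: "complex \<Rightarrow> complex"
  assumes K: "compact K" and a: "integrable lborel a" "\<And>y. y \<notin> K \<Longrightarrow> a y = 0"
    and P: "\<And>y. y \<in> K \<Longrightarrow> P (\<Phi> y)"
    and int: "\<And>x. x \<in> A \<Longrightarrow> integrable lborel (\<lambda>y. a y * \<Phi> y x)"
    and cont: "\<And>b \<epsilon>. b \<in> K \<Longrightarrow> \<epsilon> > 0 \<Longrightarrow>
        \<exists>\<delta>>0. \<forall>x\<in>A. \<forall>y\<in>ball b \<delta>. cmod (\<Phi> y x - \<Phi> b x) * w x \<le> \<epsilon>"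
  shows "P (\<lambda>x. \<integral>y. a y * \<Phi> y x \<partial>lborel)"
proof (rule P_lim)
  fix \<epsilon> :: real assume e: "\<epsilon> > 0"
  define I where "I = (\<integral>y. cmod (a y) \<partial>lborel)"
  have I: "0 \<le> I" unfolding I_def by (intro integral_nonneg_AE) simp
  define \<epsilon>' where "\<epsilon>' = \<epsilon> / (I + 1)"
  have e': "\<epsilon>' > 0" unfolding \<epsilon>'_def using e I by simp
  obtain \<delta> where d: "\<And>b. b \<in> K \<Longrightarrow> \<delta> b > 0"
    "\<And>b x y. b \<in> K \<Longrightarrow> x \<in> A \<Longrightarrow> y \<in> ball b (\<delta> b) \<Longrightarrow> cmod (\<Phi> y x - \<Phi> b x) * w x \<le> \<epsilon>'"
    using cont[OF _ e'] by metis
  obtain S where S: "S \<subseteq> K" "finite S" "K \<subseteq> (\<Union>b\<in>S. ball b (\<delta> b))"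
  proof (rule compactE_image[OF K, of K "\<lambda>b. ball b (\<delta> b)"])
    show "K \<subseteq> (\<Union>b\<in>K. ball b (\<delta> b))" using d(1) by force
  qed auto
  obtain c and N :: nat where cN: "S = c ` {0..<N}"
    using ex_bij_betw_nat_finite[OF S(2)] unfolding bij_betw_def by metis
  \<comment> \<open>The finite cover is made disjoint, so that the cells are Borel sets and every
    point of \<open>K\<close> has exactly one sample point \<open>c i\<close>.\<close>
  define D where "D = disjointed (\<lambda>i. ball (c i) (\<delta> (c i)))"
  have Dm: "D i \<in> sets borel" for i
    unfolding D_def disjointed_def by (intro sets.Diff sets.finite_UN) auto
  have Dsub: "D i \<subseteq> ball (c i) (\<delta> (c i))" for i unfolding D_def by (rule disjointed_subset)
  have DK: "K \<subseteq> (\<Union>i\<in>{0..<N}. D i)"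
    unfolding D_def finite_UN_disjointed_eq using S(3) cN by auto
  have Dd: "disjoint_family D" unfolding D_def by (rule disjoint_family_disjointed)
  have part: "(\<Sum>i\<in>{0..<N}. indicator (D i) y *\<^sub>R a y) = a y" for y
  proof (cases "y \<in> K")
    case True
    then obtain j where j: "j < N" "y \<in> D j" using DK by auto
    have "indicator (D i) y *\<^sub>R a y = (if i = j then a y else 0)" for i
      using j(2) Dd by (auto simp: indicator_def disjoint_family_on_def)
    then show ?thesis using j(1) by simp
  qed (use a(2) in simp)
  define m where "m i = (\<integral>y. indicator (D i) y *\<^sub>R a y \<partial>lborel)" for i
  have mi: "integrable lborel (\<lambda>y. indicator (D i) y *\<^sub>R a y)" for i
    using a(1) Dm by (intro integrable_mult_indicator) auto
  define G where "G x = (\<Sum>i\<in>{0..<N}. m i * \<Phi> (c i) x)" for x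
  have "P G" unfolding G_def by (intro P_sum P) (use S(1) cN in auto)
  moreover have "cmod ((\<integral>y. a y * \<Phi> y x \<partial>lborel) - G x) * w x \<le> \<epsilon>" if x: "x \<in> A" for x
  proof -
    define H where "H y = (\<Sum>i\<in>{0..<N}. indicator (D i) y *\<^sub>R a y * \<Phi> (c i) x)" for y
    have Hi: "integrable lborel H" unfolding H_def
      by (intro Bochner_Integration.integrable_sum integrable_mult_left mi)
    have "(\<integral>y. H y \<partial>lborel) = (\<Sum>i\<in>{0..<N}. \<integral>y. indicator (D i) y *\<^sub>R a y * \<Phi> (c i) x \<partial>lborel)"
      unfolding H_def by (rule Bochner_Integration.integral_sum) (rule integrable_mult_left[OF mi])
    then have G: "G x = (\<integral>y. H y \<partial>lborel)"
      unfolding G_def m_def by (simp only: integral_mult_left_zero)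
    have le: "cmod (a y * \<Phi> y x - H y) * w x \<le> cmod (a y) * \<epsilon>'" for y
    proof (cases "y \<in> K")
      case True
      then obtain j where j: "j < N" "y \<in> D j" using DK by auto
      have "indicator (D i) y *\<^sub>R a y * \<Phi> (c i) x = (if i = j then a y * \<Phi> (c j) x else 0)" for i
        using j(2) Dd by (auto simp: indicator_def disjoint_family_on_def)
      then have "H y = a y * \<Phi> (c j) x" unfolding H_def using j(1) by simp
      then have "cmod (a y * \<Phi> y x - H y) * w x = cmod (a y) * (cmod (\<Phi> y x - \<Phi> (c j) x) * w x)"
        by (simp add: norm_mult[symmetric] right_diff_distrib)
      also have "\<dots> \<le> cmod (a y) * \<epsilon>'"
      proof (intro mult_left_mono d(2)[OF _ x])
        show "c j \<in> K" using S(1) cN j(1) by auto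
        show "y \<in> ball (c j) (\<delta> (c j))" using Dsub[of j] j(2) by blast
      qed simp
      finally show ?thesis .
    qed (simp add: a(2) H_def)
    have "cmod ((\<integral>y. a y * \<Phi> y x \<partial>lborel) - G x) * w x = cmod (\<integral>y. a y * \<Phi> y x - H y \<partial>lborel) * w x"
      unfolding G using int[OF x] Hi by simp
    also have "\<dots> \<le> (\<integral>y. cmod (a y * \<Phi> y x - H y) \<partial>lborel) * w x"
      by (intro mult_right_mono integral_norm_bound w_nonneg x)
    also have "\<dots> = (\<integral>y. cmod (a y * \<Phi> y x - H y) * w x \<partial>lborel)" by simp
    also have "\<dots> \<le> (\<integral>y. cmod (a y) * \<epsilon>' \<partial>lborel)"
      by (intro integral_mono le integrable_mult_left integrable_norm Bochner_Integration.integrable_diff int[OF x] Hi a(1))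
    also have "\<dots> = I * \<epsilon>'" unfolding I_def by simp
    also have "\<dots> \<le> \<epsilon>" unfolding \<epsilon>'_def using I e by (simp add: field_simps)
    finally show ?thesis .
  qed
  ultimately show "\<exists>G. P G \<and> (\<forall>x\<in>A. cmod ((\<integral>y. a y * \<Phi> y x \<partial>lborel) - G x) * w x \<le> \<epsilon>)" by blast
qed

end

section \<open>The weighted setting\<close>

text \<open>All cutoffs are smoothed at the same scale 1, so one \<open>C\<close> bounds every
  \<open>dbar (\<theta> j)\<close>. In the limit these derivatives vanish pointwise under a common
  dominating function.\<close>

lemma exhausting_cutoffs:
  obtains \<theta> :: "nat \<Rightarrow> complex \<Rightarrow> complex" and C where "0 \<le> C" "\<And>j. Cinf_on UNIV (\<theta> j)" "\<And>j. csupp (\<theta> j)"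
    "\<And>j y. cmod (\<theta> j y) \<le> 1" "\<And>j y. cmod (dbar (\<theta> j) y) \<le> C"
    "\<And>j y. cmod y + 1 < real j \<Longrightarrow> \<theta> j y = 1" "\<And>j y. cmod y + 1 < real j \<Longrightarrow> dbar (\<theta> j) y = 0"
proof -
  obtain C where C: "0 \<le> C" "\<And>S. open S \<Longrightarrow> \<exists>\<psi>. is_cutoff 1 C S \<psi>"
    by (rule cutoff_exists[of 1]) (auto intro: that)
  have "\<exists>\<theta>. \<forall>j. is_cutoff 1 C (ball 0 (real j)) (\<theta> j)" using C(2) by (intro choice allI) auto
  then obtain \<theta> where t: "\<And>j. is_cutoff 1 C (ball 0 (real j)) (\<theta> j)" by blast
  note tD = is_cutoffD[OF t]
  have s: "csupp (\<theta> j)" for j unfolding csupp_def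
  proof (intro exI[of _ "real j + 1"] allI impI)
    fix y :: complex assume y: "real j + 1 < cmod y"
    have "ball y 1 \<inter> ball 0 (real j) = {}"
    proof (rule equals0I)
      fix z assume "z \<in> ball y 1 \<inter> ball 0 (real j)"
      then show False using y norm_triangle_ineq2[of y z] by (auto simp: dist_norm)
    qed
    then show "\<theta> j y = 0" by (rule tD(4))
  qed
  have o: "\<theta> j y = 1" if "cmod y + 1 < real j" for j y
  proof (rule tD(3), rule subsetI)
    fix z assume "z \<in> ball y 1"
    then show "z \<in> ball 0 (real j)"
      using that norm_triangle_ineq2[of z y] by (auto simp: dist_norm norm_minus_commute)
  qed
  have "dbar (\<theta> j) y = 0" if "cmod y + 1 < real j" for j y
  proof -
    have "dbar (\<theta> j) y = dbar (\<lambda>_. 1) y"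
      by (rule dbar_cong[of "ball 0 (real j - 1)"]) (use that o in \<open>auto intro!: Cinf_on_holomorphic\<close>)
    then show ?thesis using dbar_holomorphic[of UNIV "\<lambda>_. 1" y] by simp
  qed
  then show ?thesis using that[of C \<theta>] C(1) tD(1,2,5) s o by blast
qed

locale weighted_dbar =
  fixes \<Omega> :: "complex set" and \<Omega>s :: "nat \<Rightarrow> complex set" and \<nu> :: "nat \<Rightarrow> complex \<Rightarrow> real"
    and g :: "nat \<Rightarrow> complex \<Rightarrow> complex" and I1 I2 :: "nat \<Rightarrow> nat" and X :: "nat \<Rightarrow> complex set"
    and R r :: "nat \<Rightarrow> real" and I4 :: "nat \<Rightarrow> nat"
  assumes standing: "standing_setup \<Omega> \<Omega>s \<nu>" and condW: "condW \<Omega>s \<nu>"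
    and Da: "condD_a \<Omega>s \<nu> g I1 I2 X R r" and Db: "condD_b \<Omega>s \<nu> g I1 I4"
    and Dc: "condD_c \<Omega>s I1 I4 X" and I2_ge: "I2 (I1 (I4 n)) \<ge> I1 (I4 (Suc n))"
begin

lemma Omega_open: "open \<Omega>" "open (\<Omega>s n)"
  using standing unfolding standing_setup_def by auto

lemma Omega_mono: "m \<le> n \<Longrightarrow> \<Omega>s m \<subseteq> \<Omega>s n"
  using standing unfolding standing_setup_def by (metis lift_Suc_mono_le)

lemma Omega_sub: "\<Omega>s n \<subseteq> \<Omega>"
  using standing unfolding standing_setup_def by auto

lemma Omega_cover: "x \<in> \<Omega> \<Longrightarrow> \<exists>n. x \<in> \<Omega>s n"
  using standing unfolding standing_setup_def by auto

lemma nu_pos: "x \<in> \<Omega>s k \<Longrightarrow> 0 < \<nu> n x"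
  using standing Omega_sub unfolding standing_setup_def by blast

lemma nu_cont: "continuous_on \<Omega> (\<nu> n)"
  using standing unfolding standing_setup_def by auto

lemma nu_mono:
  assumes "x \<in> \<Omega>s k" "m \<le> n"
  shows "\<nu> m x \<le> \<nu> n x"
proof -
  have "\<nu> i x \<le> \<nu> (Suc i) x" for i
    using standing Omega_sub assms(1) unfolding standing_setup_def by blast
  then show ?thesis using assms(2) by (rule lift_Suc_mono_le)
qed

lemma g_holo: "g n holomorphic_on UNIV" "g n 0 = 1"
  using Da unfolding condD_a_def by auto

lemma I_gt: "n < I1 n" "n < I2 n" "n < I4 n"
  using Da Db unfolding condD_a_def condD_b_def by auto

text \<open>A ball around a point of \<open>\<Omega>s n\<close> with the distance to the frontier as
  radius is connected and misses the frontier of \<open>\<Omega>s k\<close>, so it cannot leave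
  \<open>\<Omega>s k\<close>. The frontier is non-empty because \<open>\<Omega>s k\<close> is
  neither empty nor the plane.\<close>

lemma separated:
  assumes "n < k"
  obtains d where "d > 0" "\<And>x. x \<in> \<Omega>s n \<Longrightarrow> ball x d \<subseteq> \<Omega>s k"
proof -
  have k: "\<Omega>s k \<noteq> {}" "\<Omega>s k \<noteq> UNIV" "\<Omega>s n \<noteq> {}"
    and p: "0 < edist_set (\<Omega>s n) (frontier (\<Omega>s k))"
    using standing assms unfolding standing_setup_def by auto
  have "frontier (\<Omega>s k) \<noteq> {}" using k by (simp add: frontier_eq_empty)
  then have d: "0 < setdist (\<Omega>s n) (frontier (\<Omega>s k))" using p k unfolding edist_set_def by simp
  show ?thesis
  proof (rule that[OF d])
    fix x assume x: "x \<in> \<Omega>s n"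
    let ?B = "ball x (setdist (\<Omega>s n) (frontier (\<Omega>s k)))"
    have "?B \<inter> frontier (\<Omega>s k) = {}"
      using setdist_le_dist[OF x] by (force simp: not_less)
    moreover have "x \<in> ?B" "x \<in> \<Omega>s k" using x Omega_mono[of n k] assms d by auto
    ultimately show "?B \<subseteq> \<Omega>s k" using connected_Int_frontier[OF connected_ball, of x _ "\<Omega>s k"] by blast
  qed
qed

lemma closure_sub: "n < k \<Longrightarrow> closure (\<Omega>s n) \<subseteq> \<Omega>s k"
proof
  fix x assume nk: "n < k" and x: "x \<in> closure (\<Omega>s n)"
  obtain d where d: "d > 0" "\<And>x. x \<in> \<Omega>s n \<Longrightarrow> ball x d \<subseteq> \<Omega>s k" by (rule separated[OF nk]) blast
  obtain y where "y \<in> \<Omega>s n" "dist y x < d" using x d(1) unfolding closure_approachable by blast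
  then show "x \<in> \<Omega>s k" using d(2)[of y] by auto
qed

text \<open>Converts weighted bounds into the plain local bounds required by
  \<open>solution_limit\<close>.\<close>

lemma nu_lower:
  assumes "x \<in> \<Omega>s k"
  obtains s \<beta> where "s > 0" "\<beta> > 0" "ball x s \<subseteq> \<Omega>s k" "\<And>y. y \<in> ball x s \<Longrightarrow> \<beta> \<le> \<nu> n y"
proof -
  have "isCont (\<nu> n) x"
    using nu_cont Omega_open(1) assms Omega_sub by (metis continuous_on_eq_continuous_at subsetD)
  then have "(\<nu> n \<longlongrightarrow> \<nu> n x) (at x)" by (simp add: isCont_def)
  then have "\<forall>\<^sub>F y in at x. \<nu> n x / 2 < \<nu> n y"
    using nu_pos[OF assms, of n] by (intro order_tendstoD(1)) auto
  then obtain d where d: "d > 0" "\<And>y. y \<noteq> x \<Longrightarrow> dist y x < d \<Longrightarrow> \<nu> n x / 2 < \<nu> n y"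
    unfolding eventually_at by auto
  obtain e where e: "e > 0" "ball x e \<subseteq> \<Omega>s k" using Omega_open(2)[of k] assms openE by blast
  have "\<nu> n x / 2 \<le> \<nu> n y" if "y \<in> ball x (min d e)" for y
    using d(2)[of y] that nu_pos[OF assms, of n] by (cases "y = x") (auto simp: dist_commute)
  then show ?thesis using d e nu_pos[OF assms, of n] by (intro that[of "min d e" "\<nu> n x / 2"]) auto
qed

section \<open>Kernel estimate and weighted solutions on a single set\<close>

definition ker :: "nat \<Rightarrow> complex \<Rightarrow> complex \<Rightarrow> complex" where
  "ker q x y = g q (x - y) / of_real pompeiu_const / (x - y)"

lemma ker_measurable[measurable]: "ker q x \<in> borel_measurable borel"
proof -
  have [measurable]: "g q \<in> borel_measurable borel"
    by (rule borel_measurable_continuous_onI[OF holomorphic_on_imp_continuous_on[OF g_holo(1)]])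
  show ?thesis unfolding ker_def by measurable
qed

text \<open>Condition (b) as an operator bound from the weight \<open>\<nu> k\<close> on
  \<open>\<Omega>s (I4 n)\<close> to the weight \<open>\<nu> p\<close> on
  \<open>\<Omega>s p\<close>. Convergence is stated separately, since a divergent integral has the
  value 0 by convention and would satisfy the estimate vacuously.\<close>

definition kernel_bound :: "nat \<Rightarrow> real \<Rightarrow> bool" where
  "kernel_bound n A \<longleftrightarrow> (\<forall>k p x F C. (k, p) \<in> {(I4 n, n), (I1 (I4 n), I1 (I4 n))} \<longrightarrow> x \<in> \<Omega>s p \<longrightarrow>
    F \<in> borel_measurable borel \<longrightarrow> 0 \<le> C \<longrightarrow> (\<forall>y\<in>\<Omega>s (I4 n). cmod (F y) * \<nu> k y \<le> C) \<longrightarrow>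
    (\<forall>y. y \<notin> \<Omega>s (I4 n) \<longrightarrow> F y = 0) \<longrightarrow>
    integrable lborel (\<lambda>y. ker (I1 (I4 n)) x y * F y) \<and>
    cmod (\<integral>y. ker (I1 (I4 n)) x y * F y \<partial>lborel) * \<nu> p x \<le> A * C)"

lemma kernel_boundD:
  assumes "kernel_bound n A" "(k, p) \<in> {(I4 n, n), (I1 (I4 n), I1 (I4 n))}" "x \<in> \<Omega>s p"
    "F \<in> borel_measurable borel" "0 \<le> C" "\<And>y. y \<in> \<Omega>s (I4 n) \<Longrightarrow> cmod (F y) * \<nu> k y \<le> C"
    "\<And>y. y \<notin> \<Omega>s (I4 n) \<Longrightarrow> F y = 0"
  shows "integrable lborel (\<lambda>y. ker (I1 (I4 n)) x y * F y)"
    "cmod (\<integral>y. ker (I1 (I4 n)) x y * F y \<partial>lborel) * \<nu> p x \<le> A * C"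
  using assms(1)[unfolded kernel_bound_def, rule_format, OF assms(2-5)] assms(6,7) by blast+

lemma kernel_estimate:
  obtains A where "0 \<le> A" "kernel_bound n A"
proof -
  let ?q = "I1 (I4 n)" and ?O = "\<Omega>s (I4 n)" and ?c = pompeiu_const
  obtain A4 where A4: "A4 > 0" "\<And>k p x. (k, p) \<in> {(I4 n, n), (?q, ?q)} \<Longrightarrow> x \<in> \<Omega>s p \<Longrightarrow>
      (\<integral>\<^sup>+ y. ennreal (cmod (g ?q (x - y)) * \<nu> p x / (cmod (x - y) * \<nu> k y)) * indicator ?O y \<partial>lborel) \<le> ennreal A4"
  proof -
    obtain A where "A > 0" "\<forall>(k, p) \<in> {(I4 n, n), (?q, ?q)}. \<forall>x\<in>\<Omega>s p.
      (\<integral>\<^sup>+ y. ennreal (cmod (g ?q (x - y)) * \<nu> p x / (cmod (x - y) * \<nu> k y)) * indicator ?O y \<partial>lborel) \<le> ennreal A"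
      using Db unfolding condD_b_def by meson
    then show ?thesis using that[of A] by auto
  qed
  have c: "?c > 0" by (rule pompeiu_const_pos)
  have "kernel_bound n (A4 / ?c)"
    unfolding kernel_bound_def
  proof (intro allI impI)
    fix k p x F C assume kp: "(k, p) \<in> {(I4 n, n), (?q, ?q)}" and x: "x \<in> \<Omega>s p"
      and F[measurable]: "F \<in> borel_measurable borel" and C: "0 \<le> C"
      and "\<forall>y\<in>?O. cmod (F y) * \<nu> k y \<le> C" and "\<forall>y. y \<notin> ?O \<longrightarrow> F y = 0"
    then have le: "\<And>y. y \<in> ?O \<Longrightarrow> cmod (F y) * \<nu> k y \<le> C" and F0: "\<And>y. y \<notin> ?O \<Longrightarrow> F y = 0" by auto
    have px: "\<nu> p x > 0" by (rule nu_pos[OF x])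
    define G where "G y = ennreal (cmod (g ?q (x - y)) * \<nu> p x / (cmod (x - y) * \<nu> k y)) * indicator ?O y" for y
    have Gm: "G \<in> borel_measurable lborel"
    proof -
      have [measurable]: "g ?q \<in> borel_measurable borel"
        by (rule borel_measurable_continuous_onI[OF holomorphic_on_imp_continuous_on[OF g_holo(1)]])
      have [measurable]: "?O \<in> sets borel" using Omega_open(2) by simp
      \<comment> \<open>Continuity of \<open>\<nu> k\<close> is known on \<open>\<Omega>\<close>
        only, so its measurability is available after multiplication with the indicator.\<close>
      have [measurable]: "(\<lambda>y. indicator ?O y *\<^sub>R \<nu> k y) \<in> borel_measurable borel"
        by (intro borel_measurable_continuous_on_indicator continuous_on_subset[OF nu_cont Omega_sub]) simp
      have "G = (\<lambda>y. ennreal (cmod (g ?q (x - y)) * \<nu> p x / (cmod (x - y) * (indicator ?O y *\<^sub>R \<nu> k y))) * indicator ?O y)"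
        unfolding G_def by (auto simp: fun_eq_iff indicator_def)
      also have "\<dots> \<in> borel_measurable lborel" by measurable
      finally show ?thesis .
    qed
    define b where "b = C / (?c * \<nu> p x)"
    have b: "0 \<le> b" unfolding b_def using C c px by simp
    have pt: "ennreal (cmod (ker ?q x y * F y)) \<le> ennreal b * G y" for y
    proof (cases "y \<in> ?O")
      case True
      have ky: "\<nu> k y > 0" by (rule nu_pos[OF True])
      have "cmod (F y) \<le> C / \<nu> k y" using le[OF True] ky by (simp add: field_simps)
      then have "cmod (ker ?q x y) * cmod (F y) \<le> cmod (ker ?q x y) * (C / \<nu> k y)" by (intro mult_left_mono) auto
      also have "\<dots> = b * (cmod (g ?q (x - y)) * \<nu> p x / (cmod (x - y) * \<nu> k y))"
        unfolding ker_def b_def using c px by (simp add: norm_divide norm_mult mult_ac)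
      finally have "ennreal (cmod (ker ?q x y * F y)) \<le> ennreal (b * (cmod (g ?q (x - y)) * \<nu> p x / (cmod (x - y) * \<nu> k y)))"
        unfolding norm_mult by (rule ennreal_leI)
      also have "\<dots> = ennreal b * G y"
        unfolding G_def using True b px ky by (subst ennreal_mult) auto
      finally show ?thesis .
    qed (simp add: F0)
    have "(\<integral>\<^sup>+ y. ennreal (cmod (ker ?q x y * F y)) \<partial>lborel) \<le> (\<integral>\<^sup>+ y. ennreal b * G y \<partial>lborel)"
      by (rule nn_integral_mono) (rule pt)
    also have "\<dots> = ennreal b * (\<integral>\<^sup>+ y. G y \<partial>lborel)" by (rule nn_integral_cmult[OF Gm])
    also have "\<dots> \<le> ennreal b * ennreal A4"
      using A4(2)[OF kp x] unfolding G_def by (rule mult_left_mono) simp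
    also have "\<dots> = ennreal (b * A4)" using b A4(1) by (simp add: ennreal_mult)
    finally have N: "(\<integral>\<^sup>+ y. ennreal (cmod (ker ?q x y * F y)) \<partial>lborel) \<le> ennreal (b * A4)" .
    have int: "integrable lborel (\<lambda>y. ker ?q x y * F y)"
    proof (rule integrableI_bounded)
      show "(\<integral>\<^sup>+ y. ennreal (cmod (ker ?q x y * F y)) \<partial>lborel) < \<infinity>"
        using N by (rule le_less_trans) simp
    qed measurable
    have "ennreal (cmod (\<integral>y. ker ?q x y * F y \<partial>lborel)) \<le> ennreal (b * A4)"
      using integral_norm_bound_ennreal[OF int] N by (rule order_trans)
    then have "cmod (\<integral>y. ker ?q x y * F y \<partial>lborel) \<le> b * A4"
      using b A4(1) by (simp add: ennreal_le_iff)
    from mult_right_mono[OF this, of "\<nu> p x"] px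
    have "cmod (\<integral>y. ker ?q x y * F y \<partial>lborel) * \<nu> p x \<le> A4 / ?c * C"
      unfolding b_def by (simp add: field_simps)
    with int show "integrable lborel (\<lambda>y. ker ?q x y * F y) \<and>
        cmod (\<integral>y. ker ?q x y * F y \<partial>lborel) * \<nu> p x \<le> A4 / ?c * C" by blast
  qed
  then show ?thesis using that[of "A4 / ?c"] A4(1) c by simp
qed

text \<open>The \<open>2 * \<eta>\<close>-neighbourhood of \<open>\<Omega>s m\<close> is smoothed at
  scale \<eta> with \<open>\<eta> = d / 4\<close>. A point outside \<open>\<Omega>s p\<close> has
  distance at least \<open>4 * \<eta>\<close> from \<open>\<Omega>s m\<close>, which leaves room for
  the cutoff to vanish on a whole ball around it.\<close>

lemma nested_cutoff:
  assumes "m < p"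
  obtains \<eta> C \<psi> where "\<eta> > 0" "0 \<le> C" "Cinf_on UNIV \<psi>" "\<And>y. cmod (\<psi> y) \<le> 1" "\<And>y. cmod (dbar \<psi> y) \<le> C"
    "\<And>x y. x \<in> \<Omega>s m \<Longrightarrow> y \<in> ball x \<eta> \<Longrightarrow> \<psi> y = 1" "\<And>x y. x \<in> \<Omega>s m \<Longrightarrow> y \<in> ball x \<eta> \<Longrightarrow> dbar \<psi> y = 0"
    "\<And>y. y \<notin> \<Omega>s p \<Longrightarrow> \<exists>V. open V \<and> y \<in> V \<and> (\<forall>z\<in>V. \<psi> z = 0)"
proof -
  obtain d where d: "d > 0" "\<And>x. x \<in> \<Omega>s m \<Longrightarrow> ball x d \<subseteq> \<Omega>s p" by (rule separated[OF assms]) blast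
  define \<eta> where "\<eta> = d / 4"
  have \<eta>: "\<eta> > 0" unfolding \<eta>_def using d by simp
  define S where "S = (\<Union>x\<in>\<Omega>s m. ball x (2 * \<eta>))"
  have "open S" unfolding S_def by auto
  obtain C where C: "0 \<le> C" "\<And>S. open S \<Longrightarrow> \<exists>\<psi>. is_cutoff \<eta> C S \<psi>"
    by (rule cutoff_exists[OF \<eta>]) (auto intro: that)
  obtain \<psi> where \<psi>: "is_cutoff \<eta> C S \<psi>" using C(2)[OF \<open>open S\<close>] by blast
  note pD = is_cutoffD[OF \<psi>]
  have one: "\<psi> y = 1" if "x \<in> \<Omega>s m" "y \<in> ball x \<eta>" for x y
  proof (rule pD(3), rule subsetI)
    fix z assume "z \<in> ball y \<eta>"
    then have "z \<in> ball x (2 * \<eta>)" using that(2) dist_triangle[of x z y] by auto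
    then show "z \<in> S" unfolding S_def using that(1) by blast
  qed
  have "dbar \<psi> y = 0" if "x \<in> \<Omega>s m" "y \<in> ball x \<eta>" for x y
  proof -
    have "dbar \<psi> y = dbar (\<lambda>_. 1) y"
      by (rule dbar_cong[OF _ open_ball that(2)]) (use that one in \<open>auto intro!: Cinf_on_holomorphic\<close>)
    then show ?thesis using dbar_holomorphic[of UNIV "\<lambda>_. 1" y] by simp
  qed
  moreover have "\<exists>V. open V \<and> y \<in> V \<and> (\<forall>z\<in>V. \<psi> z = 0)" if y: "y \<notin> \<Omega>s p" for y
  proof -
    have "\<psi> z = 0" if z: "z \<in> ball y \<eta>" for z
    proof (rule pD(4), rule equals0I)
      fix v assume "v \<in> ball z \<eta> \<inter> S"
      then obtain x where v: "v \<in> ball z \<eta>" "x \<in> \<Omega>s m" "v \<in> ball x (2 * \<eta>)" unfolding S_def by blast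
      have "dist x y \<le> dist x v + dist v z + dist z y"
        using dist_triangle[of x y v] dist_triangle[of v y z] by linarith
      then have "y \<in> ball x d" using z v unfolding \<eta>_def by (auto simp: dist_commute)
      then show False using d(2)[OF v(2)] y by blast
    qed
    then show ?thesis using \<eta> by (intro exI[of _ "ball y \<eta>"]) auto
  qed
  ultimately show ?thesis using that[OF \<eta> C(1) pD(1,2,5)] one by blast
qed

lemma cauchy_op_ker:
  assumes "test_fun f"
  shows "cauchy_op (g q) f x = (\<integral>y. ker q x y * f y \<partial>lborel)"
  unfolding ker_def by (rule cauchy_op_eq_integral[OF g_holo(1) assms])

text \<open>The solution is the potential of \<open>\<psi> * f\<close>, which need not have compact
  support. It is the limit of the potentials of \<open>\<theta> j * \<psi> * f\<close>; near a fixed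
  point these solve the equation for all large \<open>j\<close> and obey one weighted bound from the
  pair \<open>(I4 m, m)\<close>.\<close>

lemma local_solution:
  assumes f: "Cinf_on \<Omega> f" and fb: "\<And>n. \<exists>C. \<forall>x\<in>\<Omega>s n. cmod (f x) * \<nu> n x \<le> C"
  obtains u C where "Cinf_on (\<Omega>s m) u" "\<And>x. x \<in> \<Omega>s m \<Longrightarrow> dbar u x = f x"
    "\<And>x. x \<in> \<Omega>s m \<Longrightarrow> cmod (u x) * \<nu> m x \<le> C"
proof -
  let ?p = "I4 m" and ?q = "I1 (I4 m)"
  obtain C0 where C0: "\<And>x. x \<in> \<Omega>s ?p \<Longrightarrow> cmod (f x) * \<nu> ?p x \<le> C0" using fb by blast
  define C where "C = max C0 0"
  have C: "0 \<le> C" "\<And>x. x \<in> \<Omega>s ?p \<Longrightarrow> cmod (f x) * \<nu> ?p x \<le> C" unfolding C_def using C0 by force+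
  obtain A where A: "0 \<le> A" "kernel_bound m A" by (rule kernel_estimate)
  obtain \<eta> C1 \<psi> where \<eta>: "\<eta> > 0" and \<psi>: "Cinf_on UNIV \<psi>" "\<And>y. cmod (\<psi> y) \<le> 1"
    "\<And>x y. x \<in> \<Omega>s m \<Longrightarrow> y \<in> ball x \<eta> \<Longrightarrow> \<psi> y = 1"
    "\<And>y. y \<notin> \<Omega>s ?p \<Longrightarrow> \<exists>V. open V \<and> y \<in> V \<and> (\<forall>z\<in>V. \<psi> z = 0)"
    by (rule nested_cutoff[OF I_gt(3)[of m]]) blast
  obtain \<theta> :: "nat \<Rightarrow> complex \<Rightarrow> complex" and C2 where \<theta>: "\<And>j. Cinf_on UNIV (\<theta> j)" "\<And>j. csupp (\<theta> j)"
    "\<And>j y. cmod (\<theta> j y) \<le> 1" "\<And>j y. cmod y + 1 < real j \<Longrightarrow> \<theta> j y = 1"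
    by (rule exhausting_cutoffs) blast
  have fp: "Cinf_on (\<Omega>s ?p) f" by (rule Cinf_on_subset[OF f Omega_sub])
  define F where "F y = \<psi> y * f y" for y
  define \<phi> where "\<phi> j y = \<theta> j y * \<psi> y * f y" for j y
  have Fc: "Cinf_on UNIV F" unfolding F_def by (rule Cinf_on_cutoff[OF \<psi>(1) Omega_open(2) fp \<psi>(4)])
  have test: "test_fun (\<phi> j)" for j unfolding \<phi>_def
  proof (rule test_fun_cutoff[OF _ _ Omega_open(2) fp])
    show "Cinf_on UNIV (\<lambda>z. \<theta> j z * \<psi> z)" by (rule Cinf_on_mult[OF open_UNIV \<theta>(1) \<psi>(1)])
    show "csupp (\<lambda>z. \<theta> j z * \<psi> z)" by (rule csupp_mult(1)[OF \<theta>(2)])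
    fix x assume "x \<notin> \<Omega>s ?p"
    then show "\<exists>V. open V \<and> x \<in> V \<and> (\<forall>y\<in>V. \<theta> j y * \<psi> y = 0)" using \<psi>(4)[of x] by auto
  qed
  have Fm[measurable]: "F \<in> borel_measurable borel"
    by (rule borel_measurable_continuous_onI[OF Cinf_on_imp_continuous[OF Fc]])
  have \<phi>m[measurable]: "\<phi> j \<in> borel_measurable borel" for j
    by (rule borel_measurable_continuous_onI[OF test_funD(1)[OF test]])
  have \<psi>0: "\<psi> y = 0" if "y \<notin> \<Omega>s ?p" for y using \<psi>(4)[OF that] by blast
  have le: "cmod (\<phi> j y) \<le> cmod (F y)" for j y
    using mult_right_mono[OF \<theta>(3)[of j y] norm_ge_zero[of "\<psi> y * f y"]]
    unfolding \<phi>_def F_def by (simp add: norm_mult mult.assoc)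
  have FC: "cmod (F y) * \<nu> ?p y \<le> C" if y: "y \<in> \<Omega>s ?p" for y
  proof -
    have "cmod (F y) \<le> cmod (f y)" unfolding F_def norm_mult
      using mult_right_mono[OF \<psi>(2)[of y] norm_ge_zero[of "f y"]] by simp
    from mult_right_mono[OF this, of "\<nu> ?p y"] C(2)[OF y] nu_pos[OF y, of ?p] show ?thesis by linarith
  qed
  have \<phi>C: "cmod (\<phi> j y) * \<nu> ?p y \<le> C" if y: "y \<in> \<Omega>s ?p" for j y
    using mult_right_mono[OF le[of j y], of "\<nu> ?p y"] FC[OF y] nu_pos[OF y, of ?p] by linarith
  define u where "u j x = cauchy_op (g ?q) (\<phi> j) x" for j x
  define v where "v x = (\<integral>y. ker ?q x y * F y \<partial>lborel)" for x
  have ue: "u j x = (\<integral>y. ker ?q x y * \<phi> j y \<partial>lborel)" for j x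
    unfolding u_def by (rule cauchy_op_ker[OF test])
  have ub: "cmod (u j x) * \<nu> m x \<le> A * C" if x: "x \<in> \<Omega>s m" for j x
    unfolding ue by (rule kernel_boundD(2)[OF A(2) _ x \<phi>m C(1) \<phi>C]) (use \<psi>0 in \<open>auto simp: \<phi>_def\<close>)
  have vb: "integrable lborel (\<lambda>y. ker ?q x y * F y)" "cmod (v x) * \<nu> m x \<le> A * C" if x: "x \<in> \<Omega>s m" for x
    unfolding v_def by (rule kernel_boundD[OF A(2) _ x Fm C(1) FC]; use \<psi>0 in \<open>auto simp: F_def\<close>)+
  have lim: "(\<lambda>j. u j x) \<longlonglongrightarrow> v x" if x: "x \<in> \<Omega>s m" for x
    unfolding ue v_def
  proof (rule integral_dominated_convergence[where w = "\<lambda>y. cmod (ker ?q x y * F y)"])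
    show "integrable lborel (\<lambda>y. cmod (ker ?q x y * F y))" by (rule integrable_norm[OF vb(1)[OF x]])
    have "cmod (ker ?q x y * \<phi> j y) \<le> cmod (ker ?q x y * F y)" for j y
      unfolding norm_mult by (rule mult_left_mono[OF le]) simp
    then show "AE y in lborel. cmod (ker ?q x y * \<phi> j y) \<le> cmod (ker ?q x y * F y)" for j by simp
    have "(\<lambda>j. \<phi> j y) \<longlonglongrightarrow> F y" for y
    proof (rule tendsto_eventually)
      obtain N :: nat where N: "cmod y + 1 < real N" using reals_Archimedean2 by blast
      have "\<phi> j y = F y" if "j \<ge> N" for j
        using \<theta>(4)[of y j] N that unfolding \<phi>_def F_def by simp
      then show "\<forall>\<^sub>F j in sequentially. \<phi> j y = F y" unfolding eventually_sequentially by blast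
    qed
    then show "AE y in lborel. (\<lambda>j. ker ?q x y * \<phi> j y) \<longlonglongrightarrow> ker ?q x y * F y"
      by (intro AE_I2 tendsto_mult tendsto_const)
  qed measurable
  have "Cinf_on (\<Omega>s m) v \<and> (\<forall>y\<in>\<Omega>s m. dbar v y = f y)"
  proof (rule solution_limit[OF Omega_open(2) _ _ lim])
    show "Cinf_on (\<Omega>s m) (u j)" for j
      unfolding u_def using Cinf_on_subset[OF Cinf_on_cauchy_op[OF g_holo(1) test]] by blast
    fix x assume x: "x \<in> \<Omega>s m"
    obtain s \<beta> where s: "s > 0" "\<beta> > 0" "ball x s \<subseteq> \<Omega>s m" "\<And>y. y \<in> ball x s \<Longrightarrow> \<beta> \<le> \<nu> m y"
      by (rule nu_lower[OF x, of m]) blast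
    \<comment> \<open>The margin 2 gives \<open>cmod y + 1 < real j\<close> for all \<open>y\<close>
      within 1 of \<open>x\<close> and \<open>j \<ge> N\<close>, so that
      \<open>\<theta> j y = 1\<close>.\<close>
    obtain N :: nat where N: "cmod x + 2 < real N" using reals_Archimedean2 by blast
    define t where "t = min s (min \<eta> 1)"
    have t: "t > 0" "t \<le> s" "t \<le> \<eta>" "t \<le> 1" unfolding t_def using s \<eta> by auto
    have "dbar (u j) y = f y \<and> cmod (u j y) \<le> A * C / \<beta>" if j: "j \<ge> N" and y: "y \<in> ball x t" for j y
    proof
      have ys: "y \<in> ball x s" "y \<in> ball x \<eta>" "cmod (y - x) < 1" using y t by (auto simp: dist_norm norm_minus_commute)
      have "cmod y + 1 < real j" using norm_triangle_ineq2[of y x] ys(3) N j by simp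
      then have "\<phi> j y = f y" unfolding \<phi>_def using \<theta>(4) \<psi>(3)[OF x ys(2)] by simp
      then show "dbar (u j) y = f y" unfolding u_def using dbar_cauchy_op[OF g_holo test] by simp
      have "cmod (u j y) * \<beta> \<le> cmod (u j y) * \<nu> m y" by (rule mult_left_mono[OF s(4)[OF ys(1)]]) simp
      also have "\<dots> \<le> A * C" using ub s(3) ys(1) by blast
      finally show "cmod (u j y) \<le> A * C / \<beta>" using s(2) by (simp add: field_simps)
    qed
    then show "\<exists>r>0. \<exists>N B. ball x r \<subseteq> \<Omega>s m \<and>
        (\<forall>j\<ge>N. \<forall>y\<in>ball x r. dbar (u j) y = f y \<and> cmod (u j y) \<le> B)"
      using t s(3) by (intro exI[of _ t] conjI exI[of _ N] exI[of _ "A * C / \<beta>"]) auto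
  qed
  then show ?thesis using that[of v "A * C"] vb(2) by blast
qed

section \<open>Approximable functions and kernels with poles off the closure\<close>

definition bounded_holo :: "nat \<Rightarrow> (complex \<Rightarrow> complex) \<Rightarrow> bool" where
  "bounded_holo k h \<longleftrightarrow> h holomorphic_on \<Omega>s k \<and> (\<exists>C. \<forall>x\<in>\<Omega>s k. cmod (h x) * \<nu> k x \<le> C)"

text \<open>The closure, in the norm of \<open>\<Omega>s n\<close>, of the weight-bounded
  holomorphic functions on \<open>\<Omega>s (I2 (I1 (I4 n)))\<close>. That index is the one at which
  (a)(ii) admits kernels with pole in \<open>X (I1 (I4 n))\<close>.\<close>

definition approximable :: "nat \<Rightarrow> (complex \<Rightarrow> complex) \<Rightarrow> bool" where
  "approximable n F \<longleftrightarrow> (\<forall>\<epsilon>>0. \<exists>h. bounded_holo (I2 (I1 (I4 n))) h \<and>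
     (\<forall>x\<in>\<Omega>s n. cmod (F x - h x) * \<nu> n x \<le> \<epsilon>))"

lemma bounded_holo_add:
  assumes "bounded_holo k F" "bounded_holo k G"
  shows "bounded_holo k (\<lambda>x. F x + G x)"
proof -
  obtain C D where C: "\<And>x. x \<in> \<Omega>s k \<Longrightarrow> cmod (F x) * \<nu> k x \<le> C"
    and D: "\<And>x. x \<in> \<Omega>s k \<Longrightarrow> cmod (G x) * \<nu> k x \<le> D"
    using assms unfolding bounded_holo_def by blast
  have "cmod (F x + G x) * \<nu> k x \<le> C + D" if "x \<in> \<Omega>s k" for x
    using C[OF that] D[OF that] nu_pos[OF that, of k]
      mult_right_mono[OF norm_triangle_ineq[of "F x" "G x"], of "\<nu> k x"] by (simp add: distrib_right)
  then show ?thesis using assms unfolding bounded_holo_def by (auto intro: holomorphic_on_add)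
qed

lemma bounded_holo_scale:
  assumes "bounded_holo k F"
  shows "bounded_holo k (\<lambda>x. c * F x)"
proof -
  obtain C where C: "\<And>x. x \<in> \<Omega>s k \<Longrightarrow> cmod (F x) * \<nu> k x \<le> C"
    using assms unfolding bounded_holo_def by blast
  have "cmod (c * F x) * \<nu> k x \<le> cmod c * C" if "x \<in> \<Omega>s k" for x
    using mult_left_mono[OF C[OF that] norm_ge_zero[of c]] by (simp add: norm_mult mult.assoc)
  then show ?thesis using assms unfolding bounded_holo_def by (auto intro!: holomorphic_on_mult)
qed

lemma weighted_triangle:
  assumes "x \<in> \<Omega>s n" "cmod (a - b) * \<nu> n x \<le> \<epsilon>" "cmod (b - c) * \<nu> n x \<le> \<delta>"
  shows "cmod (a - c) * \<nu> n x \<le> \<epsilon> + \<delta>"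
proof -
  have "cmod (a - c) \<le> cmod (a - b) + cmod (b - c)"
    using norm_triangle_ineq[of "a - b" "b - c"] by simp
  from mult_right_mono[OF this, of "\<nu> n x"] show ?thesis
    using assms nu_pos[OF assms(1), of n] by (simp add: distrib_right)
qed

lemma bounded_holo_approximable:
  assumes "bounded_holo (I2 (I1 (I4 n))) h"
  shows "approximable n h"
  unfolding approximable_def using assms by (metis diff_self norm_zero mult_zero_left less_imp_le)

lemma approximable_closed_subspace: "closed_subspace (\<Omega>s n) (\<nu> n) (approximable n)"
proof
  show "0 \<le> \<nu> n x" if "x \<in> \<Omega>s n" for x using nu_pos[OF that, of n] by simp
  show "approximable n (\<lambda>_. 0)"
    by (rule bounded_holo_approximable) (auto simp: bounded_holo_def intro!: exI[of _ 0])
  show "approximable n (\<lambda>x. F x + G x)" if F: "approximable n F" and G: "approximable n G" for F G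
    unfolding approximable_def
  proof (intro allI impI)
    fix \<epsilon> :: real assume "\<epsilon> > 0"
    then have e: "\<epsilon> / 2 > 0" by simp
    obtain h where h: "bounded_holo (I2 (I1 (I4 n))) h" "\<forall>x\<in>\<Omega>s n. cmod (F x - h x) * \<nu> n x \<le> \<epsilon> / 2"
      using F e unfolding approximable_def by blast
    obtain k where k: "bounded_holo (I2 (I1 (I4 n))) k" "\<forall>x\<in>\<Omega>s n. cmod (G x - k x) * \<nu> n x \<le> \<epsilon> / 2"
      using G e unfolding approximable_def by blast
    have "cmod (F x + G x - (h x + k x)) * \<nu> n x \<le> \<epsilon>" if x: "x \<in> \<Omega>s n" for x
      using weighted_triangle[OF x, of "F x + G x" "h x + G x" "\<epsilon> / 2" "h x + k x" "\<epsilon> / 2"] h(2) k(2) x by simp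
    then show "\<exists>h. bounded_holo (I2 (I1 (I4 n))) h \<and> (\<forall>x\<in>\<Omega>s n. cmod (F x + G x - h x) * \<nu> n x \<le> \<epsilon>)"
      using bounded_holo_add[OF h(1) k(1)] by blast
  qed
  show "approximable n (\<lambda>x. c * F x)" if F: "approximable n F" for F c
    unfolding approximable_def
  proof (intro allI impI)
    fix \<epsilon> :: real assume "\<epsilon> > 0"
    then have "\<epsilon> / (cmod c + 1) > 0" by (simp add: add_nonneg_pos)
    then obtain h where h: "bounded_holo (I2 (I1 (I4 n))) h" "\<forall>x\<in>\<Omega>s n. cmod (F x - h x) * \<nu> n x \<le> \<epsilon> / (cmod c + 1)"
      using F unfolding approximable_def by blast
    have "cmod (c * F x - c * h x) * \<nu> n x \<le> \<epsilon>" if x: "x \<in> \<Omega>s n" for x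
    proof -
      have "cmod (c * F x - c * h x) * \<nu> n x = cmod c * (cmod (F x - h x) * \<nu> n x)"
        by (simp add: right_diff_distrib[symmetric] norm_mult)
      also have "\<dots> \<le> cmod c * (\<epsilon> / (cmod c + 1))" using h(2) x by (intro mult_left_mono) auto
      also have "\<dots> \<le> (cmod c + 1) * (\<epsilon> / (cmod c + 1))" using \<open>\<epsilon> > 0\<close> by (intro mult_right_mono) auto
      also have "\<dots> = \<epsilon>" using norm_ge_zero[of c] by (simp add: add_nonneg_eq_0_iff)
      finally show ?thesis .
    qed
    then show "\<exists>h. bounded_holo (I2 (I1 (I4 n))) h \<and> (\<forall>x\<in>\<Omega>s n. cmod (c * F x - h x) * \<nu> n x \<le> \<epsilon>)"
      using bounded_holo_scale[OF h(1)] by blast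
  qed
  show "approximable n F"
    if lim: "\<And>\<epsilon>. \<epsilon> > 0 \<Longrightarrow> \<exists>G. approximable n G \<and> (\<forall>x\<in>\<Omega>s n. cmod (F x - G x) * \<nu> n x \<le> \<epsilon>)" for F
    unfolding approximable_def
  proof (intro allI impI)
    fix \<epsilon> :: real assume "\<epsilon> > 0"
    then have e: "\<epsilon> / 2 > 0" by simp
    obtain G where G: "approximable n G" "\<forall>x\<in>\<Omega>s n. cmod (F x - G x) * \<nu> n x \<le> \<epsilon> / 2"
      using lim[OF e] by blast
    obtain h where h: "bounded_holo (I2 (I1 (I4 n))) h" "\<forall>x\<in>\<Omega>s n. cmod (G x - h x) * \<nu> n x \<le> \<epsilon> / 2"
      using G(1) e unfolding approximable_def by blast
    have "cmod (F x - h x) * \<nu> n x \<le> \<epsilon>" if x: "x \<in> \<Omega>s n" for x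
      using weighted_triangle[OF x, of "F x" "G x" "\<epsilon> / 2" "h x" "\<epsilon> / 2"] h(2) G(2) x by simp
    then show "\<exists>h. bounded_holo (I2 (I1 (I4 n))) h \<and> (\<forall>x\<in>\<Omega>s n. cmod (F x - h x) * \<nu> n x \<le> \<epsilon>)"
      using h(1) by blast
  qed
qed

text \<open>(a)(iii) controls the kernel only on average over poles. As the kernel is holomorphic in
  the pole away from the closure, the area bound makes this pointwise, with a constant independent
  of \<open>x\<close>. The radius \<open>e / 4\<close> keeps the enlarged disc
  \<open>cball a (2 * \<rho>)\<close> off the closure.\<close>

lemma family_locally_bounded:
  assumes a: "a \<notin> closure (\<Omega>s n)" and nq: "n \<le> q"
  shows "\<exists>\<rho>>0. \<exists>B. ball a \<rho> \<subseteq> - closure (\<Omega>s n) \<and>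
    (\<forall>x\<in>\<Omega>s n. \<forall>y\<in>ball a \<rho>. cmod (g q (x - y) / (x - y)) * \<nu> n x \<le> B)"
proof -
  have "open (- closure (\<Omega>s n))" by auto
  then obtain e where e: "e > 0" "ball a e \<subseteq> - closure (\<Omega>s n)" using a openE by blast
  define \<rho> where "\<rho> = e / 4"
  have r: "\<rho> > 0" unfolding \<rho>_def using e by simp
  obtain M where M: "0 \<le> M" "\<And>h a U. open U \<Longrightarrow> cball a \<rho> \<subseteq> U \<Longrightarrow> h holomorphic_on U \<Longrightarrow>
    ennreal (cmod (h a)) \<le> ennreal M * (\<integral>\<^sup>+ y. ennreal (cmod (h y)) * indicator (cball a \<rho>) y \<partial>lborel)"
    using holomorphic_area_bound[OF r] by metis
  have "\<exists>A3>0. \<forall>x\<in>\<Omega>s q. (\<integral>\<^sup>+ y. ennreal (cmod (g q (x - y)) * \<nu> q x / cmod (x - y)) *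
      indicator (cball a (2 * \<rho>)) y \<partial>lborel) \<le> ennreal A3"
    using spec[OF Da[unfolded condD_a_def], of q, THEN conjunct2, THEN conjunct2, THEN conjunct2,
      THEN conjunct2, THEN conjunct2, THEN conjunct2] compact_cball[of a "2 * \<rho>"] by blast
  then obtain A3 where A3: "A3 > 0" "\<And>x. x \<in> \<Omega>s q \<Longrightarrow> (\<integral>\<^sup>+ y. ennreal (cmod (g q (x - y)) * \<nu> q x / cmod (x - y)) *
      indicator (cball a (2 * \<rho>)) y \<partial>lborel) \<le> ennreal A3" by blast
  have "cmod (g q (x - y) / (x - y)) * \<nu> n x \<le> M * A3" if x: "x \<in> \<Omega>s n" and y: "y \<in> ball a \<rho>" for x y
  proof -
    have xq: "x \<in> \<Omega>s q" using x Omega_mono[OF nq] by blast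
    have px: "0 < \<nu> q x" by (rule nu_pos[OF x])
    define h where "h z = of_real (\<nu> q x) * (g q (x - z) / (x - z))" for z
    have hn: "cmod (h z) = cmod (g q (x - z)) * \<nu> q x / cmod (x - z)" for z
      unfolding h_def using px by (simp add: norm_mult norm_divide)
    have xe: "x \<notin> ball a e" using e(2) x closure_subset by blast
    have hh: "h holomorphic_on ball a e"
    proof -
      have "(\<lambda>z. g q (x - z)) holomorphic_on ball a e"
        by (rule holomorphic_on_compose_gen[OF _ g_holo(1), unfolded comp_def]) (auto intro!: holomorphic_intros)
      then show ?thesis unfolding h_def using xe by (intro holomorphic_intros) auto
    qed
    have s1: "cball y \<rho> \<subseteq> cball a (2 * \<rho>)"
    proof
      fix z assume "z \<in> cball y \<rho>"
      then show "z \<in> cball a (2 * \<rho>)" using y dist_triangle[of a z y] by auto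
    qed
    have s2: "cball a (2 * \<rho>) \<subseteq> ball a e" unfolding \<rho>_def using e(1) by auto
    have "ennreal (cmod (h y)) \<le> ennreal M * (\<integral>\<^sup>+ z. ennreal (cmod (h z)) * indicator (cball y \<rho>) z \<partial>lborel)"
      by (rule M(2)[OF open_ball _ hh]) (use s1 s2 in blast)
    also have "\<dots> \<le> ennreal M * (\<integral>\<^sup>+ z. ennreal (cmod (h z)) * indicator (cball a (2 * \<rho>)) z \<partial>lborel)"
      using s1 by (intro mult_left_mono nn_integral_mono) (auto simp: indicator_def)
    also have "\<dots> \<le> ennreal M * ennreal A3"
      unfolding hn using A3(2)[OF xq] by (rule mult_left_mono) simp
    also have "\<dots> = ennreal (M * A3)" using M(1) A3(1) by (simp add: ennreal_mult)
    finally have "cmod (h y) \<le> M * A3" using M(1) A3(1) by (simp add: ennreal_le_iff)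
    moreover have "cmod (g q (x - y) / (x - y)) * \<nu> n x \<le> cmod (g q (x - y) / (x - y)) * \<nu> q x"
      by (rule mult_left_mono[OF nu_mono[OF x nq]]) simp
    moreover have "cmod (h y) = cmod (g q (x - y) / (x - y)) * \<nu> q x"
      by (simp only: h_def norm_mult norm_of_real abs_of_pos[OF px] mult.commute)
    ultimately show ?thesis by linarith
  qed
  moreover have "ball a \<rho> \<subseteq> - closure (\<Omega>s n)" using e unfolding \<rho>_def by (auto simp: subset_eq)
  ultimately show ?thesis using r by blast
qed

text \<open>(a)(ii) bounds \<open>g q\<close> on a circle around \<open>x - y\<close>; the maximum
  principle carries the bound to the centre, and the denominator is at least the distance
  \<open>e\<close> because \<open>y\<close> lies outside the closure.\<close>

lemma family_in_exterior:
  assumes y: "y \<in> X q"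
  shows "bounded_holo (I2 q) (\<lambda>x. g q (x - y) / (x - y))"
proof -
  let ?t = "I2 q"
  note d = spec[OF Da[unfolded condD_a_def], of q, THEN conjunct2, THEN conjunct2, THEN conjunct2,
      THEN conjunct2, THEN conjunct2, THEN conjunct1, THEN conjunct2]
  have Xs: "X q \<subseteq> - closure (\<Omega>s ?t)" using d[THEN conjunct1] .
  have "0 < 2 * R q" using d[THEN conjunct2, THEN conjunct1] .
  moreover have "R q < r q" using d[THEN conjunct2, THEN conjunct2, THEN conjunct2, THEN conjunct1] .
  ultimately have R: "0 < R q" "R q < r q" by auto
  obtain A2 where A2: "\<forall>z\<in>\<Omega>s ?t. \<forall>x\<in>(\<Union>y\<in>X q. ball y (R q)). \<forall>\<zeta>.
             cmod (\<zeta> - (z - x)) = r q \<longrightarrow> cmod (g q \<zeta>) * \<nu> ?t z \<le> A2 x"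
    by (rule exE[OF d[THEN conjunct2, THEN conjunct2, THEN conjunct2, THEN conjunct2, THEN conjunct2]])
      (erule conjE)+
  have yU: "y \<in> (\<Union>y\<in>X q. ball y (R q))" using y R by (intro UN_I[of y]) auto
  have "y \<in> - closure (\<Omega>s ?t)" "open (- closure (\<Omega>s ?t))" using y Xs by auto
  then obtain e where e: "e > 0" "ball y e \<subseteq> - closure (\<Omega>s ?t)" using openE by blast
  have far: "e \<le> cmod (x - y)" if "x \<in> \<Omega>s ?t" for x
  proof (rule ccontr)
    assume "\<not> e \<le> cmod (x - y)"
    then have "x \<in> ball y e" by (simp add: dist_norm norm_minus_commute)
    then show False using e(2) that closure_subset by blast
  qed
  have "(\<lambda>x. g q (x - y) / (x - y)) holomorphic_on \<Omega>s ?t"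
  proof -
    have "(\<lambda>x. g q (x - y)) holomorphic_on \<Omega>s ?t"
      by (rule holomorphic_on_compose_gen[OF _ g_holo(1), unfolded comp_def]) (auto intro!: holomorphic_intros)
    then show ?thesis using far e(1) by (intro holomorphic_intros) force+
  qed
  moreover have "cmod (g q (x - y) / (x - y)) * \<nu> ?t x \<le> A2 y / e" if x: "x \<in> \<Omega>s ?t" for x
  proof -
    have px: "0 < \<nu> ?t x" by (rule nu_pos[OF x])
    \<comment> \<open>The Cauchy inequality of order 0 is the maximum principle for this
      disc.\<close>
    have "cmod ((deriv ^^ 0) (g q) (x - y)) \<le> fact 0 * (A2 y / \<nu> ?t x) / (r q) ^ 0"
    proof (rule Cauchy_inequality)
      show "g q holomorphic_on ball (x - y) (r q)" by (rule holomorphic_on_subset[OF g_holo(1)]) simp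
      show "continuous_on (cball (x - y) (r q)) (g q)"
        by (rule continuous_on_subset[OF holomorphic_on_imp_continuous_on[OF g_holo(1)]]) simp
      show "0 < r q" using R by simp
      fix \<zeta> assume "cmod (x - y - \<zeta>) = r q"
      then have "cmod (\<zeta> - (x - y)) = r q" by (simp add: norm_minus_commute)
      then have "cmod (g q \<zeta>) * \<nu> ?t x \<le> A2 y" using A2 x yU by blast
      then show "cmod (g q \<zeta>) \<le> A2 y / \<nu> ?t x" using px by (simp add: field_simps)
    qed
    then have b: "cmod (g q (x - y)) * \<nu> ?t x \<le> A2 y" using px by (simp add: field_simps)
    have "cmod (g q (x - y) / (x - y)) * \<nu> ?t x = (cmod (g q (x - y)) * \<nu> ?t x) / cmod (x - y)"
      by (simp add: norm_divide)
    also have "\<dots> \<le> (cmod (g q (x - y)) * \<nu> ?t x) / e"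
      using far[OF x] e(1) px by (intro divide_left_mono mult_pos_pos) (auto intro: less_le_trans)
    also have "\<dots> \<le> A2 y / e" using b e(1) by (intro divide_right_mono) auto
    finally show ?thesis .
  qed
  ultimately show ?thesis unfolding bounded_holo_def by blast
qed

lemma family_holomorphic:
  assumes "x \<in> \<Omega>s n"
  shows "(\<lambda>y. g q (x - y) / (x - y)) holomorphic_on - closure (\<Omega>s n)"
proof -
  have "(\<lambda>y. g q (x - y)) holomorphic_on - closure (\<Omega>s n)"
    by (rule holomorphic_on_compose_gen[OF _ g_holo(1), unfolded comp_def]) (auto intro!: holomorphic_intros)
  then show ?thesis using assms closure_subset[of "\<Omega>s n"] by (intro holomorphic_intros) auto
qed

text \<open>By condition (c) every component of the complement of the closure of \<open>\<Omega>s n\<close> meets the set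
  \<open>X\<close>, where the kernel belongs to the approximating space; analyticity in the pole propagates this
  to the whole component.\<close>

lemma family_approximable:
  assumes y: "y \<notin> closure (\<Omega>s n)"
  shows "approximable n (\<lambda>x. g (I1 (I4 n)) (x - y) / (x - y))"
proof -
  let ?q = "I1 (I4 n)"
  interpret closed_subspace "\<Omega>s n" "\<nu> n" "approximable n" by (rule approximable_closed_subspace)
  define U where "U = connected_component_set (- closure (\<Omega>s n)) y"
  have nq: "n \<le> ?q" using I_gt(1)[of "I4 n"] I_gt(3)[of n] by simp
  have yU: "y \<in> U" unfolding U_def using y by simp
  have Us: "U \<subseteq> - closure (\<Omega>s n)" unfolding U_def by (rule connected_component_subset)
  have Uo: "open U" "connected U" unfolding U_def by (auto intro: open_connected_component)
  have "U \<in> components (- closure (\<Omega>s n))" unfolding U_def components_def using y by auto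
  \<comment> \<open>(c) is used with \<open>M\<close> equal to the closure itself; \<open>y\<close>
    witnesses that the component leaves it.\<close>
  then have ne: "U \<inter> X ?q \<noteq> {}"
    using Dc[unfolded condD_c_def, rule_format, of "closure (\<Omega>s n)" n U] yU Us by blast
  have Xo: "open (X ?q)"
    using spec[OF Da[unfolded condD_a_def], of ?q, THEN conjunct2, THEN conjunct2, THEN conjunct2,
        THEN conjunct2, THEN conjunct2, THEN conjunct1, THEN conjunct1] .
  show ?thesis
  proof (rule family_mem_connected[where \<Phi> = "\<lambda>y x. g ?q (x - y) / (x - y)", OF Uo _ _ Xo _ _ yU])
    show "(\<lambda>y. g ?q (x - y) / (x - y)) holomorphic_on U" if "x \<in> \<Omega>s n" for x
      by (rule holomorphic_on_subset[OF family_holomorphic[OF that] Us])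
    fix a assume a: "a \<in> U"
    then have "a \<notin> closure (\<Omega>s n)" using Us by blast
    from family_locally_bounded[OF this nq] obtain \<rho> B where r: "\<rho> > 0"
      "\<forall>x\<in>\<Omega>s n. \<forall>y\<in>ball a \<rho>. cmod (g ?q (x - y) / (x - y)) * \<nu> n x \<le> B" by blast
    obtain s where s: "s > 0" "ball a s \<subseteq> U" using Uo(1) a openE by blast
    show "\<exists>\<rho>>0. \<exists>B. ball a \<rho> \<subseteq> U \<and> (\<forall>x\<in>\<Omega>s n. \<forall>y\<in>ball a \<rho>. cmod (g ?q (x - y) / (x - y)) * \<nu> n x \<le> B)"
      using r s by (intro exI[of _ "min \<rho> s"] conjI exI[of _ B]) auto
  next
    show "X ?q \<inter> U \<noteq> {}" using ne by blast
    show "approximable n (\<lambda>x. g ?q (x - y) / (x - y))" if "y \<in> X ?q \<inter> U" for y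
      using that by (intro bounded_holo_approximable family_in_exterior) auto
  qed
qed

section \<open>Approximation of weighted holomorphic functions\<close>

text \<open>The Pompeiu formula for \<open>\<psi> * F\<close>, whose support may be unbounded. It
  holds for \<open>\<theta> j * \<psi> * F\<close>; as \<open>j\<close> grows, the terms with
  \<open>dbar (\<theta> j)\<close> vanish pointwise, and a multiple of the kernel times
  \<open>F\<close> dominates.\<close>

lemma cutoff_representation:
  assumes F: "F holomorphic_on \<Omega>s q" and q: "q = I1 (I4 n)"
    and C: "0 \<le> C" "\<And>x. x \<in> \<Omega>s q \<Longrightarrow> cmod (F x) * \<nu> q x \<le> C"
    and \<psi>: "Cinf_on UNIV \<psi>" "\<And>y. cmod (\<psi> y) \<le> 1" "\<And>y. cmod (dbar \<psi> y) \<le> C1"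
      "\<And>y. y \<in> \<Omega>s n \<Longrightarrow> \<psi> y = 1"
      "\<And>y. y \<notin> \<Omega>s (I4 n) \<Longrightarrow> \<exists>V. open V \<and> y \<in> V \<and> (\<forall>z\<in>V. \<psi> z = 0)"
    and x: "x \<in> \<Omega>s n"
  shows "F x = (\<integral>y. ker q x y * (dbar \<psi> y * (indicator (\<Omega>s (I4 n)) y *\<^sub>R F y)) \<partial>lborel)"
proof -
  let ?p = "I4 n"
  define H where "H y = indicator (\<Omega>s ?p) y *\<^sub>R F y" for y
  have pq: "\<Omega>s ?p \<subseteq> \<Omega>s q" using Omega_mono I_gt(1)[of ?p] q by simp
  have xp: "x \<in> \<Omega>s ?p" "x \<in> \<Omega>s q" using x Omega_mono[of n ?p] I_gt(3)[of n] pq by auto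
  have FC: "Cinf_on (\<Omega>s ?p) F"
    by (rule Cinf_on_subset[OF Cinf_on_holomorphic[OF Omega_open(2) F] pq])
  have Fd: "dbar F y = 0" if "y \<in> \<Omega>s ?p" for y
    using dbar_holomorphic[OF Omega_open(2) F] that pq by blast
  have Hm[measurable]: "H \<in> borel_measurable borel" unfolding H_def
    using Omega_open(2) continuous_on_subset[OF holomorphic_on_imp_continuous_on[OF F] pq]
    by (intro borel_measurable_continuous_on_indicator) auto
  obtain A where A: "kernel_bound n A" by (rule kernel_estimate)
  \<comment> \<open>Here the pair with both entries \<open>I1 (I4 n)\<close> enters:
    \<open>F\<close> is bounded in the weight \<open>\<nu> q\<close>, and \<open>x\<close> is
    regarded as a point of \<open>\<Omega>s q\<close>.\<close>
  have Hi: "integrable lborel (\<lambda>y. ker q x y * H y)"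
    unfolding q by (rule kernel_boundD(1)[OF A, of q q x H C]) (use xp q C pq in \<open>auto simp: H_def\<close>)
  obtain \<theta> :: "nat \<Rightarrow> complex \<Rightarrow> complex" and C2 where \<theta>: "0 \<le> C2" "\<And>j. Cinf_on UNIV (\<theta> j)" "\<And>j. csupp (\<theta> j)"
    "\<And>j y. cmod (\<theta> j y) \<le> 1" "\<And>j y. cmod (dbar (\<theta> j) y) \<le> C2"
    "\<And>j y. cmod y + 1 < real j \<Longrightarrow> \<theta> j y = 1" "\<And>j y. cmod y + 1 < real j \<Longrightarrow> dbar (\<theta> j) y = 0"
    by (rule exhausting_cutoffs) blast
  define \<phi> where "\<phi> j y = \<theta> j y * \<psi> y * F y" for j y
  have t\<psi>: "Cinf_on UNIV (\<lambda>z. \<theta> j z * \<psi> z)" for j by (rule Cinf_on_mult[OF open_UNIV \<theta>(2) \<psi>(1)])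
  have test: "test_fun (\<phi> j)" for j unfolding \<phi>_def
  proof (rule test_fun_cutoff[OF t\<psi> _ Omega_open(2) FC])
    show "csupp (\<lambda>z. \<theta> j z * \<psi> z)" by (rule csupp_mult(1)[OF \<theta>(3)])
    fix y assume "y \<notin> \<Omega>s ?p"
    then show "\<exists>V. open V \<and> y \<in> V \<and> (\<forall>z\<in>V. \<theta> j z * \<psi> z = 0)" using \<psi>(5)[of y] by auto
  qed
  have d\<phi>: "dbar (\<phi> j) y = (dbar (\<theta> j) y * \<psi> y + \<theta> j y * dbar \<psi> y) * H y" for j y
  proof (cases "y \<in> \<Omega>s ?p")
    case True
    have "dbar (\<phi> j) y = dbar (\<lambda>z. \<theta> j z * \<psi> z) y * F y + \<theta> j y * \<psi> y * dbar F y"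
      unfolding \<phi>_def by (rule dbar_mult[OF Cinf_on_subset[OF t\<psi>] FC True]) simp
    also have "dbar (\<lambda>z. \<theta> j z * \<psi> z) y = dbar (\<theta> j) y * \<psi> y + \<theta> j y * dbar \<psi> y"
      by (rule dbar_mult[OF \<theta>(2) \<psi>(1)]) simp
    finally show ?thesis using Fd[OF True] True unfolding H_def by simp
  next
    case False
    then obtain V where V: "open V" "y \<in> V" "\<forall>z\<in>V. \<psi> z = 0" using \<psi>(5) by blast
    have "dbar (\<phi> j) y = dbar (\<lambda>_. 0) y"
      by (rule dbar_cong[OF _ V(1,2)]) (use V in \<open>auto simp: \<phi>_def intro!: Cinf_on_holomorphic\<close>)
    then show ?thesis using dbar_holomorphic[of UNIV "\<lambda>_. 0" y] False unfolding H_def by simp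
  qed
  have rep: "\<phi> j x = (\<integral>y. ker q x y * dbar (\<phi> j) y \<partial>lborel)" for j
    using cauchy_op_dbar[OF g_holo test] cauchy_op_ker[OF test_fun_dbar[OF test]] by metis
  have ev: "\<forall>\<^sub>F j in sequentially. cmod y + 1 < real j" for y :: complex
  proof -
    obtain N :: nat where "cmod y + 1 < real N" using reals_Archimedean2 by blast
    then show ?thesis unfolding eventually_sequentially by (intro exI[of _ N]) auto
  qed
  have d\<psi>m[measurable]: "dbar \<psi> \<in> borel_measurable borel"
    by (intro borel_measurable_continuous_onI Cinf_on_imp_continuous Cinf_on_dbar open_UNIV \<psi>(1))
  have "(\<lambda>j. \<integral>y. ker q x y * dbar (\<phi> j) y \<partial>lborel) \<longlonglongrightarrow> (\<integral>y. ker q x y * (dbar \<psi> y * H y) \<partial>lborel)"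
  proof (rule integral_dominated_convergence[where w = "\<lambda>y. (C2 + C1) * cmod (ker q x y * H y)"])
    have [measurable]: "dbar (\<phi> j) \<in> borel_measurable borel" for j
      by (rule borel_measurable_continuous_onI[OF test_funD(1)[OF test_fun_dbar[OF test]]])
    show "(\<lambda>y. ker q x y * dbar (\<phi> j) y) \<in> borel_measurable lborel" for j by measurable
    show "(\<lambda>y. ker q x y * (dbar \<psi> y * H y)) \<in> borel_measurable lborel" by measurable
    show "integrable lborel (\<lambda>y. (C2 + C1) * cmod (ker q x y * H y))"
      by (intro integrable_mult_right integrable_norm Hi)
    have "cmod (ker q x y * dbar (\<phi> j) y) \<le> (C2 + C1) * cmod (ker q x y * H y)" for j y
    proof -
      have "cmod (dbar (\<theta> j) y * \<psi> y) \<le> C2 * 1" unfolding norm_mult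
        by (rule mult_mono[OF \<theta>(5) \<psi>(2) \<theta>(1)]) simp
      moreover have "cmod (\<theta> j y * dbar \<psi> y) \<le> 1 * C1" unfolding norm_mult
        by (rule mult_mono[OF \<theta>(4) \<psi>(3)]) auto
      ultimately have "cmod (dbar (\<theta> j) y * \<psi> y + \<theta> j y * dbar \<psi> y) \<le> C2 + C1"
        using norm_triangle_ineq[of "dbar (\<theta> j) y * \<psi> y" "\<theta> j y * dbar \<psi> y"] by linarith
      from mult_right_mono[OF this norm_ge_zero[of "ker q x y * H y"]]
      show ?thesis unfolding d\<phi> by (simp add: norm_mult mult_ac)
    qed
    then show "AE y in lborel. cmod (ker q x y * dbar (\<phi> j) y) \<le> (C2 + C1) * cmod (ker q x y * H y)" for j
      by simp
    have "(\<lambda>j. dbar (\<phi> j) y) \<longlonglongrightarrow> dbar \<psi> y * H y" for y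
      by (rule tendsto_eventually, rule eventually_mono[OF ev[of y]]) (simp add: d\<phi> \<theta>(6,7))
    then show "AE y in lborel. (\<lambda>j. ker q x y * dbar (\<phi> j) y) \<longlonglongrightarrow> ker q x y * (dbar \<psi> y * H y)"
      by (intro AE_I2 tendsto_mult tendsto_const)
  qed
  moreover have "(\<lambda>j. \<phi> j x) \<longlonglongrightarrow> F x"
    by (rule tendsto_eventually, rule eventually_mono[OF ev[of x]]) (simp add: \<phi>_def \<theta>(6) \<psi>(4)[OF x])
  ultimately show ?thesis unfolding rep H_def using LIMSEQ_unique by blast
qed

theorem holomorphic_approximable:
  assumes F: "F holomorphic_on \<Omega>s (I1 (I4 n))"
    and FC: "\<And>x. x \<in> \<Omega>s (I1 (I4 n)) \<Longrightarrow> cmod (F x) * \<nu> (I1 (I4 n)) x \<le> C"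
  shows "approximable n F"
proof -
  define p where "p = I4 n" define q where "q = I1 p"
  interpret closed_subspace "\<Omega>s n" "\<nu> n" "approximable n" by (rule approximable_closed_subspace)
  define C' where "C' = max C 0"
  have C': "0 \<le> C'" "\<And>x. x \<in> \<Omega>s q \<Longrightarrow> cmod (F x) * \<nu> q x \<le> C'"
    unfolding C'_def q_def p_def using FC by force+
  have lt: "n < p" "p < q" unfolding p_def q_def by (rule I_gt)+
  have pq: "\<Omega>s p \<subseteq> \<Omega>s q" using Omega_mono lt by simp
  have Fq: "F holomorphic_on \<Omega>s q" using F unfolding p_def q_def .
  obtain \<eta> C1 \<psi> where \<eta>: "\<eta> > 0" and C1: "0 \<le> C1" and \<psi>: "Cinf_on UNIV \<psi>" "\<And>y. cmod (\<psi> y) \<le> 1"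
    "\<And>y. cmod (dbar \<psi> y) \<le> C1" "\<And>x y. x \<in> \<Omega>s n \<Longrightarrow> y \<in> ball x \<eta> \<Longrightarrow> \<psi> y = 1"
    "\<And>x y. x \<in> \<Omega>s n \<Longrightarrow> y \<in> ball x \<eta> \<Longrightarrow> dbar \<psi> y = 0"
    "\<And>y. y \<notin> \<Omega>s p \<Longrightarrow> \<exists>V. open V \<and> y \<in> V \<and> (\<forall>z\<in>V. \<psi> z = 0)"
    by (rule nested_cutoff[OF lt(1)]) blast
  define G where "G y = dbar \<psi> y * (indicator (\<Omega>s p) y *\<^sub>R F y)" for y
  have rep: "F x = (\<integral>y. ker q x y * G y \<partial>lborel)" if "x \<in> \<Omega>s n" for x
    unfolding G_def p_def
    by (rule cutoff_representation[OF Fq _ C' \<psi>(1-3) _ _ that])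
      (use \<psi>(4) \<eta> \<psi>(6) in \<open>auto simp: q_def p_def\<close>)
  have [measurable]: "dbar \<psi> \<in> borel_measurable borel"
    by (intro borel_measurable_continuous_onI Cinf_on_imp_continuous Cinf_on_dbar open_UNIV \<psi>(1))
  have [measurable]: "(\<lambda>y. indicator (\<Omega>s p) y *\<^sub>R F y) \<in> borel_measurable borel"
    using Omega_open(2) continuous_on_subset[OF holomorphic_on_imp_continuous_on[OF Fq] pq]
    by (intro borel_measurable_continuous_on_indicator) auto
  have Gm[measurable]: "G \<in> borel_measurable borel" unfolding G_def by measurable
  have G0: "G y = 0" if "y \<notin> \<Omega>s p" for y using that unfolding G_def by simp
  have Gn: "cmod (G y) \<le> C1 * cmod (F y)" for y
    using mult_right_mono[OF \<psi>(3)[of y] norm_ge_zero[of "F y"]] C1 unfolding G_def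
    by (cases "y \<in> \<Omega>s p") (auto simp: norm_mult)
  obtain A where A: "0 \<le> A" "kernel_bound n A" by (rule kernel_estimate)
  note kb = kernel_boundD[OF A(2), folded p_def, folded q_def]
  show ?thesis
  proof (rule P_lim)
    fix \<epsilon> :: real assume e: "\<epsilon> > 0"
    \<comment> \<open>Makes the bound \<open>A * (C1 * C' * \<delta>)\<close> for the part off
      \<open>K\<close> at most \<epsilon>; the added 1 keeps the denominator positive.\<close>
    define \<delta> where "\<delta> = \<epsilon> / (A * (C1 * C') + 1)"
    have AC: "0 \<le> A * (C1 * C')" using A(1) C1 C'(1) by simp
    have d: "\<delta> > 0" unfolding \<delta>_def using e AC by simp
    have "\<forall>\<epsilon>>0. \<exists>K. compact K \<and> K \<subseteq> closure (\<Omega>s p) \<and> (\<forall>x\<in>\<Omega>s p - K. \<nu> p x \<le> \<epsilon> * \<nu> (I1 p) x)"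
      using spec[OF Da[unfolded condD_a_def], of p, THEN conjunct2, THEN conjunct2, THEN conjunct2,
        THEN conjunct2, THEN conjunct1] .
    from mp[OF spec[OF this] d] obtain K where "compact K \<and> K \<subseteq> closure (\<Omega>s p) \<and>
        (\<forall>x\<in>\<Omega>s p - K. \<nu> p x \<le> \<delta> * \<nu> q x)" unfolding q_def ..
    then have K: "compact K" "K \<subseteq> closure (\<Omega>s p)" "\<And>x. x \<in> \<Omega>s p - K \<Longrightarrow> \<nu> p x \<le> \<delta> * \<nu> q x" by auto
    have Kq: "K \<subseteq> \<Omega>s q" using K(2) closure_sub[OF lt(2)] by blast
    have Kb: "K \<in> sets borel" using K(1) by (simp add: compact_imp_closed)
    \<comment> \<open>\<open>G\<close> is split along \<open>K\<close>. Off \<open>K\<close> the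
      weight \<open>\<nu> p\<close> is at most \<delta> times \<open>\<nu> q\<close>, so the pair
      \<open>(p, n)\<close> makes the potential of \<open>T\<close> small on
      \<open>\<Omega>s n\<close>. The part on \<open>K\<close> becomes the integrable density
      \<open>a\<close> against the family of kernels.\<close>
    define T where "T y = indicator (- K) y *\<^sub>R G y" for y
    define a where "a y = indicator K y *\<^sub>R G y / of_real pompeiu_const" for y
    have Tm: "T \<in> borel_measurable borel" unfolding T_def using Kb
      by (intro borel_measurable_scaleR borel_measurable_indicator) auto
    have am: "a \<in> borel_measurable borel" unfolding a_def using Kb
      by (intro borel_measurable_divide borel_measurable_scaleR borel_measurable_indicator) auto
    have TC: "cmod (T y) * \<nu> p y \<le> C1 * C' * \<delta>" if y: "y \<in> \<Omega>s p" for y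
    proof (cases "y \<in> K")
      case False
      have yq: "y \<in> \<Omega>s q" using y pq by blast
      have "cmod (T y) * \<nu> p y \<le> (C1 * cmod (F y)) * (\<delta> * \<nu> q y)"
      proof (rule mult_mono)
        show "cmod (T y) \<le> C1 * cmod (F y)" unfolding T_def using Gn[of y] False by simp
        show "\<nu> p y \<le> \<delta> * \<nu> q y" by (rule K(3)) (use y False in blast)
      qed (use C1 nu_pos[OF y, of p] in auto)
      also have "\<dots> = C1 * (cmod (F y) * \<nu> q y) * \<delta>" by simp
      also have "\<dots> \<le> C1 * C' * \<delta>" using C'(2)[OF yq] C1 d by (intro mult_right_mono mult_left_mono) auto
      finally show ?thesis .
    qed (use C1 C'(1) d in \<open>simp add: T_def\<close>)
    have T0: "T y = 0" if "y \<notin> \<Omega>s p" for y unfolding T_def using G0[OF that] by simp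
    have Cd: "0 \<le> C1 * C' * \<delta>" using C1 C'(1) d by simp
    have T: "integrable lborel (\<lambda>y. ker q x y * T y)"
      "cmod (\<integral>y. ker q x y * T y \<partial>lborel) * \<nu> n x \<le> A * (C1 * C' * \<delta>)" if x: "x \<in> \<Omega>s n" for x
      using kb[OF _ x Tm Cd TC T0] by auto
    have Gi: "integrable lborel (\<lambda>y. ker q x y * G y)" if x: "x \<in> \<Omega>s n" for x
    proof (rule kb(1)[of q q x G "C1 * C'"])
      show "x \<in> \<Omega>s q" using x Omega_mono[of n q] lt by auto
      show "cmod (G y) * \<nu> q y \<le> C1 * C'" if "y \<in> \<Omega>s p" for y
      proof -
        have "cmod (G y) * \<nu> q y \<le> C1 * cmod (F y) * \<nu> q y"
          using Gn[of y] nu_pos[OF that, of q] by (intro mult_right_mono) auto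
        also have "\<dots> \<le> C1 * C'" using mult_left_mono[OF C'(2)[of y] C1] that pq by (auto simp: mult.assoc)
        finally show ?thesis .
      qed
    qed (use G0 Gm C1 C'(1) in auto)
    define \<Phi> where "\<Phi> y x = g q (x - y) / (x - y)" for y x
    have split: "ker q x y * G y = a y * \<Phi> y x + ker q x y * T y" for x y
      unfolding a_def T_def \<Phi>_def ker_def by (cases "y \<in> K") auto
    have ai: "integrable lborel (\<lambda>y. a y * \<Phi> y x)" if "x \<in> \<Omega>s n" for x
    proof -
      have "a y * \<Phi> y x = ker q x y * G y - ker q x y * T y" for y using split[of x y] by simp
      then show ?thesis using Bochner_Integration.integrable_diff[OF Gi[OF that] T(1)[OF that]] by simp
    qed
    \<comment> \<open>\<open>dbar \<psi>\<close> vanishes on this open set, which contains the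
      closure of \<open>\<Omega>s n\<close>. Removing it from \<open>K\<close> leaves a compact set
      of poles off the closure, where kernels are known to be approximable.\<close>
    define O' where "O' = (\<Union>x\<in>\<Omega>s n. ball x \<eta>)"
    have Oo: "open O'" unfolding O'_def by auto
    have Ocl: "closure (\<Omega>s n) \<subseteq> O'"
    proof
      fix y assume "y \<in> closure (\<Omega>s n)"
      then obtain x where "x \<in> \<Omega>s n" "dist x y < \<eta>" using \<eta> unfolding closure_approachable by blast
      then show "y \<in> O'" unfolding O'_def by auto
    qed
    define L where "L = K - O'"
    have Lc: "compact L" unfolding L_def by (rule compact_diff[OF K(1) Oo])
    have Lcl: "y \<notin> closure (\<Omega>s n)" if "y \<in> L" for y using that Ocl unfolding L_def by blast
    have a0: "a y = 0" if yL: "y \<notin> L" for y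
    proof (cases "y \<in> K")
      case True
      then obtain x where "x \<in> \<Omega>s n" "y \<in> ball x \<eta>" using yL unfolding L_def O'_def by blast
      then show ?thesis unfolding a_def G_def using \<psi>(5) by simp
    qed (simp add: a_def)
    have aint: "integrable lborel a"
    proof -
      have "compact (F ` K)"
        by (rule compact_continuous_image[OF continuous_on_subset[OF holomorphic_on_imp_continuous_on[OF Fq] Kq] K(1)])
      then have "bounded (F ` K)" by (rule compact_imp_bounded)
      then obtain B where B: "\<And>y. y \<in> K \<Longrightarrow> cmod (F y) \<le> B" unfolding bounded_iff by blast
      show ?thesis
      proof (rule Bochner_Integration.integrable_bound[where f = "\<lambda>y. (C1 * B / pompeiu_const) * indicator K y :: real"])
        show "integrable lborel (\<lambda>y. (C1 * B / pompeiu_const) * indicator K y :: real)"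
          using emeasure_bounded_finite[OF compact_imp_bounded[OF K(1)]] Kb
          by (intro integrable_mult_right integrable_real_indicator) (auto simp: infinity_ennreal_def)
        show "a \<in> borel_measurable lborel" using am by simp
        have "cmod (a y) \<le> norm ((C1 * B / pompeiu_const) * indicator K y :: real)" for y
        proof (cases "y \<in> K")
          case True
          have "cmod (G y) \<le> C1 * B" using Gn[of y] mult_left_mono[OF B[OF True] C1] by simp
          then have "cmod (a y) \<le> C1 * B / pompeiu_const"
            unfolding a_def using True pompeiu_const_pos by (simp add: norm_divide divide_right_mono)
          from order_trans[OF this abs_ge_self] show ?thesis using True by simp
        qed (simp add: a_def)
        then show "AE y in lborel. cmod (a y) \<le> norm ((C1 * B / pompeiu_const) * indicator K y :: real)" by simp
      qed
    qed
    have "approximable n (\<lambda>x. \<integral>y. a y * \<Phi> y x \<partial>lborel)"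
    proof (rule family_integral_mem[OF Lc aint a0 _ ai])
      show "approximable n (\<Phi> y)" if "y \<in> L" for y
        using family_approximable[OF Lcl[OF that]] unfolding \<Phi>_def q_def p_def .
      fix b \<epsilon>' :: real and c assume c: "c \<in> L" and e': "\<epsilon>' > 0"
      obtain \<rho> B where r: "\<rho> > 0" "ball c \<rho> \<subseteq> - closure (\<Omega>s n)"
        "\<forall>x\<in>\<Omega>s n. \<forall>y\<in>ball c \<rho>. cmod (\<Phi> y x) * \<nu> n x \<le> B"
        using family_locally_bounded[OF Lcl[OF c], of q] lt unfolding \<Phi>_def by auto
      have hol: "(\<lambda>y. \<Phi> y x) holomorphic_on ball c \<rho>" if "x \<in> \<Omega>s n" for x
        unfolding \<Phi>_def by (rule holomorphic_on_subset[OF family_holomorphic[OF that] r(2)])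
      obtain d' where "d' > 0" "\<And>x y. x \<in> \<Omega>s n \<Longrightarrow> y \<in> ball c d' \<Longrightarrow> cmod (\<Phi> y x - \<Phi> c x) * \<nu> n x \<le> \<epsilon>'"
        by (rule family_continuous[where \<Phi> = \<Phi> and a = c, OF r(1) hol _ e', of B]) (use r(3) in blast)+
      then show "\<exists>\<delta>>0. \<forall>x\<in>\<Omega>s n. \<forall>y\<in>ball c \<delta>. cmod (\<Phi> y x - \<Phi> c x) * \<nu> n x \<le> \<epsilon>'" by blast
    qed
    moreover have "cmod (F x - (\<integral>y. a y * \<Phi> y x \<partial>lborel)) * \<nu> n x \<le> \<epsilon>" if x: "x \<in> \<Omega>s n" for x
    proof -
      have "F x = (\<integral>y. a y * \<Phi> y x \<partial>lborel) + (\<integral>y. ker q x y * T y \<partial>lborel)"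
        unfolding rep[OF x] split using ai[OF x] T(1)[OF x] by (rule Bochner_Integration.integral_add)
      then have "cmod (F x - (\<integral>y. a y * \<Phi> y x \<partial>lborel)) * \<nu> n x \<le> A * (C1 * C' * \<delta>)"
        using T(2)[OF x] by simp
      also have "\<dots> \<le> (A * (C1 * C') + 1) * \<delta>" using d by (simp add: algebra_simps)
      also have "\<dots> = \<epsilon>" unfolding \<delta>_def using AC by simp
      finally show ?thesis .
    qed
    ultimately show "\<exists>G. approximable n G \<and> (\<forall>x\<in>\<Omega>s n. cmod (F x - G x) * \<nu> n x \<le> \<epsilon>)" by blast
  qed
qed

section \<open>The Mittag-Leffler construction\<close>

definition weight_bounded :: "(complex \<Rightarrow> complex) \<Rightarrow> bool" where
  "weight_bounded f \<longleftrightarrow> (\<forall>n. \<exists>C. \<forall>x\<in>\<Omega>s n. cmod (f x) * \<nu> n x \<le> C)"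

text \<open>The construction carries a stronger invariant \<open>S\<close>: the n-th function solves
  the equation with bounds on \<open>\<Omega>s (I1 (I4 n))\<close>, because only there can its
  difference from a later solution be approximated. The stated properties are restrictions to
  \<open>\<Omega>s n\<close>.\<close>

lemma solution_sequence:
  assumes f: "Cinf_on \<Omega> f" "weight_bounded f"
  obtains v :: "nat \<Rightarrow> complex \<Rightarrow> complex" where
    "\<And>n. Cinf_on (\<Omega>s n) (v n)" "\<And>n x. x \<in> \<Omega>s n \<Longrightarrow> dbar (v n) x = f x"
    "\<And>n. \<exists>C. \<forall>x\<in>\<Omega>s n. cmod (v n x) * \<nu> n x \<le> C"
    "\<And>n x. x \<in> \<Omega>s n \<Longrightarrow> cmod (v (Suc n) x - v n x) * \<nu> n x \<le> (1 / 2) ^ n"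
proof -
  define a where "a n = I1 (I4 n)" for n
  define S where "S n v \<longleftrightarrow> Cinf_on (\<Omega>s (a n)) v \<and> (\<forall>x\<in>\<Omega>s (a n). dbar v x = f x) \<and>
    (\<exists>C. \<forall>x\<in>\<Omega>s (a n). cmod (v x) * \<nu> (a n) x \<le> C)" for n v
  have local: "\<exists>u. Cinf_on (\<Omega>s m) u \<and> (\<forall>x\<in>\<Omega>s m. dbar u x = f x) \<and>
    (\<exists>C. \<forall>x\<in>\<Omega>s m. cmod (u x) * \<nu> m x \<le> C)" for m
    by (rule local_solution[OF f(1), of m]) (use f(2) in \<open>auto simp: weight_bounded_def\<close>)
  have "\<exists>v. \<forall>n. S n (v n) \<and> (\<forall>x\<in>\<Omega>s n. cmod (v (Suc n) x - v n x) * \<nu> n x \<le> (1 / 2) ^ n)"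
  proof (rule dependent_nat_choice)
    show "\<exists>v. S 0 v" unfolding S_def by (rule local)
    fix v n assume v: "S n v"
    \<comment> \<open>No order between \<open>a n\<close> and \<open>a (Suc n)\<close> is at hand,
      so the fresh solution \<open>u\<close> is taken on the larger set.\<close>
    define m where "m = max (a n) (a (Suc n))"
    have sub: "\<Omega>s (a n) \<subseteq> \<Omega>s m" "\<Omega>s (a (Suc n)) \<subseteq> \<Omega>s m"
      "\<Omega>s (a (Suc n)) \<subseteq> \<Omega>s (I2 (a n))" "\<Omega>s n \<subseteq> \<Omega>s (a n)"
      using I2_ge[of n] I_gt(1)[of "I4 n"] I_gt(3)[of n] unfolding a_def m_def by (auto intro!: Omega_mono)
    obtain u C where u: "Cinf_on (\<Omega>s m) u" "\<forall>x\<in>\<Omega>s m. dbar u x = f x" "\<forall>x\<in>\<Omega>s m. cmod (u x) * \<nu> m x \<le> C"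
      using local[of m] by blast
    obtain D where D: "\<forall>x\<in>\<Omega>s (a n). cmod (v x) * \<nu> (a n) x \<le> D" using v unfolding S_def by blast
    have uC: "Cinf_on (\<Omega>s (a n)) u" by (rule Cinf_on_subset[OF u(1) sub(1)])
    have vC: "Cinf_on (\<Omega>s (a n)) v" using v unfolding S_def by blast
    have "(\<lambda>x. v x - u x) holomorphic_on \<Omega>s (a n)"
    proof (rule holomorphic_on_dbar_zero[OF Omega_open(2) Cinf_on_diff[OF Omega_open(2) vC uC]])
      fix x assume "x \<in> \<Omega>s (a n)"
      then show "dbar (\<lambda>x. v x - u x) x = 0"
        using dbar_diff[OF vC uC] v u(2) sub(1) unfolding S_def by auto
    qed
    moreover have "cmod (v x - u x) * \<nu> (a n) x \<le> D + C" if x: "x \<in> \<Omega>s (a n)" for x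
    proof (rule weighted_triangle[OF x, of _ 0, simplified])
      show "cmod (v x) * \<nu> (a n) x \<le> D" using D x by blast
      have "cmod (u x) * \<nu> (a n) x \<le> cmod (u x) * \<nu> m x"
        by (rule mult_left_mono[OF nu_mono[OF x]]) (auto simp: m_def)
      also have "\<dots> \<le> C" using u(3) x sub(1) by blast
      finally show "cmod (u x) * \<nu> (a n) x \<le> C" .
    qed
    ultimately have "approximable n (\<lambda>x. v x - u x)"
      unfolding a_def by (rule holomorphic_approximable)
    then obtain h where h: "bounded_holo (I2 (a n)) h" "\<forall>x\<in>\<Omega>s n. cmod (v x - u x - h x) * \<nu> n x \<le> (1 / 2) ^ n"
      unfolding approximable_def a_def by (meson half_gt_zero zero_less_one zero_less_power)
    obtain B where B: "\<forall>x\<in>\<Omega>s (I2 (a n)). cmod (h x) * \<nu> (I2 (a n)) x \<le> B"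
      using h(1) unfolding bounded_holo_def by blast
    have hh: "h holomorphic_on \<Omega>s (a (Suc n))"
      using h(1) holomorphic_on_subset sub(3) unfolding bounded_holo_def by blast
    \<comment> \<open>On \<open>\<Omega>s n\<close>, \<open>v' - v\<close> is minus the
      approximation error \<open>v - u - h\<close>, while on the next set \<open>h\<close> is
      holomorphic and does not disturb the equation for \<open>u\<close>.\<close>
    define v' where "v' x = u x + h x" for x
    have uS: "Cinf_on (\<Omega>s (a (Suc n))) u" by (rule Cinf_on_subset[OF u(1) sub(2)])
    note hS = Cinf_on_holomorphic[OF Omega_open(2) hh]
    have "S (Suc n) v'"
      unfolding S_def
    proof (intro conjI ballI exI)
      show "Cinf_on (\<Omega>s (a (Suc n))) v'" unfolding v'_def by (rule Cinf_on_add[OF Omega_open(2) uS hS])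
      show "dbar v' x = f x" if x: "x \<in> \<Omega>s (a (Suc n))" for x
        using dbar_add[OF uS hS x] dbar_holomorphic[OF Omega_open(2) hh x] u(2) x sub(2)
        unfolding v'_def by auto
      show "cmod (v' x) * \<nu> (a (Suc n)) x \<le> C + B" if x: "x \<in> \<Omega>s (a (Suc n))" for x
      proof -
        have "cmod (u x) * \<nu> (a (Suc n)) x \<le> cmod (u x) * \<nu> m x"
          by (rule mult_left_mono[OF nu_mono[OF x]]) (auto simp: m_def)
        also have "\<dots> \<le> C" using u(3) x sub(2) by blast
        finally have 1: "cmod (u x) * \<nu> (a (Suc n)) x \<le> C" .
        have "cmod (h x) * \<nu> (a (Suc n)) x \<le> cmod (h x) * \<nu> (I2 (a n)) x"
          by (rule mult_left_mono[OF nu_mono[OF x]]) (use I2_ge in \<open>auto simp: a_def\<close>)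
        also have "\<dots> \<le> B" using B x sub(3) by blast
        finally have 2: "cmod (h x) * \<nu> (a (Suc n)) x \<le> B" .
        show ?thesis
          using mult_right_mono[OF norm_triangle_ineq[of "u x" "h x"], of "\<nu> (a (Suc n)) x"]
            1 2 nu_pos[OF x, of "a (Suc n)"] unfolding v'_def by (simp add: distrib_right)
      qed
    qed
    moreover have "cmod (v' x - v x) * \<nu> n x \<le> (1 / 2) ^ n" if "x \<in> \<Omega>s n" for x
    proof -
      have "cmod (v' x - v x) = cmod (v x - u x - h x)"
        unfolding v'_def by (metis diff_diff_eq norm_minus_commute)
      then show ?thesis using h(2) that by simp
    qed
    ultimately show "\<exists>v'. S (Suc n) v' \<and> (\<forall>x\<in>\<Omega>s n. cmod (v' x - v x) * \<nu> n x \<le> (1 / 2) ^ n)" by blast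
  qed
  then obtain v where v: "\<And>n. S n (v n)"
    "\<And>n x. x \<in> \<Omega>s n \<Longrightarrow> cmod (v (Suc n) x - v n x) * \<nu> n x \<le> (1 / 2) ^ n" by blast
  have na: "n \<le> a n" for n using I_gt(1)[of "I4 n"] I_gt(3)[of n] unfolding a_def by simp
  show ?thesis
  proof (rule that[of v])
    show "Cinf_on (\<Omega>s n) (v n)" for n
      using v(1)[of n] Cinf_on_subset[OF _ Omega_mono[OF na]] unfolding S_def by blast
    show "dbar (v n) x = f x" if "x \<in> \<Omega>s n" for n x
      using v(1)[of n] that Omega_mono[OF na[of n]] unfolding S_def by blast
    show "\<exists>C. \<forall>x\<in>\<Omega>s n. cmod (v n x) * \<nu> n x \<le> C" for n
    proof -
      obtain C where C: "\<forall>x\<in>\<Omega>s (a n). cmod (v n x) * \<nu> (a n) x \<le> C" using v(1)[of n] unfolding S_def by blast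
      have "cmod (v n x) * \<nu> n x \<le> C" if x: "x \<in> \<Omega>s n" for x
      proof -
        have "cmod (v n x) * \<nu> n x \<le> cmod (v n x) * \<nu> (a n) x"
          by (rule mult_left_mono[OF nu_mono[OF x na]]) simp
        also have "\<dots> \<le> C" using C x Omega_mono[OF na[of n]] by blast
        finally show ?thesis .
      qed
      then show ?thesis by blast
    qed
  qed (rule v(2))
qed

lemma global_solution:
  assumes f: "Cinf_on \<Omega> f" "weight_bounded f"
  obtains u where "Cinf_on \<Omega> u" "\<And>x. x \<in> \<Omega> \<Longrightarrow> dbar u x = f x" "weight_bounded u"
proof -
  obtain v :: "nat \<Rightarrow> complex \<Rightarrow> complex" where v:
    "\<And>n. Cinf_on (\<Omega>s n) (v n)" "\<And>n x. x \<in> \<Omega>s n \<Longrightarrow> dbar (v n) x = f x"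
    "\<And>n. \<exists>C. \<forall>x\<in>\<Omega>s n. cmod (v n x) * \<nu> n x \<le> C"
    "\<And>n x. x \<in> \<Omega>s n \<Longrightarrow> cmod (v (Suc n) x - v n x) * \<nu> n x \<le> (1 / 2) ^ n"
    by (rule solution_sequence[OF f]) blast
  \<comment> \<open>The weights increase with the index, so at a point of \<open>\<Omega>s n\<close>
    all later differences can be measured with the one weight \<open>\<nu> n\<close> and form a
    geometric series.\<close>
  have step: "cmod (v (Suc (k + n)) x - v (k + n) x) \<le> (1 / 2) ^ k / \<nu> n x" if x: "x \<in> \<Omega>s n" for x n k
  proof -
    have xk: "x \<in> \<Omega>s (k + n)" using x Omega_mono[of n "k + n"] by auto
    have "cmod (v (Suc (k + n)) x - v (k + n) x) * \<nu> n x \<le> cmod (v (Suc (k + n)) x - v (k + n) x) * \<nu> (k + n) x"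
      by (rule mult_left_mono[OF nu_mono[OF x]]) auto
    also have "\<dots> \<le> (1 / 2) ^ (k + n)" by (rule v(4)[OF xk])
    also have "\<dots> \<le> (1 / 2) ^ k" by (rule power_decreasing) auto
    finally show ?thesis using nu_pos[OF x, of n] by (simp add: field_simps)
  qed
  have geo: "(\<lambda>k. (1 / 2) ^ k / \<nu> n x) sums (2 / \<nu> n x)" for n x
    using sums_divide[OF geometric_sums[of "1 / 2 :: real"], of "\<nu> n x"] by simp
  have tel: "v (j + n) x = v n x + (\<Sum>k<j. v (Suc (k + n)) x - v (k + n) x)" for j n x
    using sum_lessThan_telescope[of "\<lambda>k. v (k + n) x" j] by simp
  have bd: "cmod (v (j + n) x - v n x) \<le> 2 / \<nu> n x" if x: "x \<in> \<Omega>s n" for j n x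
  proof -
    have "cmod (v (j + n) x - v n x) \<le> (\<Sum>k<j. (1 / 2) ^ k / \<nu> n x)"
      unfolding tel[of j n x] using norm_sum[of "\<lambda>k. v (Suc (k + n)) x - v (k + n) x" "{..<j}"]
        sum_mono[of "{..<j}" "\<lambda>k. cmod (v (Suc (k + n)) x - v (k + n) x)", OF step[OF x]] by simp
    also have "\<dots> \<le> (\<Sum>k. (1 / 2) ^ k / \<nu> n x)"
      using nu_pos[OF x, of n] by (intro sum_le_suminf sums_summable[OF geo]) auto
    also have "\<dots> = 2 / \<nu> n x" using sums_unique[OF geo] by simp
    finally show ?thesis .
  qed
  define u where "u x = lim (\<lambda>k. v k x)" for x
  have conv: "(\<lambda>j. v (j + n) x) \<longlonglongrightarrow> u x" if x: "x \<in> \<Omega>s n" for n x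
  proof -
    have "summable (\<lambda>k. v (Suc (k + n)) x - v (k + n) x)"
      by (rule summable_comparison_test'[OF sums_summable[OF geo, of n x], of 0]) (use step[OF x] in auto)
    then have "(\<lambda>j. v n x + (\<Sum>k<j. v (Suc (k + n)) x - v (k + n) x)) \<longlonglongrightarrow>
        v n x + (\<Sum>k. v (Suc (k + n)) x - v (k + n) x)"
      by (intro tendsto_add tendsto_const summable_LIMSEQ)
    then have "(\<lambda>j. v (j + n) x) \<longlonglongrightarrow> v n x + (\<Sum>k. v (Suc (k + n)) x - v (k + n) x)"
      unfolding tel[symmetric] .
    from LIMSEQ_offset[OF this] have "convergent (\<lambda>k. v k x)" unfolding convergent_def by blast
    then have "(\<lambda>k. v k x) \<longlonglongrightarrow> u x" unfolding u_def by (simp add: convergent_LIMSEQ_iff)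
    then show ?thesis by (rule LIMSEQ_ignore_initial_segment)
  qed
  \<comment> \<open>From index \<open>n\<close> on all terms solve the equation on
    \<open>\<Omega>s n\<close>, and the telescoped bound \<open>bd\<close> is uniform in
    \<open>j\<close>.\<close>
  have sol: "Cinf_on (\<Omega>s n) u \<and> (\<forall>y\<in>\<Omega>s n. dbar u y = f y)" for n
  proof (rule solution_limit[where u = "\<lambda>j. v (j + n)"])
    show "open (\<Omega>s n)" by (rule Omega_open)
    show "Cinf_on (\<Omega>s n) (v (j + n))" for j by (rule Cinf_on_subset[OF v(1) Omega_mono]) simp
    show "(\<lambda>j. v (j + n) y) \<longlonglongrightarrow> u y" if "y \<in> \<Omega>s n" for y by (rule conv[OF that])
    fix x assume x: "x \<in> \<Omega>s n"
    obtain C where C: "\<And>x. x \<in> \<Omega>s n \<Longrightarrow> cmod (v n x) * \<nu> n x \<le> C" using v(3) by blast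
    obtain s \<beta> where s: "s > 0" "\<beta> > 0" "ball x s \<subseteq> \<Omega>s n" "\<And>y. y \<in> ball x s \<Longrightarrow> \<beta> \<le> \<nu> n y"
      by (rule nu_lower[OF x, of n]) blast
    have "dbar (v (j + n)) y = f y \<and> cmod (v (j + n) y) \<le> (C + 2) / \<beta>" if y: "y \<in> ball x s" for j y
    proof
      have yn: "y \<in> \<Omega>s n" using y s(3) by blast
      then show "dbar (v (j + n)) y = f y" using v(2) Omega_mono[of n "j + n"] by auto
      have py: "0 < \<nu> n y" by (rule nu_pos[OF yn])
      have "cmod (v (j + n) y) \<le> cmod (v n y) + cmod (v (j + n) y - v n y)"
        using norm_triangle_ineq[of "v n y" "v (j + n) y - v n y"] by simp
      also have "\<dots> \<le> C / \<nu> n y + 2 / \<nu> n y"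
        using C[OF yn] bd[OF yn, of j] py by (intro add_mono) (auto simp: field_simps)
      also have "\<dots> = (C + 2) / \<nu> n y" by (simp add: add_divide_distrib)
      also have "\<dots> \<le> (C + 2) / \<beta>"
      proof (rule divide_left_mono[OF s(4)[OF y]])
        have "0 \<le> cmod (v n y) * \<nu> n y" using py by simp
        then show "0 \<le> C + 2" using C[OF yn] by linarith
      qed (use s(2) py in simp)
      finally show "cmod (v (j + n) y) \<le> (C + 2) / \<beta>" .
    qed
    then show "\<exists>r>0. \<exists>N B. ball x r \<subseteq> \<Omega>s n \<and>
        (\<forall>j\<ge>N. \<forall>y\<in>ball x r. dbar (v (j + n)) y = f y \<and> cmod (v (j + n) y) \<le> B)"
      using s(1,3) by blast
  qed
  have wb: "\<exists>C. \<forall>x\<in>\<Omega>s n. cmod (u x) * \<nu> n x \<le> C" for n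
  proof -
    obtain C where C: "\<And>x. x \<in> \<Omega>s n \<Longrightarrow> cmod (v n x) * \<nu> n x \<le> C" using v(3) by blast
    have "cmod (u x) * \<nu> n x \<le> C + 2" if x: "x \<in> \<Omega>s n" for x
    proof -
      have px: "0 < \<nu> n x" by (rule nu_pos[OF x])
      have "(\<lambda>j. cmod (v (j + n) x - v n x)) \<longlonglongrightarrow> cmod (u x - v n x)"
        by (intro tendsto_norm tendsto_diff conv[OF x] tendsto_const)
      then have "cmod (u x - v n x) \<le> 2 / \<nu> n x"
        by (rule LIMSEQ_le_const2) (use bd[OF x] in auto)
      then have "cmod (u x - v n x) * \<nu> n x \<le> 2" using px by (simp add: field_simps)
      from weighted_triangle[OF x this, of 0 C] C[OF x] show ?thesis by simp
    qed
    then show ?thesis by blast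
  qed
  show ?thesis
  proof (rule that)
    show "Cinf_on \<Omega> u"
    proof (rule Cinf_on_local)
      fix x assume "x \<in> \<Omega>"
      then obtain n where "x \<in> \<Omega>s n" using Omega_cover by blast
      then show "\<exists>V. open V \<and> x \<in> V \<and> Cinf_on V u"
        using sol[of n] Omega_open(2)[of n] by (intro exI[of _ "\<Omega>s n"]) auto
    qed
    show "dbar u x = f x" if "x \<in> \<Omega>" for x using sol Omega_cover[OF that] by blast
    show "weight_bounded u" unfolding weight_bounded_def using wb by blast
  qed
qed

section \<open>Weighted bounds for derivatives and surjectivity\<close>

text \<open>Condition W offers on each \<open>\<Omega>s n\<close> one radius and a comparison of
  \<open>\<nu> n x\<close> with \<open>\<nu> J1\<close> on the whole ball around \<open>x\<close>.
  The constant of the interior estimate depends on the radius alone, so bounds for \<open>u\<close>,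
  \<open>f\<close> and the derivative of \<open>f\<close> at a higher index give a bound for the
  derivative of \<open>u\<close>. The second conclusion lets this be iterated.\<close>

lemma weight_bounded_partial_dir:
  assumes u: "Cinf_on \<Omega> u" and f: "Cinf_on \<Omega> f" and du: "\<And>x. x \<in> \<Omega> \<Longrightarrow> dbar u x = f x" and e: "e \<in> {1, \<i>}"
    and bu: "weight_bounded u" and bf: "weight_bounded f" and bp: "weight_bounded (partial_dir e f)"
  shows "weight_bounded (partial_dir e u)" "x \<in> \<Omega> \<Longrightarrow> dbar (partial_dir e u) x = partial_dir e f x"
proof -
  have main: "\<exists>C. \<forall>x\<in>\<Omega>s n. cmod (partial_dir e u x) * \<nu> n x \<le> C \<and>
      dbar (partial_dir e u) x = partial_dir e f x" for n
  proof -
    obtain \<rho> where \<rho>: "\<forall>k. 0 < \<rho> k \<and>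
     (\<forall>x\<in>\<Omega>s k. \<exists>\<delta>>\<rho> k. \<forall>y\<in>frontier (\<Omega>s (Suc k)). \<delta> \<le> maxnorm (x - y)) \<and>
     (\<forall>n. \<exists>J1 J2 C1 C2. J1 \<ge> n \<and> J2 \<ge> n \<and> 0 < C1 \<and> 0 < C2 \<and>
        (\<forall>x\<in>\<Omega>s k.
           (\<forall>\<zeta> \<zeta>'. maxnorm \<zeta> \<le> \<rho> k \<longrightarrow> maxnorm \<zeta>' \<le> \<rho> k \<longrightarrow>
               \<nu> n (x + \<zeta>) \<le> C1 * \<nu> J1 (x + \<zeta>')) \<and>
           \<nu> n x \<le> C2 * (1 + (cmod x)^2) powi (-2) * \<nu> J2 x))"
      using condW unfolding condW_def ..
    note \<rho>n = spec[OF \<rho>, of n]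
    have r: "0 < \<rho> n" using \<rho>n ..
    have fr: "\<forall>x\<in>\<Omega>s n. \<exists>\<delta>>\<rho> n. \<forall>y\<in>frontier (\<Omega>s (Suc n)). \<delta> \<le> maxnorm (x - y)"
      using \<rho>n[THEN conjunct2, THEN conjunct1] .
    obtain J1 J2 C1 C2 where J: "J1 \<ge> n \<and> J2 \<ge> n \<and> 0 < C1 \<and> 0 < C2 \<and>
        (\<forall>x\<in>\<Omega>s n.
           (\<forall>\<zeta> \<zeta>'. maxnorm \<zeta> \<le> \<rho> n \<longrightarrow> maxnorm \<zeta>' \<le> \<rho> n \<longrightarrow>
               \<nu> n (x + \<zeta>) \<le> C1 * \<nu> J1 (x + \<zeta>')) \<and>
           \<nu> n x \<le> C2 * (1 + (cmod x)^2) powi (-2) * \<nu> J2 x)"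
      using spec[OF \<rho>n[THEN conjunct2, THEN conjunct2], of n] by (elim exE)
    have C1: "0 < C1" using J by blast
    have Jw: "\<nu> n x \<le> C1 * \<nu> J1 (x + \<zeta>)" if x: "x \<in> \<Omega>s n" and z: "maxnorm \<zeta> \<le> \<rho> n" for x \<zeta>
    proof -
      have "maxnorm 0 \<le> \<rho> n" using r by (simp add: maxnorm_def)
      then have "\<nu> n (x + 0) \<le> C1 * \<nu> J1 (x + \<zeta>)" using J x z by blast
      then show ?thesis by simp
    qed
    have mx: "maxnorm z \<le> cmod z" for z
      unfolding maxnorm_def using abs_Re_le_cmod abs_Im_le_cmod by simp
    \<comment> \<open>The max-norm is at most the modulus, so a Euclidean ball of radius
      \<open>\<rho> n\<close> also misses the frontier and, being connected, stays inside.\<close>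
    have sub: "cball x (\<rho> n) \<subseteq> \<Omega>s (Suc n)" if x: "x \<in> \<Omega>s n" for x
    proof -
      have "cball x (\<rho> n) \<inter> frontier (\<Omega>s (Suc n)) = {}"
      proof (rule equals0I)
        fix y assume y: "y \<in> cball x (\<rho> n) \<inter> frontier (\<Omega>s (Suc n))"
        then obtain \<delta> where "\<delta> > \<rho> n" "\<delta> \<le> maxnorm (x - y)" using fr x by blast
        then show False using mx[of "x - y"] y by (simp add: dist_norm)
      qed
      moreover have "x \<in> cball x (\<rho> n)" "x \<in> \<Omega>s (Suc n)" using r x Omega_mono[of n "Suc n"] by auto
      ultimately show ?thesis using connected_Int_frontier[OF connected_cball, of x _ "\<Omega>s (Suc n)"] by blast
    qed
    \<comment> \<open>\<open>Suc n\<close> is needed for the ball to lie in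
      \<open>\<Omega>s N\<close>, \<open>J1\<close> for the weight comparison.\<close>
    define N where "N = max J1 (Suc n)"
    obtain D1 D2 D3 where D: "\<forall>x\<in>\<Omega>s N. cmod (u x) * \<nu> N x \<le> D1" "\<forall>x\<in>\<Omega>s N. cmod (f x) * \<nu> N x \<le> D2"
      "\<forall>x\<in>\<Omega>s N. cmod (partial_dir e f x) * \<nu> N x \<le> D3"
      using bu bf bp unfolding weight_bounded_def by meson
    define D where "D = max 0 (max D1 (max D2 D3))"
    have D0: "0 \<le> D" unfolding D_def by simp
    have bnd: "cmod c \<le> D * C1 / \<nu> n x"
      if x: "x \<in> \<Omega>s n" and y: "y \<in> cball x (\<rho> n)" and c: "cmod c * \<nu> N y \<le> D" for x y c
    proof -
      have y1: "y \<in> \<Omega>s (Suc n)" using sub[OF x] y by blast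
      have "maxnorm (y - x) \<le> \<rho> n" using mx[of "y - x"] y by (simp add: dist_norm norm_minus_commute)
      from Jw[OF x this] have "\<nu> n x \<le> C1 * \<nu> J1 y" by simp
      also have "\<dots> \<le> C1 * \<nu> N y" using C1 nu_mono[OF y1, of J1 N] unfolding N_def by simp
      finally have "cmod c * \<nu> n x \<le> cmod c * (C1 * \<nu> N y)" by (rule mult_left_mono) simp
      also have "\<dots> = (cmod c * \<nu> N y) * C1" by simp
      also have "\<dots> \<le> D * C1" using c C1 by (intro mult_right_mono) auto
      finally show ?thesis using nu_pos[OF x, of n] by (simp add: field_simps)
    qed
    obtain A where A: "0 \<le> A" "\<And>U u f a e B. open U \<Longrightarrow> cball a (\<rho> n) \<subseteq> U \<Longrightarrow> Cinf_on U u \<Longrightarrow> Cinf_on U f \<Longrightarrow>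
     (\<And>x. x \<in> U \<Longrightarrow> dbar u x = f x) \<Longrightarrow> e \<in> {1, \<i>} \<Longrightarrow>
     (\<And>y. y \<in> cball a (\<rho> n) \<Longrightarrow> cmod (u y) \<le> B) \<Longrightarrow> (\<And>y. y \<in> cball a (\<rho> n) \<Longrightarrow> cmod (f y) \<le> B) \<Longrightarrow>
     (\<And>y. y \<in> cball a (\<rho> n) \<Longrightarrow> cmod (partial_dir e f y) \<le> B) \<Longrightarrow>
     cmod (partial_dir e u a) \<le> A * B \<and> dbar (partial_dir e u) a = partial_dir e f a"
      using derivative_estimate[OF r] by metis
    have "cmod (partial_dir e u x) * \<nu> n x \<le> A * (D * C1) \<and> dbar (partial_dir e u) x = partial_dir e f x"
      if x: "x \<in> \<Omega>s n" for x
    proof -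
      have NN: "cball x (\<rho> n) \<subseteq> \<Omega>s N" using sub[OF x] Omega_mono[of "Suc n" N] unfolding N_def by auto
      have "cmod (partial_dir e u x) \<le> A * (D * C1 / \<nu> n x) \<and> dbar (partial_dir e u) x = partial_dir e f x"
      proof (rule A(2)[OF Omega_open(1) _ u f du e])
        show "cball x (\<rho> n) \<subseteq> \<Omega>" using sub[OF x] Omega_sub by blast
        fix y assume y: "y \<in> cball x (\<rho> n)"
        then have yN: "y \<in> \<Omega>s N" using NN by blast
        show "cmod (u y) \<le> D * C1 / \<nu> n x"
          by (rule bnd[OF x y]) (use D(1) yN in \<open>force simp: D_def\<close>)
        show "cmod (f y) \<le> D * C1 / \<nu> n x"
          by (rule bnd[OF x y]) (use D(2) yN in \<open>force simp: D_def\<close>)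
        show "cmod (partial_dir e f y) \<le> D * C1 / \<nu> n x"
          by (rule bnd[OF x y]) (use D(3) yN in \<open>force simp: D_def\<close>)
      qed
      then show ?thesis using nu_pos[OF x, of n] by (simp add: field_simps)
    qed
    then show ?thesis by blast
  qed
  show "weight_bounded (partial_dir e u)" unfolding weight_bounded_def using main by meson
  show "dbar (partial_dir e u) x = partial_dir e f x" if "x \<in> \<Omega>" for x
    using main Omega_cover[OF that] by blast
qed

lemma dbar_surjective:
  assumes f: "f \<in> EV \<Omega> \<Omega>s \<nu>"
  shows "\<exists>u\<in>EV \<Omega> \<Omega>s \<nu>. \<forall>x\<in>\<Omega>. dbar u x = f x"
proof -
  have fC: "Cinf_on \<Omega> f" using f unfolding EV_def by blast
  have fb: "weight_bounded (partial_beta a b f)" for a b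
    unfolding weight_bounded_def
  proof
    fix n
    have "\<exists>C. \<forall>x\<in>\<Omega>s n. \<forall>a' b'. a' + b' \<le> a + b \<longrightarrow> cmod (partial_beta a' b' f x) * \<nu> n x \<le> C"
      using f unfolding EV_def in_Enu_def by blast
    then show "\<exists>C. \<forall>x\<in>\<Omega>s n. cmod (partial_beta a b f x) * \<nu> n x \<le> C" by blast
  qed
  have "weight_bounded f" using fb[of 0 0] by (simp add: partial_beta_def)
  then obtain u where u: "Cinf_on \<Omega> u" "\<And>x. x \<in> \<Omega> \<Longrightarrow> dbar u x = f x" "weight_bounded u"
    by (rule global_solution[OF fC]) blast
  have betaC: "Cinf_on \<Omega> (partial_beta a b h)" if "Cinf_on \<Omega> h" for a b h
    unfolding partial_beta_def by (rule Cinf_on_iter_partial[OF that]) auto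
  have beta1: "partial_beta (Suc a) b h = partial_dir 1 (partial_beta a b h)" for a b h
    unfolding partial_beta_def by simp
  have beta2: "partial_beta 0 (Suc b) h = partial_dir \<i> (partial_beta 0 b h)" for b h
    unfolding partial_beta_def by simp
  \<comment> \<open>\<open>partial_beta a b\<close> differentiates along \<open>\<i>\<close> first,
    so \<open>b\<close> is raised with \<open>a = 0\<close> and only then \<open>a\<close>.\<close>
  have "weight_bounded (partial_beta 0 b u) \<and> (\<forall>x\<in>\<Omega>. dbar (partial_beta 0 b u) x = partial_beta 0 b f x)" for b
  proof (induction b)
    case 0
    then show ?case using u by (simp add: partial_beta_def)
  next
    case (Suc b)
    have "weight_bounded (partial_dir \<i> (partial_beta 0 b f))" using fb[of 0 "Suc b"] unfolding beta2 .
    from weight_bounded_partial_dir[OF betaC[OF u(1)] betaC[OF fC] _ _ _ fb this] Suc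
    show ?case unfolding beta2 by blast
  qed
  note beta0 = this
  have beta: "weight_bounded (partial_beta a b u) \<and> (\<forall>x\<in>\<Omega>. dbar (partial_beta a b u) x = partial_beta a b f x)" for a b
  proof (induction a)
    case 0
    then show ?case by (rule beta0)
  next
    case (Suc a)
    have "weight_bounded (partial_dir 1 (partial_beta a b f))" using fb[of "Suc a" b] unfolding beta1 .
    from weight_bounded_partial_dir[OF betaC[OF u(1)] betaC[OF fC] _ _ _ fb this] Suc
    show ?case unfolding beta1 by blast
  qed
  have "in_Enu (\<nu> n) (\<Omega>s n) u" for n
    unfolding in_Enu_def
  proof (intro conjI allI)
    show "Cinf_on (\<Omega>s n) u" by (rule Cinf_on_subset[OF u(1) Omega_sub])
    fix m
    have "\<exists>C. \<forall>a b. \<forall>x\<in>\<Omega>s n. cmod (partial_beta a b u x) * \<nu> n x \<le> C a b"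
    proof -
      have "\<forall>a. \<exists>C. \<forall>b. \<forall>x\<in>\<Omega>s n. cmod (partial_beta a b u x) * \<nu> n x \<le> C b"
        using beta unfolding weight_bounded_def by (intro allI choice) blast
      then show ?thesis by (rule choice)
    qed
    then obtain C where C: "\<And>a b x. x \<in> \<Omega>s n \<Longrightarrow> cmod (partial_beta a b u x) * \<nu> n x \<le> C a b" by blast
    \<comment> \<open>Summing absolute values over the square of index pairs yields one constant for
      the finitely many orders up to \<open>m\<close>.\<close>
    have "cmod (partial_beta a b u x) * \<nu> n x \<le> (\<Sum>(a, b)\<in>{..m} \<times> {..m}. \<bar>C a b\<bar>)"
      if "x \<in> \<Omega>s n" "a + b \<le> m" for x a b
    proof -
      have "C a b \<le> (case (a, b) of (a, b) \<Rightarrow> \<bar>C a b\<bar>)" by simp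
      also have "\<dots> \<le> (\<Sum>(a, b)\<in>{..m} \<times> {..m}. \<bar>C a b\<bar>)"
        by (rule member_le_sum) (use that(2) in auto)
      finally show ?thesis using C[OF that(1), of a b] by linarith
    qed
    then show "\<exists>C. \<forall>x\<in>\<Omega>s n. \<forall>a b. a + b \<le> m \<longrightarrow> cmod (partial_beta a b u x) * \<nu> n x \<le> C" by blast
  qed
  then have "u \<in> EV \<Omega> \<Omega>s \<nu>" unfolding EV_def using u(1) by blast
  then show ?thesis using u(2) by blast
qed

end

theorem theorem4p8:
  fixes \<Omega> :: "complex set" and \<Omega>s :: "nat \<Rightarrow> complex set" and \<nu> :: "nat \<Rightarrow> complex \<Rightarrow> real"
  assumes "standing_setup \<Omega> \<Omega>s \<nu>"
    and "condW \<Omega>s \<nu>"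
    and "\<exists>g I1 I2 X R r I4. condD_a \<Omega>s \<nu> g I1 I2 X R r \<and> condD_b \<Omega>s \<nu> g I1 I4 \<and>
           condD_c \<Omega>s I1 I4 X \<and> (\<forall>n. I2 (I1 (I4 n)) \<ge> I1 (I4 (Suc n)))"
    and "\<forall>n. subharmonic_on \<Omega> (\<lambda>x. - ln (\<nu> n x))"
  shows "\<forall>f\<in>EV \<Omega> \<Omega>s \<nu>. \<exists>u\<in>EV \<Omega> \<Omega>s \<nu>. \<forall>x\<in>\<Omega>. dbar u x = f x"
proof -
  obtain g I1 I2 X R r I4 where "condD_a \<Omega>s \<nu> g I1 I2 X R r" "condD_b \<Omega>s \<nu> g I1 I4"
    "condD_c \<Omega>s I1 I4 X" "\<forall>n. I2 (I1 (I4 n)) \<ge> I1 (I4 (Suc n))"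
    using assms(3) by (elim exE conjE)
  then interpret weighted_dbar \<Omega> \<Omega>s \<nu> g I1 I2 X R r I4
    using assms(1,2) by unfold_locales auto
  show ?thesis using dbar_surjective by blast
qed

end
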